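(* Let $\Lambda$ be a row-finite $k$-graph with no sources, let $v\in\Lambda^0$, and let $\Lambda_I$ be the in-split of $\Lambda$ at $v$ with respect to a partition $v\Lambda^{\mathbf 1}=\mathcal E_1\cup\mathcal E_2$ into two nonempty sets satisfying the pairing condition. Let $\mathsf F$ be any field. Then there is a $\mathbb Z^k$-graded isomorphism of $\mathsf F$-algebras $$\pi:\mathrm{KP}_{\mathsf F}(\Lambda)\longrightarrow \mathrm{KP}_{\mathsf F}(\Lambda_I).$$ Consequently, $\mathrm{KP}_{\mathsf F}(\Lambda)$ and $\mathrm{KP}_{\mathsf F}(\Lambda_I)$ are graded Morita equivalent.
   Context: $\mathbb N=\{0,1,2,\dots\}$, and $\mathbf e_1,\dots,\mathbf e_k$ is the standard basis of $\mathbb N^k$. A $k$-graph is a countable small category $\Lambda$ with a functor $d:\Lambda\to\mathbb N^k$ (degree) such that whenever $d(\lambda)=\mathbf n+\mathbf m$ there are unique $\alpha,\beta$ with $d(\alpha)=\mathbf n$, $d(\beta)=\mathbf m$, $\lambda=\alpha\beta$. Range and source are $r,s$; $\lambda\mu$ is defined when $s(\lambda)=r(\mu)$. Put $\Lambda^{\mathbf n}=d^{-1}(\mathbf n)$ ($\Lambda^0$ is identified with the objects, called vertices), $u\Lambda^{\mathbf n}=r^{-1}(u)\cap\Lambda^{\mathbf n}$, $\Lambda^{\mathbf n}v=\Lambda^{\mathbf n}\cap s^{-1}(v)$, $\Lambda^{\mathbf 1}=\bigcup_{i=1}^k\Lambda^{\mathbf e_i}$ (edges), $v\Lambda^{\mathbf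 1}=\bigcup_i v\Lambda^{\mathbf e_i}$, $\Lambda^{\mathbf 1}v=\bigcup_i\Lambda^{\mathbf e_i}v$. $\Lambda$ is row-finite without sources if $0<|v\Lambda^{\mathbf n}|<\infty$ for all $v\in\Lambda^0,\mathbf n\in\mathbb N^k$. Kumjian--Pask algebra: with $\Lambda^{\neq0}=\Lambda\setminus\Lambda^0$, $\mathrm{KP}_{\mathsf F}(\Lambda)$ is the universal associative $\mathsf F$-algebra generated by $p_v$ ($v\in\Lambda^0$), $s_\lambda,s_{\lambda^*}$ ($\lambda\in\Lambda^{\neq 0}$) subject to: (KP1) $p_up_v=\delta_{u,v}p_u$; (KP2) $s_\lambda s_\mu=s_{\lambda\mu}$, $s_{\mu^*}s_{\lambda^*}=s_{(\lambda\mu)^*}$ if $s(\lambda)=r(\mu)$, $p_{r(\lambda)}s_\lambda=s_\lambda=s_\lambda p_{s(\lambda)}$, $p_{s(\lambda)}s_{\lambda^*}=s_{\lambda^*}=s_{\lambda^*}p_{r(\lambda)}$; (KP3) $s_{\lambda^*}s_\mu=\delta_{\lambda,\mu}p_{s(\lambda)}$ if $d(\lambda)=d(\mu)$; (KP4) $p_v=\sum_{\lambda\in v\Lambda^{\mathbf n}}s_\lambda s_{\lambda^*}$ for $\mathbf n\neq0$. It is $\mathbb Z^k$-graded with $\mathrm{KP}_{\mathsf F}(\Lambda)_{\mathbf n}=\mathrm{span}_{\mathsf F}\{s_\alpha s_{\beta^*}: s(\alpha)=s(\beta),\ d(\alpha)-d(\beta)=\mathbf n\}$ (with $s_v=s_{v^*}=p_v$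 for vertices). In-split: the pairing condition on the partition says that if $\lambda,\mu\in v\Lambda^{\mathbf 1}$ and $\lambda\alpha=\mu\beta$ for some $\alpha,\beta\in\Lambda^{\mathbf 1}$, then $\lambda,\mu$ lie in the same set $\mathcal E_j$. The $k$-graph $\Lambda_I$ has vertices $\Lambda_I^0=(\Lambda^0\setminus\{v\})\cup\{v^1,v^2\}$ and edges $\Lambda_I^{\mathbf 1}=(\Lambda^{\mathbf 1}\setminus\Lambda^{\mathbf 1}v)\cup\{f^1,f^2: f\in\Lambda^{\mathbf 1}v\}$. Parents: $par(v^i)=v$, $par(f^i)=f$, $par(x)=x$ otherwise. An edge $\alpha$ of $\Lambda_I$ has degree $d_I(\alpha)=d(par(\alpha))$; range $r_I(\alpha)=r(par(\alpha))$ if $r(par(\alpha))\ne v$, and $r_I(\alpha)=v^j$ if $par(\alpha)\in\mathcal E_j$; source $s_I(\alpha)=s(\alpha)$ if $\alpha\in\Lambda^{\mathbf 1}\setminus\Lambda^{\mathbf 1}v$ and $s_I(f^i)=v^i$. Extend $par$ multiplicatively to edge paths. $\Lambda_I$ is the path category of this coloured graph modulo identifying two edge paths with the same range, the same source and the same parent in $\Lambda$ (i.e. factorization in $\Lambda_I$ is determined by factorization of parents in $\Lambda$). This is a row-finite $k$-graph without sources. Two $\mathbb Z^k$-graded algebras (with local units) are graded Morita equivalent if their categories of (unital) graded modules are equivalent via an equivalence commuting with the shift functors. *)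

theory Defs
  imports
    "HOL-Analysis.Finite_Cartesian_Product"
    "HOL-Library.Poly_Mapping"
    "HOL-Library.FuncSet"
    "HOL-Library.Countable_Set"
begin

section \<open>Higher-rank graphs\<close>

text \<open>
  The rank is the cardinality of the index type \<open>'k\<close>; degrees live in \<open>nat ^ 'k\<close>.
  The product \<open>cmp \<Lambda> a b\<close> is only meaningful when \<open>src \<Lambda> a = rng \<Lambda> b\<close>.
\<close>

record ('v, 'a, 'k::finite) kgraph =
  obj :: "'v set"
  mor :: "'a set"
  rng :: "'a \<Rightarrow> 'v"
  src :: "'a \<Rightarrow> 'v"
  idm :: "'v \<Rightarrow> 'a"
  cmp :: "'a \<Rightarrow> 'a \<Rightarrow> 'a"
  deg :: "'a \<Rightarrow> nat ^ 'k"

locale k_graph =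
  fixes \<Lambda> :: "('v, 'a, 'k::finite) kgraph"
  assumes countable_mor: "countable (mor \<Lambda>)"
    and rng_obj: "a \<in> mor \<Lambda> \<Longrightarrow> rng \<Lambda> a \<in> obj \<Lambda>"
    and src_obj: "a \<in> mor \<Lambda> \<Longrightarrow> src \<Lambda> a \<in> obj \<Lambda>"
    and idm_mor: "u \<in> obj \<Lambda> \<Longrightarrow> idm \<Lambda> u \<in> mor \<Lambda>"
    and rng_idm: "u \<in> obj \<Lambda> \<Longrightarrow> rng \<Lambda> (idm \<Lambda> u) = u"
    and src_idm: "u \<in> obj \<Lambda> \<Longrightarrow> src \<Lambda> (idm \<Lambda> u) = u"
    and cmp_mor: "\<lbrakk>a \<in> mor \<Lambda>; b \<in> mor \<Lambda>; src \<Lambda> a = rng \<Lambda> b\<rbrakk> \<Longrightarrow> cmp \<Lambda> a b \<in> mor \<Lambda>"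
    and rng_cmp: "\<lbrakk>a \<in> mor \<Lambda>; b \<in> mor \<Lambda>; src \<Lambda> a = rng \<Lambda> b\<rbrakk>
          \<Longrightarrow> rng \<Lambda> (cmp \<Lambda> a b) = rng \<Lambda> a"
    and src_cmp: "\<lbrakk>a \<in> mor \<Lambda>; b \<in> mor \<Lambda>; src \<Lambda> a = rng \<Lambda> b\<rbrakk>
          \<Longrightarrow> src \<Lambda> (cmp \<Lambda> a b) = src \<Lambda> b"
    and cmp_idm_left: "a \<in> mor \<Lambda> \<Longrightarrow> cmp \<Lambda> (idm \<Lambda> (rng \<Lambda> a)) a = a"
    and cmp_idm_right: "a \<in> mor \<Lambda> \<Longrightarrow> cmp \<Lambda> a (idm \<Lambda> (src \<Lambda> a)) = a"
    and cmp_assoc: "\<lbrakk>a \<in> mor \<Lambda>; b \<in> mor \<Lambda>; c \<in> mor \<Lambda>;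
            src \<Lambda> a = rng \<Lambda> b; src \<Lambda> b = rng \<Lambda> c\<rbrakk>
          \<Longrightarrow> cmp \<Lambda> (cmp \<Lambda> a b) c = cmp \<Lambda> a (cmp \<Lambda> b c)"
    and deg_idm: "u \<in> obj \<Lambda> \<Longrightarrow> deg \<Lambda> (idm \<Lambda> u) = 0"
    and deg_cmp: "\<lbrakk>a \<in> mor \<Lambda>; b \<in> mor \<Lambda>; src \<Lambda> a = rng \<Lambda> b\<rbrakk>
          \<Longrightarrow> deg \<Lambda> (cmp \<Lambda> a b) = deg \<Lambda> a + deg \<Lambda> b"
    and factorization: "\<lbrakk>l \<in> mor \<Lambda>; deg \<Lambda> l = n + m\<rbrakk>
          \<Longrightarrow> \<exists>!(a, b). a \<in> mor \<Lambda> \<and> b \<in> mor \<Lambda> \<and> src \<Lambda> a = rng \<Lambda> b \<and>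
                deg \<Lambda> a = n \<and> deg \<Lambda> b = m \<and> l = cmp \<Lambda> a b"

definition paths_from ::
  "('v, 'a, 'k::finite) kgraph \<Rightarrow> 'v \<Rightarrow> nat ^ 'k \<Rightarrow> 'a set" where
  "paths_from \<Lambda> u n = {a \<in> mor \<Lambda>. rng \<Lambda> a = u \<and> deg \<Lambda> a = n}"

definition row_finite_no_sources :: "('v, 'a, 'k::finite) kgraph \<Rightarrow> bool" where
  "row_finite_no_sources \<Lambda> \<longleftrightarrow>
     (\<forall>u\<in>obj \<Lambda>. \<forall>n. finite (paths_from \<Lambda> u n) \<and> paths_from \<Lambda> u n \<noteq> {})"

definition edges :: "('v, 'a, 'k::finite) kgraph \<Rightarrow> 'a set" where
  "edges \<Lambda> = {a \<in> mor \<Lambda>. \<exists>i. deg \<Lambda> a = axis i 1}"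


section \<open>In-splits\<close>

definition insplit_partition ::
  "('v, 'a, 'k::finite) kgraph \<Rightarrow> 'v \<Rightarrow> 'a set \<Rightarrow> 'a set \<Rightarrow> bool" where
  "insplit_partition \<Lambda> v E1 E2 \<longleftrightarrow>
     E1 \<union> E2 = {a \<in> edges \<Lambda>. rng \<Lambda> a = v} \<and> E1 \<inter> E2 = {} \<and> E1 \<noteq> {} \<and> E2 \<noteq> {} \<and>
     (\<forall>l m a b. l \<in> edges \<Lambda> \<and> rng \<Lambda> l = v \<and> m \<in> edges \<Lambda> \<and> rng \<Lambda> m = v \<and>
        a \<in> edges \<Lambda> \<and> b \<in> edges \<Lambda> \<and> src \<Lambda> l = rng \<Lambda> a \<and> src \<Lambda> m = rng \<Lambda> b \<and>
        cmp \<Lambda> l a = cmp \<Lambda> m b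
        \<longrightarrow> (l \<in> E1 \<and> m \<in> E1) \<or> (l \<in> E2 \<and> m \<in> E2))"

text \<open>
  Vertices and edges of the split graph: \<open>Copy v i\<close> is $v^i$, \<open>Copy f i\<close> is $f^i$
  (\<open>i \<in> {1, 2}\<close>), and \<open>Keep x\<close> is an unsplit vertex or edge \<open>x\<close>.
\<close>

datatype 'x split = Keep (par: 'x) | Copy (par: 'x) nat

definition split_obj :: "('v, 'a, 'k::finite) kgraph \<Rightarrow> 'v \<Rightarrow> 'v split set" where
  "split_obj \<Lambda> v = Keep ` (obj \<Lambda> - {v}) \<union> {Copy v 1, Copy v 2}"

definition split_edges :: "('v, 'a, 'k::finite) kgraph \<Rightarrow> 'v \<Rightarrow> 'a split set" where
  "split_edges \<Lambda> v =
     Keep ` {f \<in> edges \<Lambda>. src \<Lambda> f \<noteq> v} \<union>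
     {Copy f i | f i. f \<in> edges \<Lambda> \<and> src \<Lambda> f = v \<and> i \<in> {1, 2}}"

text \<open>
  Only the first block \<open>E1\<close> of the partition is a parameter; the edges with range \<open>v\<close>
  outside \<open>E1\<close> are those of the second block.
\<close>

definition split_rng ::
  "('v, 'a, 'k::finite) kgraph \<Rightarrow> 'v \<Rightarrow> 'a set \<Rightarrow> 'a split \<Rightarrow> 'v split" where
  "split_rng \<Lambda> v E1 e =
     (if rng \<Lambda> (par e) \<noteq> v then Keep (rng \<Lambda> (par e))
      else if par e \<in> E1 then Copy v 1 else Copy v 2)"

fun split_src :: "('v, 'a, 'k::finite) kgraph \<Rightarrow> 'v \<Rightarrow> 'a split \<Rightarrow> 'v split" where
  "split_src \<Lambda> v (Keep f) = Keep (src \<Lambda> f)"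
| "split_src \<Lambda> v (Copy f i) = Copy v i"

text \<open>
  An edge path is a range vertex together with a list of edges, so that every vertex has its own
  empty path.
\<close>

type_synonym ('v, 'a) epath = "'v split \<times> 'a split list"

fun is_epath ::
  "('v, 'a, 'k::finite) kgraph \<Rightarrow> 'v \<Rightarrow> 'a set \<Rightarrow> ('v, 'a) epath \<Rightarrow> bool" where
  "is_epath \<Lambda> v E1 (w, []) \<longleftrightarrow> w \<in> split_obj \<Lambda> v"
| "is_epath \<Lambda> v E1 (w, e # es) \<longleftrightarrow>
     e \<in> split_edges \<Lambda> v \<and> split_rng \<Lambda> v E1 e = w \<and> is_epath \<Lambda> v E1 (split_src \<Lambda> v e, es)"

fun epath_src :: "('v, 'a, 'k::finite) kgraph \<Rightarrow> 'v \<Rightarrow> ('v, 'a) epath \<Rightarrow> 'v split" where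
  "epath_src \<Lambda> v (w, es) = (if es = [] then w else split_src \<Lambda> v (last es))"

fun epath_par :: "('v, 'a, 'k::finite) kgraph \<Rightarrow> 'v \<Rightarrow> ('v, 'a) epath \<Rightarrow> 'a" where
  "epath_par \<Lambda> v (w, []) = idm \<Lambda> (par w)"
| "epath_par \<Lambda> v (w, e # es) = cmp \<Lambda> (par e) (epath_par \<Lambda> v (split_src \<Lambda> v e, es))"

definition epath_deg :: "('v, 'a, 'k::finite) kgraph \<Rightarrow> ('v, 'a) epath \<Rightarrow> nat ^ 'k" where
  "epath_deg \<Lambda> p = (\<Sum>e\<leftarrow>snd p. deg \<Lambda> (par e))"

definition epath_cmp :: "('v, 'a) epath \<Rightarrow> ('v, 'a) epath \<Rightarrow> ('v, 'a) epath" where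
  "epath_cmp p q = (fst p, snd p @ snd q)"

definition epath_rel ::
  "('v, 'a, 'k::finite) kgraph \<Rightarrow> 'v \<Rightarrow> 'a set \<Rightarrow> (('v, 'a) epath \<times> ('v, 'a) epath) set" where
  "epath_rel \<Lambda> v E1 =
     {(p, q). is_epath \<Lambda> v E1 p \<and> is_epath \<Lambda> v E1 q \<and> fst p = fst q \<and>
        epath_src \<Lambda> v p = epath_src \<Lambda> v q \<and> epath_par \<Lambda> v p = epath_par \<Lambda> v q}"

text \<open>
  The morphisms of the in-split are the classes of edge paths; range, source and degree are constant
  on classes, and products are classes of concatenations of representatives.
\<close>

definition insplit ::
  "('v, 'a, 'k::finite) kgraph \<Rightarrow> 'v \<Rightarrow> 'a set
     \<Rightarrow> ('v split, ('v, 'a) epath set, 'k) kgraph" where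
  "insplit \<Lambda> v E1 =
     \<lparr> obj = split_obj \<Lambda> v,
       mor = {p. is_epath \<Lambda> v E1 p} // epath_rel \<Lambda> v E1,
       rng = (\<lambda>X. the_elem (fst ` X)),
       src = (\<lambda>X. the_elem (epath_src \<Lambda> v ` X)),
       idm = (\<lambda>w. epath_rel \<Lambda> v E1 `` {(w, [])}),
       cmp = (\<lambda>X Y. \<Union>p\<in>X. \<Union>q\<in>Y. epath_rel \<Lambda> v E1 `` {epath_cmp p q}),
       deg = (\<lambda>X. the_elem (epath_deg \<Lambda> ` X)) \<rparr>"


section \<open>Vector spaces and graded algebras with explicit carriers\<close>

text \<open>
  The algebras below have no identity element in general, so the rings of HOL-Algebra, which are
  unital, do not apply.
\<close>

record ('f, 'x) vspace =
  vcarrier :: "'x set"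
  vzero :: 'x
  vadd :: "'x \<Rightarrow> 'x \<Rightarrow> 'x"
  vscale :: "'f \<Rightarrow> 'x \<Rightarrow> 'x"

record ('f, 'x) falgebra = "('f, 'x) vspace" +
  amult :: "'x \<Rightarrow> 'x \<Rightarrow> 'x"

record ('f, 'x, 'k::finite) galgebra = "('f, 'x) falgebra" +
  acomp :: "int ^ 'k \<Rightarrow> 'x set"

definition is_vspace :: "('f::field, 'x, 'z) vspace_scheme \<Rightarrow> bool" where
  "is_vspace V \<longleftrightarrow>
     vzero V \<in> vcarrier V \<and>
     (\<forall>x\<in>vcarrier V. \<forall>y\<in>vcarrier V. vadd V x y \<in> vcarrier V \<and> vadd V x y = vadd V y x) \<and>
     (\<forall>c. \<forall>x\<in>vcarrier V. vscale V c x \<in> vcarrier V) \<and>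
     (\<forall>x\<in>vcarrier V. \<forall>y\<in>vcarrier V. \<forall>z\<in>vcarrier V.
        vadd V (vadd V x y) z = vadd V x (vadd V y z)) \<and>
     (\<forall>x\<in>vcarrier V. vadd V (vzero V) x = x) \<and>
     (\<forall>x\<in>vcarrier V. \<exists>y\<in>vcarrier V. vadd V y x = vzero V) \<and>
     (\<forall>c. \<forall>x\<in>vcarrier V. \<forall>y\<in>vcarrier V.
        vscale V c (vadd V x y) = vadd V (vscale V c x) (vscale V c y)) \<and>
     (\<forall>c d. \<forall>x\<in>vcarrier V. vscale V (c + d) x = vadd V (vscale V c x) (vscale V d x)) \<and>
     (\<forall>c d. \<forall>x\<in>vcarrier V. vscale V (c * d) x = vscale V c (vscale V d x)) \<and>
     (\<forall>x\<in>vcarrier V. vscale V 1 x = x)"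

inductive_set vspan :: "('f, 'x, 'z) vspace_scheme \<Rightarrow> 'x set \<Rightarrow> 'x set"
  for V :: "('f, 'x, 'z) vspace_scheme" and S :: "'x set" where
  zero: "vzero V \<in> vspan V S"
| base: "x \<in> S \<Longrightarrow> x \<in> vspan V S"
| add: "\<lbrakk>x \<in> vspan V S; y \<in> vspan V S\<rbrakk> \<Longrightarrow> vadd V x y \<in> vspan V S"
| scale: "x \<in> vspan V S \<Longrightarrow> vscale V c x \<in> vspan V S"

definition vsubspace :: "('f, 'x, 'z) vspace_scheme \<Rightarrow> 'x set \<Rightarrow> bool" where
  "vsubspace V S \<longleftrightarrow> S \<subseteq> vcarrier V \<and> vspan V S = S"

definition vlinear ::
  "('f, 'x, 'z) vspace_scheme \<Rightarrow> ('f, 'y, 'w) vspace_scheme \<Rightarrow> ('x \<Rightarrow> 'y) \<Rightarrow> bool" where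
  "vlinear V W h \<longleftrightarrow>
     (\<forall>x\<in>vcarrier V. h x \<in> vcarrier W) \<and>
     (\<forall>x\<in>vcarrier V. \<forall>y\<in>vcarrier V. h (vadd V x y) = vadd W (h x) (h y)) \<and>
     (\<forall>c. \<forall>x\<in>vcarrier V. h (vscale V c x) = vscale W c (h x))"

definition direct_sum :: "('f, 'x, 'z) vspace_scheme \<Rightarrow> ('i \<Rightarrow> 'x set) \<Rightarrow> bool" where
  "direct_sum V C \<longleftrightarrow>
     (\<forall>n. vsubspace V (C n)) \<and> vspan V (\<Union>n. C n) = vcarrier V \<and>
     (\<forall>ns c. distinct ns \<and> (\<forall>n\<in>set ns. c n \<in> C n) \<and>
        foldr (\<lambda>n. vadd V (c n)) ns (vzero V) = vzero V \<longrightarrow> (\<forall>n\<in>set ns. c n = vzero V))"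

definition graded_algebra_iso ::
  "('f, 'x, 'k::finite) galgebra \<Rightarrow> ('f, 'y, 'k) galgebra \<Rightarrow> ('x \<Rightarrow> 'y) \<Rightarrow> bool" where
  "graded_algebra_iso A B h \<longleftrightarrow>
     bij_betw h (vcarrier A) (vcarrier B) \<and> vlinear A B h \<and>
     (\<forall>x\<in>vcarrier A. \<forall>y\<in>vcarrier A. h (amult A x y) = amult B (h x) (h y)) \<and>
     (\<forall>n. h ` acomp A n = acomp B n)"


section \<open>Algebras given by generators and relations\<close>

datatype 'g gword = Word (letters: "'g list")

instantiation gword :: (type) monoid_add
begin

definition zero_gword :: "'g gword" where
  "zero_gword = Word []"

definition plus_gword :: "'g gword \<Rightarrow> 'g gword \<Rightarrow> 'g gword" where
  "plus_gword u w = Word (letters u @ letters w)"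

instance
  by standard (simp_all add: zero_gword_def plus_gword_def)

end

text \<open>
  With concatenation as addition on words, finitely supported functions on words form the free
  unital algebra.  The free algebra without unit consists of those functions that vanish on the
  empty word.
\<close>

type_synonym ('f, 'g) free_elem = "'g gword \<Rightarrow>\<^sub>0 'f"

definition free_gen :: "'g \<Rightarrow> ('f::field, 'g) free_elem" where
  "free_gen g = Poly_Mapping.single (Word [g]) 1"

definition free_scale :: "'f::field \<Rightarrow> ('f, 'g) free_elem \<Rightarrow> ('f, 'g) free_elem" where
  "free_scale c x = Poly_Mapping.single 0 c * x"

definition free_carrier :: "'g set \<Rightarrow> ('f::field, 'g) free_elem set" where
  "free_carrier G =
     {x. \<forall>w\<in>Poly_Mapping.keys x. letters w \<noteq> [] \<and> set (letters w) \<subseteq> G}"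

inductive_set rel_ideal ::
  "'g set \<Rightarrow> ('f::field, 'g) free_elem set \<Rightarrow> ('f, 'g) free_elem set"
  for G :: "'g set" and R :: "('f, 'g) free_elem set" where
  zero: "0 \<in> rel_ideal G R"
| base: "x \<in> R \<Longrightarrow> x \<in> rel_ideal G R"
| add: "\<lbrakk>x \<in> rel_ideal G R; y \<in> rel_ideal G R\<rbrakk> \<Longrightarrow> x + y \<in> rel_ideal G R"
| scale: "x \<in> rel_ideal G R \<Longrightarrow> free_scale c x \<in> rel_ideal G R"
| left: "\<lbrakk>x \<in> rel_ideal G R; a \<in> free_carrier G\<rbrakk> \<Longrightarrow> a * x \<in> rel_ideal G R"
| right: "\<lbrakk>x \<in> rel_ideal G R; a \<in> free_carrier G\<rbrakk> \<Longrightarrow> x * a \<in> rel_ideal G R"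

definition ideal_rel ::
  "'g set \<Rightarrow> ('f::field, 'g) free_elem set \<Rightarrow> (('f, 'g) free_elem \<times> ('f, 'g) free_elem) set" where
  "ideal_rel G R = {(x, y). x \<in> free_carrier G \<and> y \<in> free_carrier G \<and> x - y \<in> rel_ideal G R}"

text \<open>The universal associative algebra on the generators \<open>G\<close> subject to \<open>x = 0\<close> for \<open>x \<in> R\<close>.\<close>

definition presented_algebra ::
  "'g set \<Rightarrow> ('f::field, 'g) free_elem set \<Rightarrow> ('f, ('f, 'g) free_elem set) falgebra" where
  "presented_algebra G R =
     \<lparr> vcarrier = free_carrier G // ideal_rel G R,
       vzero = ideal_rel G R `` {0},
       vadd = (\<lambda>X Y. \<Union>x\<in>X. \<Union>y\<in>Y. ideal_rel G R `` {x + y}),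
       vscale = (\<lambda>c X. \<Union>x\<in>X. ideal_rel G R `` {free_scale c x}),
       amult = (\<lambda>X Y. \<Union>x\<in>X. \<Union>y\<in>Y. ideal_rel G R `` {x * y}) \<rparr>"


section \<open>Kumjian--Pask algebras\<close>

datatype ('v, 'a) kp_gen = Vtx 'v | Path 'a | Ghost 'a

definition kp_gens :: "('v, 'a, 'k::finite) kgraph \<Rightarrow> ('v, 'a) kp_gen set" where
  "kp_gens \<Lambda> = Vtx ` obj \<Lambda> \<union>
     Path ` {l \<in> mor \<Lambda>. deg \<Lambda> l \<noteq> 0} \<union> Ghost ` {l \<in> mor \<Lambda>. deg \<Lambda> l \<noteq> 0}"

abbreviation kp_p :: "'v \<Rightarrow> ('f::field, ('v, 'a) kp_gen) free_elem" where
  "kp_p u \<equiv> free_gen (Vtx u)"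

abbreviation kp_s :: "'a \<Rightarrow> ('f::field, ('v, 'a) kp_gen) free_elem" where
  "kp_s l \<equiv> free_gen (Path l)"

abbreviation kp_t :: "'a \<Rightarrow> ('f::field, ('v, 'a) kp_gen) free_elem" where
  "kp_t l \<equiv> free_gen (Ghost l)"

text \<open>A relation \<open>x = y\<close> is represented by the element \<open>x - y\<close>; \<open>kp_t l\<close> stands for $s_{l^*}$.\<close>

inductive_set kp_rels ::
  "('v, 'a, 'k::finite) kgraph \<Rightarrow> ('f::field, ('v, 'a) kp_gen) free_elem set"
  for \<Lambda> :: "('v, 'a, 'k::finite) kgraph" where
  KP1: "\<lbrakk>u \<in> obj \<Lambda>; w \<in> obj \<Lambda>\<rbrakk> \<Longrightarrow>
     kp_p u * kp_p w - (if u = w then kp_p u else 0) \<in> kp_rels \<Lambda>"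
| KP2_path: "\<lbrakk>l \<in> mor \<Lambda>; m \<in> mor \<Lambda>; deg \<Lambda> l \<noteq> 0; deg \<Lambda> m \<noteq> 0; src \<Lambda> l = rng \<Lambda> m\<rbrakk> \<Longrightarrow>
     kp_s l * kp_s m - kp_s (cmp \<Lambda> l m) \<in> kp_rels \<Lambda>"
| KP2_ghost: "\<lbrakk>l \<in> mor \<Lambda>; m \<in> mor \<Lambda>; deg \<Lambda> l \<noteq> 0; deg \<Lambda> m \<noteq> 0; src \<Lambda> l = rng \<Lambda> m\<rbrakk> \<Longrightarrow>
     kp_t m * kp_t l - kp_t (cmp \<Lambda> l m) \<in> kp_rels \<Lambda>"
| KP2_rng_path: "\<lbrakk>l \<in> mor \<Lambda>; deg \<Lambda> l \<noteq> 0\<rbrakk> \<Longrightarrow>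
     kp_p (rng \<Lambda> l) * kp_s l - kp_s l \<in> kp_rels \<Lambda>"
| KP2_path_src: "\<lbrakk>l \<in> mor \<Lambda>; deg \<Lambda> l \<noteq> 0\<rbrakk> \<Longrightarrow>
     kp_s l * kp_p (src \<Lambda> l) - kp_s l \<in> kp_rels \<Lambda>"
| KP2_src_ghost: "\<lbrakk>l \<in> mor \<Lambda>; deg \<Lambda> l \<noteq> 0\<rbrakk> \<Longrightarrow>
     kp_p (src \<Lambda> l) * kp_t l - kp_t l \<in> kp_rels \<Lambda>"
| KP2_ghost_rng: "\<lbrakk>l \<in> mor \<Lambda>; deg \<Lambda> l \<noteq> 0\<rbrakk> \<Longrightarrow>
     kp_t l * kp_p (rng \<Lambda> l) - kp_t l \<in> kp_rels \<Lambda>"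
| KP3: "\<lbrakk>l \<in> mor \<Lambda>; m \<in> mor \<Lambda>; deg \<Lambda> l \<noteq> 0; deg \<Lambda> l = deg \<Lambda> m\<rbrakk> \<Longrightarrow>
     kp_t l * kp_s m - (if l = m then kp_p (src \<Lambda> l) else 0) \<in> kp_rels \<Lambda>"
| KP4: "\<lbrakk>u \<in> obj \<Lambda>; n \<noteq> 0\<rbrakk> \<Longrightarrow>
     kp_p u - (\<Sum>l\<in>paths_from \<Lambda> u n. kp_s l * kp_t l) \<in> kp_rels \<Lambda>"

definition kp_algebra ::
  "'f::field itself \<Rightarrow> ('v, 'a, 'k::finite) kgraph
     \<Rightarrow> ('f, ('f, ('v, 'a) kp_gen) free_elem set) falgebra" where
  "kp_algebra F \<Lambda> = presented_algebra (kp_gens \<Lambda>) (kp_rels \<Lambda>)"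

definition kp_class ::
  "('v, 'a, 'k::finite) kgraph \<Rightarrow> ('f::field, ('v, 'a) kp_gen) free_elem
     \<Rightarrow> ('f, ('v, 'a) kp_gen) free_elem set" where
  "kp_class \<Lambda> x = ideal_rel (kp_gens \<Lambda>) (kp_rels \<Lambda>) `` {x}"

text \<open>
  The elements $s_\lambda$ and $s_{\lambda^*}$ for arbitrary morphisms, equal to $p_u$ if $\lambda$
  is the identity of $u$ (a morphism of a k-graph is an identity iff its degree is 0).
\<close>

definition path_elem ::
  "('v, 'a, 'k::finite) kgraph \<Rightarrow> 'a \<Rightarrow> ('f::field, ('v, 'a) kp_gen) free_elem set" where
  "path_elem \<Lambda> l = kp_class \<Lambda> (if deg \<Lambda> l = 0 then kp_p (rng \<Lambda> l) else kp_s l)"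

definition ghost_elem ::
  "('v, 'a, 'k::finite) kgraph \<Rightarrow> 'a \<Rightarrow> ('f::field, ('v, 'a) kp_gen) free_elem set" where
  "ghost_elem \<Lambda> l = kp_class \<Lambda> (if deg \<Lambda> l = 0 then kp_p (rng \<Lambda> l) else kp_t l)"

definition int_deg :: "nat ^ 'k::finite \<Rightarrow> int ^ 'k" where
  "int_deg n = (\<chi> i. int (n $ i))"

definition KP ::
  "'f::field itself \<Rightarrow> ('v, 'a, 'k::finite) kgraph
     \<Rightarrow> ('f, ('f, ('v, 'a) kp_gen) free_elem set, 'k) galgebra" where
  "KP F \<Lambda> = falgebra.extend (kp_algebra F \<Lambda>)
     (galgebra.fields (\<lambda>n. vspan (kp_algebra F \<Lambda>)
        {amult (kp_algebra F \<Lambda>) (path_elem \<Lambda> a) (ghost_elem \<Lambda> b) | a b.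
           a \<in> mor \<Lambda> \<and> b \<in> mor \<Lambda> \<and> src \<Lambda> a = src \<Lambda> b \<and>
           int_deg (deg \<Lambda> a) - int_deg (deg \<Lambda> b) = n}))"


section \<open>Categories, functors and equivalences\<close>

text \<open>\<open>Comp C X Y Z g f\<close> is the composite of \<open>f : X \<rightarrow> Y\<close> and \<open>g : Y \<rightarrow> Z\<close>.\<close>

record ('o, 'm) hcat =
  Ob :: "'o set"
  Hom :: "'o \<Rightarrow> 'o \<Rightarrow> 'm set"
  Ident :: "'o \<Rightarrow> 'm"
  Comp :: "'o \<Rightarrow> 'o \<Rightarrow> 'o \<Rightarrow> 'm \<Rightarrow> 'm \<Rightarrow> 'm"

record ('o, 'm, 'p, 'q) hfunctor =
  fob :: "'o \<Rightarrow> 'p"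
  fmor :: "'o \<Rightarrow> 'o \<Rightarrow> 'm \<Rightarrow> 'q"

definition is_functor ::
  "('o, 'm) hcat \<Rightarrow> ('p, 'q) hcat \<Rightarrow> ('o, 'm, 'p, 'q) hfunctor \<Rightarrow> bool" where
  "is_functor C D F \<longleftrightarrow>
     (\<forall>X\<in>Ob C. fob F X \<in> Ob D \<and> fmor F X X (Ident C X) = Ident D (fob F X)) \<and>
     (\<forall>X\<in>Ob C. \<forall>Y\<in>Ob C. \<forall>f\<in>Hom C X Y. fmor F X Y f \<in> Hom D (fob F X) (fob F Y)) \<and>
     (\<forall>X\<in>Ob C. \<forall>Y\<in>Ob C. \<forall>Z\<in>Ob C. \<forall>f\<in>Hom C X Y. \<forall>g\<in>Hom C Y Z.
        fmor F X Z (Comp C X Y Z g f) =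
        Comp D (fob F X) (fob F Y) (fob F Z) (fmor F Y Z g) (fmor F X Y f))"

definition functor_id :: "('o, 'm, 'o, 'm) hfunctor" where
  "functor_id = \<lparr> fob = (\<lambda>X. X), fmor = (\<lambda>X Y f. f) \<rparr>"

definition functor_comp ::
  "('p, 'q, 'r, 's) hfunctor \<Rightarrow> ('o, 'm, 'p, 'q) hfunctor \<Rightarrow> ('o, 'm, 'r, 's) hfunctor" where
  "functor_comp G F =
     \<lparr> fob = (\<lambda>X. fob G (fob F X)),
       fmor = (\<lambda>X Y f. fmor G (fob F X) (fob F Y) (fmor F X Y f)) \<rparr>"

definition functor_eq ::
  "('o, 'm) hcat \<Rightarrow> ('o, 'm, 'p, 'q) hfunctor \<Rightarrow> ('o, 'm, 'p, 'q) hfunctor \<Rightarrow> bool" where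
  "functor_eq C F G \<longleftrightarrow>
     (\<forall>X\<in>Ob C. fob F X = fob G X) \<and>
     (\<forall>X\<in>Ob C. \<forall>Y\<in>Ob C. \<forall>f\<in>Hom C X Y. fmor F X Y f = fmor G X Y f)"

definition naturally_isomorphic ::
  "('o, 'm) hcat \<Rightarrow> ('p, 'q) hcat \<Rightarrow> ('o, 'm, 'p, 'q) hfunctor \<Rightarrow> ('o, 'm, 'p, 'q) hfunctor
     \<Rightarrow> bool" where
  "naturally_isomorphic C D F G \<longleftrightarrow> (\<exists>\<eta>.
     (\<forall>X\<in>Ob C. \<eta> X \<in> Hom D (fob F X) (fob G X) \<and>
        (\<exists>h\<in>Hom D (fob G X) (fob F X).
           Comp D (fob F X) (fob G X) (fob F X) h (\<eta> X) = Ident D (fob F X) \<and>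
           Comp D (fob G X) (fob F X) (fob G X) (\<eta> X) h = Ident D (fob G X))) \<and>
     (\<forall>X\<in>Ob C. \<forall>Y\<in>Ob C. \<forall>f\<in>Hom C X Y.
        Comp D (fob F X) (fob F Y) (fob G Y) (\<eta> Y) (fmor F X Y f) =
        Comp D (fob F X) (fob G X) (fob G Y) (fmor G X Y f) (\<eta> X)))"


section \<open>Graded modules and graded Morita equivalence\<close>

text \<open>Right modules; carriers are sets of elements of type \<open>'u\<close>.\<close>

record ('f, 'u, 'x, 'k::finite) grmodule = "('f, 'u) vspace" +
  act :: "'u \<Rightarrow> 'x \<Rightarrow> 'u"
  mcomp :: "int ^ 'k \<Rightarrow> 'u set"

definition is_graded_module ::
  "('f::field, 'x, 'k::finite) galgebra \<Rightarrow> ('f, 'u, 'x, 'k) grmodule \<Rightarrow> bool" where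
  "is_graded_module A M \<longleftrightarrow>
     is_vspace M \<and>
     (\<forall>m\<in>vcarrier M. \<forall>a\<in>vcarrier A. act M m a \<in> vcarrier M) \<and>
     (\<forall>m\<in>vcarrier M. \<forall>m'\<in>vcarrier M. \<forall>a\<in>vcarrier A.
        act M (vadd M m m') a = vadd M (act M m a) (act M m' a)) \<and>
     (\<forall>m\<in>vcarrier M. \<forall>a\<in>vcarrier A. \<forall>b\<in>vcarrier A.
        act M m (vadd A a b) = vadd M (act M m a) (act M m b)) \<and>
     (\<forall>c. \<forall>m\<in>vcarrier M. \<forall>a\<in>vcarrier A.
        act M (vscale M c m) a = vscale M c (act M m a) \<and>
        act M m (vscale A c a) = vscale M c (act M m a)) \<and>
     (\<forall>m\<in>vcarrier M. \<forall>a\<in>vcarrier A. \<forall>b\<in>vcarrier A.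
        act M (act M m a) b = act M m (amult A a b)) \<and>
     direct_sum M (mcomp M) \<and>
     (\<forall>i j. \<forall>m\<in>mcomp M i. \<forall>a\<in>acomp A j. act M m a \<in> mcomp M (i + j))"

definition unital_module ::
  "('f, 'x, 'k::finite) galgebra \<Rightarrow> ('f, 'u, 'x, 'k) grmodule \<Rightarrow> bool" where
  "unital_module A M \<longleftrightarrow>
     vspan M {act M m a | m a. m \<in> vcarrier M \<and> a \<in> vcarrier A} = vcarrier M"

definition graded_hom ::
  "('f, 'x, 'k::finite) galgebra \<Rightarrow> ('f, 'u, 'x, 'k) grmodule \<Rightarrow> ('f, 'u, 'x, 'k) grmodule
     \<Rightarrow> ('u \<Rightarrow> 'u) set" where
  "graded_hom A M N =
     {h. h \<in> extensional (vcarrier M) \<and> vlinear M N h \<and>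
       (\<forall>m\<in>vcarrier M. \<forall>a\<in>vcarrier A. h (act M m a) = act N (h m) a) \<and>
       (\<forall>n. \<forall>m\<in>mcomp M n. h m \<in> mcomp N n)}"

definition grmod_cat ::
  "'u itself \<Rightarrow> ('f::field, 'x, 'k::finite) galgebra
     \<Rightarrow> (('f, 'u, 'x, 'k) grmodule, 'u \<Rightarrow> 'u) hcat" where
  "grmod_cat U A =
     \<lparr> Ob = {M. is_graded_module A M \<and> unital_module A M},
       Hom = graded_hom A,
       Ident = (\<lambda>M. restrict (\<lambda>m. m) (vcarrier M)),
       Comp = (\<lambda>L M N g f. compose (vcarrier L) g f) \<rparr>"

text \<open>The \<open>n\<close>-th shift: $M(n)_i = M_{n+i}$, morphisms unchanged.\<close>

definition shift ::
  "int ^ 'k::finite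
     \<Rightarrow> (('f, 'u, 'x, 'k) grmodule, 'u \<Rightarrow> 'u, ('f, 'u, 'x, 'k) grmodule, 'u \<Rightarrow> 'u) hfunctor" where
  "shift n = \<lparr> fob = (\<lambda>M. M\<lparr>mcomp := \<lambda>i. mcomp M (n + i)\<rparr>), fmor = (\<lambda>M N f. f) \<rparr>"

definition commutes_with_shifts ::
  "(('f, 'u, 'x, 'k::finite) grmodule, 'u \<Rightarrow> 'u) hcat
     \<Rightarrow> (('f, 'u, 'x, 'k) grmodule, 'u \<Rightarrow> 'u, ('f, 'u, 'y, 'k) grmodule, 'u \<Rightarrow> 'u) hfunctor
     \<Rightarrow> bool" where
  "commutes_with_shifts C F \<longleftrightarrow>
     (\<forall>n. functor_eq C (functor_comp F (shift n)) (functor_comp (shift n) F))"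

text \<open>
  A type cannot contain all modules, so the categories consist of the modules carried by subsets of
  an arbitrary type \<open>'u\<close>.  Theorems about \<open>graded_morita_equivalent\<close> are to be stated for all \<open>'u\<close>.
\<close>

definition graded_morita_equivalent ::
  "'u itself \<Rightarrow> ('f::field, 'x, 'k::finite) galgebra \<Rightarrow> ('f, 'y, 'k) galgebra \<Rightarrow> bool" where
  "graded_morita_equivalent U A B \<longleftrightarrow> (\<exists>F G.
     is_functor (grmod_cat U A) (grmod_cat U B) F \<and>
     is_functor (grmod_cat U B) (grmod_cat U A) G \<and>
     commutes_with_shifts (grmod_cat U A) F \<and>
     commutes_with_shifts (grmod_cat U B) G \<and>
     naturally_isomorphic (grmod_cat U A) (grmod_cat U A) (functor_comp G F) functor_id \<and>
     naturally_isomorphic (grmod_cat U B) (grmod_cat U B) (functor_comp F G) functor_id)"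

end

theory Submission
  imports Defs
begin

text \<open>
  A path of the in-split is determined by its parent in \<open>\<Lambda>\<close> together with its source, since the
  copies of the other edges are forced by the ranges of the edges that follow them.  Hence sending
  $p_u$, $s_\lambda$ and $s_{\lambda^*}$ to the sums of the generators belonging to all lifts of \<open>u\<close> and
  \<open>\<lambda>\<close> respects the Kumjian--Pask relations.  Conversely, by the pairing condition the block of the
  first edge of a path does not depend on the factorization of the path, and the vertex $v^j$ is
  sent to the idempotent $q_j = \sum s_\lambda s_{\lambda^*}$, where \<open>\<lambda>\<close> runs over the paths of
  a fixed nonzero degree with range \<open>v\<close> and first edge in the \<open>j\<close>-th block, while the lift of \<open>\<lambda>\<close>
  with source $v^j$ is sent to $s_\lambda q_j$.  The two homomorphisms are inverse to each other and
  preserve degrees, and restriction of scalars along a graded isomorphism is a graded Morita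
  equivalence.
\<close>

section \<open>Free algebras\<close>

abbreviation scalar :: "'f::field \<Rightarrow> ('f, 'g) free_elem" where
  "scalar c \<equiv> Poly_Mapping.single 0 c"

definition word_prod :: "('g \<Rightarrow> 'r::monoid_mult) \<Rightarrow> 'g gword \<Rightarrow> 'r" where
  "word_prod \<phi> w = prod_list (map \<phi> (letters w))"

lemma word_prod_plus: "word_prod \<phi> (u + w) = word_prod \<phi> u * word_prod \<phi> w"
  by (simp add: word_prod_def plus_gword_def)

lemma word_prod_zero [simp]: "word_prod \<phi> 0 = 1"
  by (simp add: word_prod_def zero_gword_def)

lemma word_prod_single [simp]: "word_prod \<phi> (Word [g]) = \<phi> g"
  by (simp add: word_prod_def)

lemma single_eq_scalar_times: "Poly_Mapping.single w c = scalar c * Poly_Mapping.single w 1"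
  by (simp add: mult_single)

lemma lookup_scalar_times: "Poly_Mapping.lookup (scalar c * x) w = c * Poly_Mapping.lookup x w"
  unfolding mult_map_scale_conv_mult [symmetric] by (simp add: map.rep_eq when_def)

lemma sum_monomials:
  fixes x :: "('f::field, 'g) free_elem"
  shows "(\<Sum>w\<in>Poly_Mapping.keys x. Poly_Mapping.single w (Poly_Mapping.lookup x w)) = x"
proof (rule poly_mapping_eqI)
  fix k
  have "(\<Sum>w\<in>Poly_Mapping.keys x. Poly_Mapping.lookup x w when w = k) = Poly_Mapping.lookup x k"
    by (simp add: when_def sum.delta in_keys_iff)
  then show "Poly_Mapping.lookup
      (\<Sum>w\<in>Poly_Mapping.keys x. Poly_Mapping.single w (Poly_Mapping.lookup x w)) k
      = Poly_Mapping.lookup x k"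
    by (simp add: lookup_sum lookup_single)
qed

lemma free_elem_induct [case_names single add]:
  fixes x :: "('f::field, 'g) free_elem"
  assumes single: "\<And>w c. w \<in> W \<Longrightarrow> Q (Poly_Mapping.single w c)"
    and add: "\<And>x y. Q x \<Longrightarrow> Q y \<Longrightarrow> Q (x + y)"
    and zero: "Q 0" and x: "Poly_Mapping.keys x \<subseteq> W"
  shows "Q x"
proof -
  have "Q (\<Sum>w\<in>K. Poly_Mapping.single w (Poly_Mapping.lookup x w))" if "finite K" "K \<subseteq> W" for K
    using that by (induction K) (auto intro: assms)
  from this[OF finite_keys x] show ?thesis by (simp add: sum_monomials)
qed

lemma scalar_central: "x * scalar c = scalar c * (x :: ('f::field, 'g) free_elem)"
  by (rule free_elem_induct[where W=UNIV and x=x])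
    (auto simp: mult_single algebra_simps)

lemma scalar_mult: "scalar (c * d) = scalar c * (scalar d :: ('f::field, 'g) free_elem)"
  by (simp add: mult_single)

definition free_lift :: "('g \<Rightarrow> ('f::field, 'h) free_elem) \<Rightarrow> ('f, 'g) free_elem \<Rightarrow> ('f, 'h) free_elem"
  where "free_lift \<phi> x =
    (\<Sum>w\<in>Poly_Mapping.keys x. scalar (Poly_Mapping.lookup x w) * word_prod \<phi> w)"

lemma free_lift_superset:
  assumes "finite W" "Poly_Mapping.keys x \<subseteq> W"
  shows "free_lift \<phi> x = (\<Sum>w\<in>W. scalar (Poly_Mapping.lookup x w) * word_prod \<phi> w)"
  unfolding free_lift_def
  by (rule sum.mono_neutral_left) (use assms in \<open>auto simp: in_keys_iff\<close>)

lemma free_lift_add: "free_lift \<phi> (x + y) = free_lift \<phi> x + free_lift \<phi> y"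
proof -
  let ?W = "Poly_Mapping.keys x \<union> Poly_Mapping.keys y"
  have "free_lift \<phi> z = (\<Sum>w\<in>?W. scalar (Poly_Mapping.lookup z w) * word_prod \<phi> w)"
    if "z \<in> {x, y, x + y}" for z
    using that keys_add[of x y] by (intro free_lift_superset) auto
  then show ?thesis
    by (simp add: lookup_add single_add distrib_right sum.distrib)
qed

lemma free_lift_0 [simp]: "free_lift \<phi> 0 = 0"
  by (simp add: free_lift_def)

lemma free_lift_single: "free_lift \<phi> (Poly_Mapping.single w c) = scalar c * word_prod \<phi> w"
  by (cases "c = 0") (simp_all add: free_lift_def)

lemma free_lift_gen [simp]: "free_lift \<phi> (free_gen g) = \<phi> g"
  by (simp add: free_gen_def free_lift_single)

lemma free_lift_scalar [simp]: "free_lift \<phi> (scalar c) = scalar c"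
  by (simp add: free_lift_single)

lemma free_lift_mult: "free_lift \<phi> (x * y) = free_lift \<phi> x * free_lift \<phi> y"
proof -
  have ss: "free_lift \<phi> (Poly_Mapping.single u c * Poly_Mapping.single w d) =
      free_lift \<phi> (Poly_Mapping.single u c) * free_lift \<phi> (Poly_Mapping.single w d)" for u w c d
  proof -
    have "word_prod \<phi> u * (scalar d * word_prod \<phi> w) = scalar d * (word_prod \<phi> u * word_prod \<phi> w)"
      by (simp only: scalar_central flip: mult.assoc)
    then show ?thesis
      by (simp only: mult_single free_lift_single word_prod_plus mult.assoc)
        (simp only: scalar_mult mult.assoc)
  qed
  have *: "free_lift \<phi> (Poly_Mapping.single u c * y) =
      free_lift \<phi> (Poly_Mapping.single u c) * free_lift \<phi> y" for u c
    by (rule free_elem_induct[where W=UNIV and x=y])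
      (auto simp: ss distrib_left free_lift_add)
  show ?thesis
    by (rule free_elem_induct[where W=UNIV and x=x])
      (auto simp: * distrib_right free_lift_add)
qed

lemma free_lift_scale: "free_lift \<phi> (free_scale c x) = free_scale c (free_lift \<phi> x)"
  by (simp add: free_scale_def free_lift_mult)

lemma free_lift_uminus: "free_lift \<phi> (- x) = - free_lift \<phi> x"
  using free_lift_add[of \<phi> x "- x"] by (simp add: eq_neg_iff_add_eq_0 add.commute)

lemma free_lift_diff: "free_lift \<phi> (x - y) = free_lift \<phi> x - free_lift \<phi> y"
  using free_lift_add[of \<phi> x "- y"] by (simp add: free_lift_uminus)

lemma single_word_prod:
  "(Poly_Mapping.single w 1 :: ('f::field, 'g) free_elem) = word_prod free_gen w"
proof -
  have "(Poly_Mapping.single (Word xs) 1 :: ('f, 'g) free_elem) = prod_list (map free_gen xs)" for xs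
  proof (induction xs)
    case Nil
    show ?case by (simp flip: zero_gword_def)
  next
    case (Cons a xs)
    have "(Poly_Mapping.single (Word (a # xs)) 1 :: ('f, 'g) free_elem) =
        free_gen a * Poly_Mapping.single (Word xs) 1"
      by (simp add: free_gen_def mult_single plus_gword_def)
    then show ?case by (simp add: Cons)
  qed
  then show ?thesis
    by (cases w) (simp add: word_prod_def)
qed

lemma free_carrier_0: "0 \<in> free_carrier G"
  by (simp add: free_carrier_def)

lemma free_carrier_gen: "g \<in> G \<Longrightarrow> free_gen g \<in> free_carrier G"
  by (simp add: free_carrier_def free_gen_def)

lemma free_carrier_add: "x \<in> free_carrier G \<Longrightarrow> y \<in> free_carrier G \<Longrightarrow> x + y \<in> free_carrier G"
  using keys_add[of x y] by (auto simp: free_carrier_def)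

lemma free_carrier_mult:
  assumes "x \<in> free_carrier G" "y \<in> free_carrier G" shows "x * y \<in> free_carrier G"
  using keys_mult[of x y] assms by (fastforce simp: free_carrier_def plus_gword_def)

lemma free_carrier_scale: "x \<in> free_carrier G \<Longrightarrow> scalar c * x \<in> free_carrier G"
  by (auto simp: free_carrier_def in_keys_iff lookup_scalar_times)

lemma free_carrier_uminus: "x \<in> free_carrier G \<Longrightarrow> - x \<in> free_carrier G"
  by (auto simp: free_carrier_def in_keys_iff)

lemma free_carrier_diff: "x \<in> free_carrier G \<Longrightarrow> y \<in> free_carrier G \<Longrightarrow> x - y \<in> free_carrier G"
  using free_carrier_add[of x G "- y"] by (simp add: free_carrier_uminus)

lemma free_carrier_sum: "(\<And>i. i \<in> A \<Longrightarrow> f i \<in> free_carrier G) \<Longrightarrow> (\<Sum>i\<in>A. f i) \<in> free_carrier G"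
  by (induction A rule: infinite_finite_induct) (auto simp: free_carrier_0 free_carrier_add)

lemmas free_carrier_intros =
  free_carrier_0 free_carrier_gen free_carrier_add free_carrier_mult free_carrier_diff free_carrier_sum

lemma free_carrier_UNIV_decompose:
  obtains c y where "x = scalar c + y" "y \<in> free_carrier UNIV"
proof
  show "x = scalar (Poly_Mapping.lookup x 0) + (x - scalar (Poly_Mapping.lookup x 0))" by simp
  have "letters w \<noteq> []" if "w \<noteq> 0" for w :: "'b gword"
    using that by (cases w) (auto simp: zero_gword_def)
  then show "x - scalar (Poly_Mapping.lookup x 0) \<in> free_carrier UNIV"
    by (auto simp: free_carrier_def in_keys_iff lookup_minus lookup_single when_def split: if_splits)
qed

lemma free_carrier_induct [consumes 1, case_names gen mult add scale]:
  fixes x :: "('f::field, 'g) free_elem"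
  assumes x: "x \<in> free_carrier G"
    and gen: "\<And>g. g \<in> G \<Longrightarrow> Q (free_gen g)"
    and mult: "\<And>x y. x \<in> free_carrier G \<Longrightarrow> y \<in> free_carrier G \<Longrightarrow> Q x \<Longrightarrow> Q y \<Longrightarrow> Q (x * y)"
    and add: "\<And>x y. Q x \<Longrightarrow> Q y \<Longrightarrow> Q (x + y)"
    and scale: "\<And>c x. Q x \<Longrightarrow> Q (scalar c * x)"
    and zero: "Q 0"
  shows "Q x"
proof (rule free_elem_induct[where W="{w. letters w \<noteq> [] \<and> set (letters w) \<subseteq> G}"])
  have word: "Q (prod_list (map free_gen (g # gs)))" if "set (g # gs) \<subseteq> G" for g gs
    using that
  proof (induction gs arbitrary: g)
    case Nil
    then show ?case by (simp add: gen)
  next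
    case (Cons h gs)
    have carrier: "(prod_list (map free_gen (h # gs)) :: ('f, 'g) free_elem) \<in> free_carrier G"
      if "set (h # gs) \<subseteq> G" for h gs
      using that
    proof (induction gs arbitrary: h)
      case (Cons k ks)
      from Cons.prems have "(prod_list (map free_gen (k # ks)) :: ('f, 'g) free_elem) \<in> free_carrier G"
        by (intro Cons.IH) simp
      with Cons.prems show ?case
        by (simp add: free_carrier_gen free_carrier_mult)
    qed (simp add: free_carrier_gen)
    show ?case
      using Cons.prems Cons.IH[of h] carrier[of h gs]
      by (simp add: mult gen free_carrier_gen)
  qed
  fix w c
  assume "w \<in> {w. letters w \<noteq> [] \<and> set (letters w) \<subseteq> G}"
  then have "Q (word_prod free_gen w)"
    using word by (cases "letters w") (auto simp: word_prod_def)
  then have "Q (scalar c * word_prod free_gen w)" by (rule scale)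
  then show "Q (Poly_Mapping.single w c)"
    by (subst single_eq_scalar_times) (simp only: single_word_prod)
qed (use x in \<open>auto simp: free_carrier_def intro: add zero\<close>)

lemma free_lift_carrier:
  assumes "x \<in> free_carrier G" "\<And>g. g \<in> G \<Longrightarrow> \<phi> g \<in> free_carrier G'"
  shows "free_lift \<phi> x \<in> free_carrier G'"
  using assms(1)
  by (induction rule: free_carrier_induct)
    (auto simp: assms(2) free_lift_mult free_lift_add intro: free_carrier_intros free_carrier_scale)

lemma free_lift_cong_gen:
  assumes "x \<in> free_carrier G" "\<And>g. g \<in> G \<Longrightarrow> \<phi> g = \<psi> g"
  shows "free_lift \<phi> x = free_lift \<psi> x"
  using assms(1)
  by (induction rule: free_carrier_induct)
    (auto simp: assms(2) free_lift_mult free_lift_add)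

lemma free_lift_free_gen: "x \<in> free_carrier G \<Longrightarrow> free_lift free_gen x = x"
  by (induction rule: free_carrier_induct)
    (auto simp: free_lift_mult free_lift_add)


section \<open>Relation ideals as kernels of ring homomorphisms\<close>

lemma rel_ideal_uminus: "x \<in> rel_ideal G R \<Longrightarrow> - x \<in> rel_ideal G R"
  using rel_ideal.scale[of x G R "- 1"] by (simp add: free_scale_def single_uminus)

lemma rel_ideal_UNIV_left: "x \<in> rel_ideal UNIV R \<Longrightarrow> a * x \<in> rel_ideal UNIV R"
  by (rule free_carrier_UNIV_decompose[of a])
    (auto simp: distrib_right simp flip: free_scale_def
      intro: rel_ideal.add rel_ideal.scale rel_ideal.left)

lemma rel_ideal_UNIV_right: "x \<in> rel_ideal UNIV R \<Longrightarrow> x * a \<in> rel_ideal UNIV R"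
  by (rule free_carrier_UNIV_decompose[of a])
    (auto simp: distrib_left scalar_central simp flip: free_scale_def
      intro: rel_ideal.add rel_ideal.scale rel_ideal.right)

lemma free_lift_rel_ideal:
  assumes "x \<in> rel_ideal G R"
    and "\<And>g. g \<in> G \<Longrightarrow> \<phi> g \<in> free_carrier G'"
    and "\<And>r. r \<in> R \<Longrightarrow> free_lift \<phi> r \<in> rel_ideal G' R'"
  shows "free_lift \<phi> x \<in> rel_ideal G' R'"
  using assms(1)
  by induction
    (auto simp: free_lift_add free_lift_mult free_lift_scale
      intro: rel_ideal.intros assms free_lift_carrier)

text \<open>The retraction onto the subalgebra generated by \<open>G\<close> that kills all other generators maps the
  ideal of the whole free algebra into the ideal of the subalgebra.\<close>

lemma rel_ideal_UNIV_restrict: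
  fixes x :: "('f::field, 'g) free_elem"
  assumes x: "x \<in> rel_ideal UNIV R" "x \<in> free_carrier G" and R: "R \<subseteq> free_carrier G"
  shows "x \<in> rel_ideal G R"
proof -
  define \<tau> :: "'g \<Rightarrow> ('f, 'g) free_elem" where "\<tau> g = (if g \<in> G then free_gen g else 0)" for g
  have fixed: "free_lift \<tau> y = y" if "y \<in> free_carrier G" for y
    using free_lift_cong_gen[OF that, of \<tau> free_gen] free_lift_free_gen[OF that]
    by (simp add: \<tau>_def)
  have "free_lift \<tau> x \<in> rel_ideal G R"
    using x(1)
  proof (rule free_lift_rel_ideal)
    show "\<tau> g \<in> free_carrier G" for g
      by (simp add: \<tau>_def free_carrier_gen free_carrier_0)
    show "free_lift \<tau> r \<in> rel_ideal G R" if "r \<in> R" for r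
      using fixed[of r] rel_ideal.base[OF that] R that by auto
  qed
  then show ?thesis by (simp add: fixed x(2))
qed

typedef (overloaded) 'r endo = "{f :: 'r::ab_group_add \<Rightarrow> 'r. \<forall>x y. f (x + y) = f x + f y}"
  morphisms endo_apply Endo
  by (rule exI[of _ "\<lambda>_. 0"]) simp

setup_lifting type_definition_endo

instantiation endo :: (ab_group_add) ring
begin

lift_definition zero_endo :: "'a endo" is "\<lambda>_. 0" by simp
lift_definition plus_endo :: "'a endo \<Rightarrow> 'a endo \<Rightarrow> 'a endo" is "\<lambda>f g x. f x + g x"
  by (simp add: algebra_simps)
lift_definition minus_endo :: "'a endo \<Rightarrow> 'a endo \<Rightarrow> 'a endo" is "\<lambda>f g x. f x - g x"
  by (simp add: algebra_simps)
lift_definition uminus_endo :: "'a endo \<Rightarrow> 'a endo" is "\<lambda>f x. - f x" by simp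
lift_definition times_endo :: "'a endo \<Rightarrow> 'a endo \<Rightarrow> 'a endo" is "\<lambda>f g x. f (g x)" by simp

instance
  by standard (transfer; simp add: algebra_simps; fail)+

end

definition ring_hom :: "('a::ring \<Rightarrow> 'b::ring) \<Rightarrow> bool" where
  "ring_hom h \<longleftrightarrow> (\<forall>x y. h (x + y) = h x + h y \<and> h (x * y) = h x * h y)"

lemma ring_hom_add: "ring_hom h \<Longrightarrow> h (x + y) = h x + h y"
  and ring_hom_mult: "ring_hom h \<Longrightarrow> h (x * y) = h x * h y"
  by (simp_all add: ring_hom_def)

lemma ring_hom_0: "ring_hom h \<Longrightarrow> h 0 = 0"
  using ring_hom_add[of h 0 0] by simp

lemma ring_hom_diff: "ring_hom h \<Longrightarrow> h (x - y) = h x - h y"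
  using ring_hom_add[of h "x - y" y] by simp

lemma ring_hom_sum: "ring_hom h \<Longrightarrow> h (\<Sum>i\<in>A. f i) = (\<Sum>i\<in>A. h (f i))"
  by (induction A rule: infinite_finite_induct) (auto simp: ring_hom_0 ring_hom_add)

lemmas ring_hom_simps = ring_hom_0 ring_hom_add ring_hom_mult ring_hom_diff ring_hom_sum

lemma ring_hom_free_lift: "ring_hom h \<Longrightarrow> ring_hom (\<lambda>x. h (free_lift \<phi> x))"
  by (simp add: ring_hom_def free_lift_add free_lift_mult)

text \<open>There is no type of classes modulo the ideal.  Instead, the quotient algebra is made to
  act on a linear complement of the ideal: if \<open>N\<close> is a linear projection with kernel
  the ideal, then \<open>x\<close> acts by \<open>z \<mapsto> N (x z)\<close>.\<close>

lemma rel_ideal_kernel: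
  fixes R :: "('f::field, 'g) free_elem set"
  obtains \<Phi> :: "('f, 'g) free_elem \<Rightarrow> ('f, 'g) free_elem endo"
  where "ring_hom \<Phi>" "\<And>x. \<Phi> x = 0 \<longleftrightarrow> x \<in> rel_ideal UNIV R"
proof -
  let ?J = "rel_ideal UNIV R"
  interpret V: vector_space "free_scale :: 'f \<Rightarrow> ('f, 'g) free_elem \<Rightarrow> _"
    by standard (simp_all add: free_scale_def algebra_simps single_add mult_single flip: mult.assoc)
  interpret VV: vector_space_pair "free_scale :: 'f \<Rightarrow> ('f, 'g) free_elem \<Rightarrow> _"
      "free_scale :: 'f \<Rightarrow> ('f, 'g) free_elem \<Rightarrow> _"
    by (intro vector_space_pair.intro V.vector_space_axioms)
  have "V.subspace ?J"
    by (simp add: V.subspace_def rel_ideal.intros)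
  from VV.linear_exists_left_inverse_on[OF V.linear_ident this]
  obtain g where g: "range g \<subseteq> ?J" "Vector_Spaces.linear free_scale free_scale g"
      "\<And>x. x \<in> ?J \<Longrightarrow> g x = x"
    by (auto simp: inj_on_def)
  define N where "N x = x - g x" for x
  have gadd: "g (x + y) = g x + g y" for x y
    using g(2) by (rule VV.linear_add)
  have Nadd: "N (x + y) = N x + N y" for x y
    by (simp add: N_def gadd)
  have N0: "N x = 0" if "x \<in> ?J" for x
    by (simp add: N_def g(3) that)
  have NJ: "x \<in> ?J" if "N x = 0" for x
    using that g(1) by (auto simp: N_def)
  have Ndiff: "N x = N y" if "x - y \<in> ?J" for x y
    using Nadd[of "x - y" y] N0[OF that] by simp
  define \<Phi> where "\<Phi> x = Endo (\<lambda>z. N (x * z))" for x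
  have app: "endo_apply (\<Phi> x) z = N (x * z)" for x z
    unfolding \<Phi>_def by (subst Endo_inverse) (auto simp: distrib_left Nadd)
  show thesis
  proof
    show "ring_hom \<Phi>"
      unfolding ring_hom_def
    proof (intro allI conjI)
      fix x y
      show "\<Phi> (x + y) = \<Phi> x + \<Phi> y"
        by (simp add: endo_apply_inject[symmetric] fun_eq_iff app plus_endo.rep_eq distrib_right Nadd)
      have "x * y * z - x * N (y * z) \<in> ?J" for z
      proof -
        have "x * y * z - x * N (y * z) = x * g (y * z)"
          by (simp add: N_def algebra_simps)
        then show ?thesis
          using g(1) by (auto intro: rel_ideal_UNIV_left)
      qed
      then show "\<Phi> (x * y) = \<Phi> x * \<Phi> y"
        by (auto simp: endo_apply_inject[symmetric] fun_eq_iff app times_endo.rep_eq intro: Ndiff)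
    qed
    show "\<Phi> x = 0 \<longleftrightarrow> x \<in> ?J" for x
    proof
      assume "\<Phi> x = 0"
      then have "endo_apply (\<Phi> x) 1 = 0" by (simp add: zero_endo.rep_eq)
      then show "x \<in> ?J" by (simp add: app NJ)
    next
      assume "x \<in> ?J"
      then show "\<Phi> x = 0"
        by (simp add: endo_apply_inject[symmetric] fun_eq_iff app zero_endo.rep_eq N0
            rel_ideal_UNIV_right)
    qed
  qed
qed


section \<open>Isomorphisms of presented algebras\<close>

abbreviation rel_class ::
  "'g set \<Rightarrow> ('f::field, 'g) free_elem set \<Rightarrow> ('f, 'g) free_elem \<Rightarrow> ('f, 'g) free_elem set" where
  "rel_class G R x \<equiv> ideal_rel G R `` {x}"

lemma equiv_ideal_rel: "equiv (free_carrier G) (ideal_rel G R)"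
proof (rule equivI)
  show "sym (ideal_rel G R)"
    using rel_ideal_uminus by (fastforce simp: ideal_rel_def sym_def)
  show "trans (ideal_rel G R)"
    using rel_ideal.add by (fastforce simp: ideal_rel_def trans_def)
qed (auto simp: ideal_rel_def refl_on_def rel_ideal.zero)

lemma free_scale_carrier: "x \<in> free_carrier G \<Longrightarrow> free_scale c x \<in> free_carrier G"
  by (simp add: free_scale_def free_carrier_scale)

lemma ideal_rel_iff: "(x, y) \<in> ideal_rel G R \<longleftrightarrow>
    x \<in> free_carrier G \<and> y \<in> free_carrier G \<and> x - y \<in> rel_ideal G R"
  by (simp add: ideal_rel_def)

lemma rel_class_eq_iff:
  assumes "x \<in> free_carrier G" "y \<in> free_carrier G"
  shows "rel_class G R x = rel_class G R y \<longleftrightarrow> x - y \<in> rel_ideal G R"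
  using assms eq_equiv_class_iff[OF equiv_ideal_rel assms] by (auto simp: ideal_rel_def)

lemma rel_classI: "x - y \<in> rel_ideal G R \<Longrightarrow> x \<in> free_carrier G \<Longrightarrow> y \<in> free_carrier G \<Longrightarrow>
    rel_class G R x = rel_class G R y"
  by (simp add: rel_class_eq_iff)

lemma vcarrier_presented: "vcarrier (presented_algebra G R) = rel_class G R ` free_carrier G"
  by (auto simp: presented_algebra_def quotient_def)

lemma vzero_presented: "vzero (presented_algebra G R) = rel_class G R 0"
  by (simp add: presented_algebra_def)

lemma vadd_presented:
  assumes "x \<in> free_carrier G" "y \<in> free_carrier G"
  shows "vadd (presented_algebra G R) (rel_class G R x) (rel_class G R y) = rel_class G R (x + y)"
proof -
  have "congruent2 (ideal_rel G R) (ideal_rel G R) (\<lambda>x y. rel_class G R (x + y))"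
    by (rule congruent2I[OF equiv_ideal_rel equiv_ideal_rel]; rule rel_classI)
      (auto simp: ideal_rel_iff free_carrier_add)
  from UN_equiv_class2[OF equiv_ideal_rel equiv_ideal_rel this assms] show ?thesis
    by (simp only: presented_algebra_def vspace.simps)
qed

lemma amult_presented:
  assumes "x \<in> free_carrier G" "y \<in> free_carrier G"
  shows "amult (presented_algebra G R) (rel_class G R x) (rel_class G R y) = rel_class G R (x * y)"
proof -
  have "congruent2 (ideal_rel G R) (ideal_rel G R) (\<lambda>x y. rel_class G R (x * y))"
    by (rule congruent2I[OF equiv_ideal_rel equiv_ideal_rel]; rule rel_classI)
      (auto simp: ideal_rel_iff free_carrier_mult simp flip: left_diff_distrib right_diff_distrib
        intro: rel_ideal.left rel_ideal.right)
  from UN_equiv_class2[OF equiv_ideal_rel equiv_ideal_rel this assms] show ?thesis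
    by (simp only: presented_algebra_def falgebra.simps)
qed

lemma vscale_presented:
  assumes "x \<in> free_carrier G"
  shows "vscale (presented_algebra G R) c (rel_class G R x) = rel_class G R (free_scale c x)"
  unfolding presented_algebra_def vspace.simps
proof (rule UN_equiv_class[OF equiv_ideal_rel _ assms], rule congruentI)
  fix y z assume yz: "(y, z) \<in> ideal_rel G R"
  then have "free_scale c y - free_scale c z = free_scale c (y - z)"
    by (simp add: free_scale_def right_diff_distrib)
  then show "rel_class G R (free_scale c y) = rel_class G R (free_scale c z)"
    using yz rel_ideal.scale[of "y - z" G R c]
    by (intro rel_classI) (auto simp: ideal_rel_def free_scale_def intro: free_carrier_scale)
qed

lemma vadd_presented_closed:
  "X \<in> vcarrier (presented_algebra G R) \<Longrightarrow> Y \<in> vcarrier (presented_algebra G R) \<Longrightarrow>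
    vadd (presented_algebra G R) X Y \<in> vcarrier (presented_algebra G R)"
  by (auto simp: vcarrier_presented vadd_presented free_carrier_add)

lemma amult_presented_closed:
  "X \<in> vcarrier (presented_algebra G R) \<Longrightarrow> Y \<in> vcarrier (presented_algebra G R) \<Longrightarrow>
    amult (presented_algebra G R) X Y \<in> vcarrier (presented_algebra G R)"
  by (auto simp: vcarrier_presented amult_presented free_carrier_mult)

lemma vscale_presented_closed:
  "X \<in> vcarrier (presented_algebra G R) \<Longrightarrow>
    vscale (presented_algebra G R) c X \<in> vcarrier (presented_algebra G R)"
  by (auto simp: vcarrier_presented vscale_presented free_scale_def free_carrier_scale)

lemma vspan_presented_subset:
  assumes "S \<subseteq> vcarrier (presented_algebra G R)"
  shows "vspan (presented_algebra G R) S \<subseteq> vcarrier (presented_algebra G R)"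
proof
  fix X assume "X \<in> vspan (presented_algebra G R) S"
  then show "X \<in> vcarrier (presented_algebra G R)"
  proof induction
    case zero
    show ?case by (simp add: vzero_presented vcarrier_presented free_carrier_0)
  qed (use assms in \<open>auto simp: vadd_presented_closed vscale_presented_closed\<close>)
qed

locale presented_hom =
  fixes G :: "'g set" and R :: "('f::field, 'g) free_elem set"
    and G' :: "'h set" and R' :: "('f, 'h) free_elem set"
    and \<phi> :: "'g \<Rightarrow> ('f, 'h) free_elem"
  assumes gen_carrier: "g \<in> G \<Longrightarrow> \<phi> g \<in> free_carrier G'"
    and rel_ideal: "r \<in> R \<Longrightarrow> free_lift \<phi> r \<in> rel_ideal G' R'"
begin

definition induced :: "('f, 'g) free_elem set \<Rightarrow> ('f, 'h) free_elem set" where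
  "induced X = (\<Union>x\<in>X. rel_class G' R' (free_lift \<phi> x))"

lemma lift_carrier: "x \<in> free_carrier G \<Longrightarrow> free_lift \<phi> x \<in> free_carrier G'"
  by (erule free_lift_carrier) (rule gen_carrier)

lemma induced_class:
  assumes "x \<in> free_carrier G"
  shows "induced (rel_class G R x) = rel_class G' R' (free_lift \<phi> x)"
  unfolding induced_def
proof (rule UN_equiv_class[OF equiv_ideal_rel _ assms], rule congruentI)
  fix y z assume yz: "(y, z) \<in> ideal_rel G R"
  then have "free_lift \<phi> (y - z) \<in> rel_ideal G' R'"
    by (intro free_lift_rel_ideal[OF _ gen_carrier rel_ideal]) (simp_all add: ideal_rel_iff)
  with yz show "rel_class G' R' (free_lift \<phi> y) = rel_class G' R' (free_lift \<phi> z)"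
    by (intro rel_classI) (auto simp: ideal_rel_iff free_lift_diff lift_carrier)
qed

lemma vlinear_induced: "vlinear (presented_algebra G R) (presented_algebra G' R') induced"
  unfolding vlinear_def vcarrier_presented
proof (intro conjI ballI allI)
  fix c X Y
  assume "X \<in> rel_class G R ` free_carrier G"
  then obtain x where x: "X = rel_class G R x" "x \<in> free_carrier G" by blast
  show "induced X \<in> rel_class G' R' ` free_carrier G'"
    unfolding x(1) induced_class[OF x(2)] by (intro imageI lift_carrier x)
  show "induced (vscale (presented_algebra G R) c X) = vscale (presented_algebra G' R') c (induced X)"
    unfolding x(1)
    by (simp only: vscale_presented induced_class lift_carrier x free_scale_carrier free_lift_scale)
  assume "Y \<in> rel_class G R ` free_carrier G"
  then obtain y where y: "Y = rel_class G R y" "y \<in> free_carrier G" by blast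
  show "induced (vadd (presented_algebra G R) X Y) =
      vadd (presented_algebra G' R') (induced X) (induced Y)"
    unfolding x(1) y(1)
    by (simp only: vadd_presented induced_class lift_carrier free_carrier_add x y free_lift_add)
qed

lemma induced_amult:
  assumes "X \<in> vcarrier (presented_algebra G R)" "Y \<in> vcarrier (presented_algebra G R)"
  shows "induced (amult (presented_algebra G R) X Y) =
    amult (presented_algebra G' R') (induced X) (induced Y)"
proof -
  obtain x y where xy: "X = rel_class G R x" "x \<in> free_carrier G"
      "Y = rel_class G R y" "y \<in> free_carrier G"
    using assms unfolding vcarrier_presented by blast
  show ?thesis
    unfolding xy(1,3)
    by (simp only: amult_presented induced_class lift_carrier free_carrier_mult xy free_lift_mult)
qed

lemma induced_vspan:
  assumes "B \<subseteq> free_carrier G"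
    and "\<And>x. x \<in> B \<Longrightarrow> rel_class G' R' (free_lift \<phi> x) \<in> vspan (presented_algebra G' R') B'"
    and "X \<in> vspan (presented_algebra G R) (rel_class G R ` B)"
  shows "induced X \<in> vspan (presented_algebra G' R') B'"
proof -
  have sub: "vspan (presented_algebra G R) (rel_class G R ` B) \<subseteq> vcarrier (presented_algebra G R)"
    using assms(1) by (intro vspan_presented_subset) (auto simp: vcarrier_presented)
  show ?thesis
    using assms(3)
  proof induction
    case zero
    then show ?case
      using vspan.zero[of "presented_algebra G' R'" B']
      by (simp add: vzero_presented induced_class free_carrier_0)
  next
    case (base X)
    then show ?case
      using assms(1,2) by (auto simp: induced_class)
  next
    case (add X Y)
    have "induced (vadd (presented_algebra G R) X Y) =
        vadd (presented_algebra G' R') (induced X) (induced Y)"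
      using vlinear_induced subsetD[OF sub add.hyps(1)] subsetD[OF sub add.hyps(2)]
      by (simp add: vlinear_def)
    then show ?case using add.IH by (simp add: vspan.add)
  next
    case (scale X c)
    have "induced (vscale (presented_algebra G R) c X) =
        vscale (presented_algebra G' R') c (induced X)"
      using vlinear_induced subsetD[OF sub scale.hyps(1)] by (simp add: vlinear_def)
    then show ?case using scale.IH by (simp add: vspan.scale)
  qed
qed

end

definition graded_presented ::
  "'g set \<Rightarrow> ('f::field, 'g) free_elem set \<Rightarrow> (int ^ 'k::finite \<Rightarrow> ('f, 'g) free_elem set) \<Rightarrow>
    ('f, ('f, 'g) free_elem set, 'k) galgebra" where
  "graded_presented G R B = falgebra.extend (presented_algebra G R)
     (galgebra.fields (\<lambda>n. vspan (presented_algebra G R) (rel_class G R ` B n)))"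

lemma graded_presented_simps [simp]:
  "vcarrier (graded_presented G R B) = vcarrier (presented_algebra G R)"
  "vzero (graded_presented G R B) = vzero (presented_algebra G R)"
  "vadd (graded_presented G R B) = vadd (presented_algebra G R)"
  "vscale (graded_presented G R B) = vscale (presented_algebra G R)"
  "amult (graded_presented G R B) = amult (presented_algebra G R)"
  "acomp (graded_presented G R B) n = vspan (presented_algebra G R) (rel_class G R ` B n)"
  by (simp_all add: graded_presented_def falgebra.defs galgebra.defs)

definition galgebra_closed :: "('f, 'x, 'k::finite) galgebra \<Rightarrow> bool" where
  "galgebra_closed A \<longleftrightarrow>
     (\<forall>x\<in>vcarrier A. \<forall>y\<in>vcarrier A. vadd A x y \<in> vcarrier A \<and> amult A x y \<in> vcarrier A) \<and>
     (\<forall>c. \<forall>x\<in>vcarrier A. vscale A c x \<in> vcarrier A) \<and> (\<forall>n. acomp A n \<subseteq> vcarrier A)"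

lemma galgebra_closed_graded_presented:
  assumes "\<And>n. B n \<subseteq> free_carrier G"
  shows "galgebra_closed (graded_presented G R B)"
proof -
  have "rel_class G R ` B n \<subseteq> vcarrier (presented_algebra G R)" for n
    using assms by (auto simp: vcarrier_presented)
  from vspan_presented_subset[OF this] show ?thesis
    by (simp add: galgebra_closed_def vadd_presented_closed amult_presented_closed
        vscale_presented_closed)
qed

lemma free_lift_inverse:
  assumes "presented_hom G R G' R' \<phi>" "presented_hom G' R' G R \<psi>"
    and "\<And>g. g \<in> G \<Longrightarrow> free_lift \<psi> (\<phi> g) - free_gen g \<in> rel_ideal G R"
    and "x \<in> free_carrier G"
  shows "free_lift \<psi> (free_lift \<phi> x) - x \<in> rel_ideal G R"
proof -
  interpret f: presented_hom G R G' R' \<phi> by fact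
  interpret g: presented_hom G' R' G R \<psi> by fact
  let ?k = "\<lambda>x. free_lift \<psi> (free_lift \<phi> x)"
  show ?thesis
    using assms(4)
  proof (induction rule: free_carrier_induct)
    case (mult x y)
    have "?k (x * y) - x * y = (?k x - x) * ?k y + x * (?k y - y)"
      by (simp add: free_lift_mult algebra_simps)
    moreover have "(?k x - x) * ?k y + x * (?k y - y) \<in> rel_ideal G R"
      using mult
      by (intro rel_ideal.add[OF rel_ideal.right rel_ideal.left])
        (auto simp: f.lift_carrier g.lift_carrier)
    ultimately show ?case by (rule ssubst)
  next
    case (add x y)
    then show ?case
      using rel_ideal.add[of "?k x - x" G R "?k y - y"] by (simp add: free_lift_add algebra_simps)
  next
    case (scale c x)
    then show ?case
      using rel_ideal.scale[of "?k x - x" G R c]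
      by (simp add: free_scale_def free_lift_mult algebra_simps)
  qed (use assms(3) in \<open>auto intro: rel_ideal.zero\<close>)
qed

lemma graded_presented_iso:
  assumes "presented_hom G R G' R' \<phi>" "presented_hom G' R' G R \<psi>"
    and inv: "\<And>g. g \<in> G \<Longrightarrow> free_lift \<psi> (\<phi> g) - free_gen g \<in> rel_ideal G R"
      "\<And>g. g \<in> G' \<Longrightarrow> free_lift \<phi> (\<psi> g) - free_gen g \<in> rel_ideal G' R'"
    and B: "\<And>n. B n \<subseteq> free_carrier G" "\<And>n. B' n \<subseteq> free_carrier G'"
    and \<phi>: "\<And>n x. x \<in> B n \<Longrightarrow>
      rel_class G' R' (free_lift \<phi> x) \<in> vspan (presented_algebra G' R') (rel_class G' R' ` B' n)"
    and \<psi>: "\<And>n x. x \<in> B' n \<Longrightarrow>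
      rel_class G R (free_lift \<psi> x) \<in> vspan (presented_algebra G R) (rel_class G R ` B n)"
  shows "\<exists>h. graded_algebra_iso (graded_presented G R B) (graded_presented G' R' B') h"
proof -
  interpret f: presented_hom G R G' R' \<phi> by fact
  interpret g: presented_hom G' R' G R \<psi> by fact
  let ?A = "presented_algebra G R" and ?A' = "presented_algebra G' R'"
  have gf: "g.induced (f.induced X) = X" if X: "X \<in> vcarrier ?A" for X
  proof -
    obtain x where x: "X = rel_class G R x" "x \<in> free_carrier G"
      using X unfolding vcarrier_presented by blast
    show ?thesis
      unfolding x(1) f.induced_class[OF x(2)] g.induced_class[OF f.lift_carrier[OF x(2)]]
      by (intro rel_classI free_lift_inverse[OF assms(1,2) inv(1)] f.lift_carrier g.lift_carrier x)
  qed
  have fg: "f.induced (g.induced X) = X" if X: "X \<in> vcarrier ?A'" for X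
  proof -
    obtain x where x: "X = rel_class G' R' x" "x \<in> free_carrier G'"
      using X unfolding vcarrier_presented by blast
    show ?thesis
      unfolding x(1) g.induced_class[OF x(2)] f.induced_class[OF g.lift_carrier[OF x(2)]]
      by (intro rel_classI free_lift_inverse[OF assms(2,1) inv(2)] f.lift_carrier g.lift_carrier x)
  qed
  have "bij_betw f.induced (vcarrier ?A) (vcarrier ?A')"
    using gf fg f.vlinear_induced g.vlinear_induced
    by (intro bij_betw_byWitness[where f'=g.induced]) (auto simp: vlinear_def)
  moreover have "f.induced ` vspan ?A (rel_class G R ` B n) = vspan ?A' (rel_class G' R' ` B' n)" for n
  proof (intro equalityI subsetI)
    fix Y assume Y: "Y \<in> vspan ?A' (rel_class G' R' ` B' n)"
    from g.induced_vspan[OF B(2) \<psi> Y]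
    have "g.induced Y \<in> vspan ?A (rel_class G R ` B n)" .
    moreover have "Y \<in> vcarrier ?A'"
      using Y B(2) vspan_presented_subset[of "rel_class G' R' ` B' n" G' R']
      by (auto simp: vcarrier_presented)
    ultimately
    show "Y \<in> f.induced ` vspan ?A (rel_class G R ` B n)"
      using fg by (metis imageI)
  qed (use f.induced_vspan[OF B(1) \<phi>] in auto)
  ultimately have "graded_algebra_iso (graded_presented G R B) (graded_presented G' R' B') f.induced"
    using f.vlinear_induced f.induced_amult by (simp add: graded_algebra_iso_def vlinear_def)
  then show ?thesis by blast
qed


section \<open>Kumjian--Pask families\<close>

locale kp_family =
  fixes \<Lambda> :: "('v, 'a, 'k::finite) kgraph" and P :: "'v \<Rightarrow> 'r::ring" and S T :: "'a \<Rightarrow> 'r"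
  assumes P_mult: "\<lbrakk>u \<in> obj \<Lambda>; w \<in> obj \<Lambda>\<rbrakk> \<Longrightarrow> P u * P w = (if u = w then P u else 0)"
    and S_mult: "\<lbrakk>l \<in> mor \<Lambda>; m \<in> mor \<Lambda>; deg \<Lambda> l \<noteq> 0; deg \<Lambda> m \<noteq> 0; src \<Lambda> l = rng \<Lambda> m\<rbrakk>
      \<Longrightarrow> S l * S m = S (cmp \<Lambda> l m)"
    and T_mult: "\<lbrakk>l \<in> mor \<Lambda>; m \<in> mor \<Lambda>; deg \<Lambda> l \<noteq> 0; deg \<Lambda> m \<noteq> 0; src \<Lambda> l = rng \<Lambda> m\<rbrakk>
      \<Longrightarrow> T m * T l = T (cmp \<Lambda> l m)"
    and P_S: "\<lbrakk>l \<in> mor \<Lambda>; deg \<Lambda> l \<noteq> 0\<rbrakk> \<Longrightarrow> P (rng \<Lambda> l) * S l = S l"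
    and S_P: "\<lbrakk>l \<in> mor \<Lambda>; deg \<Lambda> l \<noteq> 0\<rbrakk> \<Longrightarrow> S l * P (src \<Lambda> l) = S l"
    and P_T: "\<lbrakk>l \<in> mor \<Lambda>; deg \<Lambda> l \<noteq> 0\<rbrakk> \<Longrightarrow> P (src \<Lambda> l) * T l = T l"
    and T_P: "\<lbrakk>l \<in> mor \<Lambda>; deg \<Lambda> l \<noteq> 0\<rbrakk> \<Longrightarrow> T l * P (rng \<Lambda> l) = T l"
    and T_S: "\<lbrakk>l \<in> mor \<Lambda>; m \<in> mor \<Lambda>; deg \<Lambda> l \<noteq> 0; deg \<Lambda> l = deg \<Lambda> m\<rbrakk>
      \<Longrightarrow> T l * S m = (if l = m then P (src \<Lambda> l) else 0)"
    and P_sum: "\<lbrakk>u \<in> obj \<Lambda>; n \<noteq> 0\<rbrakk> \<Longrightarrow> P u = (\<Sum>l\<in>paths_from \<Lambda> u n. S l * T l)"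

lemma kp_family_iff_kills_kp_rels:
  fixes h :: "('f::field, ('v, 'a) kp_gen) free_elem \<Rightarrow> 'r::ring"
  assumes h: "ring_hom h"
  shows "kp_family \<Lambda> (\<lambda>u. h (kp_p u)) (\<lambda>l. h (kp_s l)) (\<lambda>l. h (kp_t l)) \<longleftrightarrow>
    (\<forall>r\<in>kp_rels \<Lambda>. h r = 0)"
proof
  assume "kp_family \<Lambda> (\<lambda>u. h (kp_p u)) (\<lambda>l. h (kp_s l)) (\<lambda>l. h (kp_t l))"
  then interpret kp_family \<Lambda> "\<lambda>u. h (kp_p u)" "\<lambda>l. h (kp_s l)" "\<lambda>l. h (kp_t l)" .
  show "\<forall>r\<in>kp_rels \<Lambda>. h r = 0"
  proof
    fix r :: "('f, ('v, 'a) kp_gen) free_elem" assume "r \<in> kp_rels \<Lambda>"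
    then show "h r = 0"
    proof cases
      case (KP4 u n)
      with P_sum[of u n] show ?thesis
        by (simp add: ring_hom_simps[OF h])
    qed (simp_all add: ring_hom_simps[OF h] P_mult S_mult T_mult P_S S_P P_T T_P T_S if_distrib[of h])
  qed
next
  assume *: "\<forall>r\<in>kp_rels \<Lambda>. h r = 0"
  have diff: "h x = h y" if "x - y \<in> kp_rels \<Lambda>" for x y
    using * that ring_hom_diff[OF h, of x y] by auto
  show "kp_family \<Lambda> (\<lambda>u. h (kp_p u)) (\<lambda>l. h (kp_s l)) (\<lambda>l. h (kp_t l))"
  proof (unfold_locales, goal_cases)
    case (1 u w)
    show ?case using diff[OF kp_rels.KP1[OF 1]] by (simp add: ring_hom_simps[OF h] if_distrib[of h])
  next
    case (2 l m)
    show ?case using diff[OF kp_rels.KP2_path[OF 2]] by (simp add: ring_hom_simps[OF h])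
  next
    case (3 l m)
    show ?case using diff[OF kp_rels.KP2_ghost[OF 3]] by (simp add: ring_hom_simps[OF h])
  next
    case (4 l)
    show ?case using diff[OF kp_rels.KP2_rng_path[OF 4]] by (simp add: ring_hom_simps[OF h])
  next
    case (5 l)
    show ?case using diff[OF kp_rels.KP2_path_src[OF 5]] by (simp add: ring_hom_simps[OF h])
  next
    case (6 l)
    show ?case using diff[OF kp_rels.KP2_src_ghost[OF 6]] by (simp add: ring_hom_simps[OF h])
  next
    case (7 l)
    show ?case using diff[OF kp_rels.KP2_ghost_rng[OF 7]] by (simp add: ring_hom_simps[OF h])
  next
    case (8 l m)
    show ?case using diff[OF kp_rels.KP3[OF 8]] by (simp add: ring_hom_simps[OF h] if_distrib[of h])
  next
    case (9 u n)
    show ?case using diff[OF kp_rels.KP4[OF 9]] by (simp add: ring_hom_simps[OF h])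
  qed
qed

locale composable =
  fixes \<Lambda> :: "('v, 'a, 'k::finite) kgraph"
  assumes rng_in_obj: "a \<in> mor \<Lambda> \<Longrightarrow> rng \<Lambda> a \<in> obj \<Lambda>"
    and src_in_obj: "a \<in> mor \<Lambda> \<Longrightarrow> src \<Lambda> a \<in> obj \<Lambda>"
    and cmp_in_mor: "\<lbrakk>a \<in> mor \<Lambda>; b \<in> mor \<Lambda>; deg \<Lambda> a \<noteq> 0; deg \<Lambda> b \<noteq> 0; src \<Lambda> a = rng \<Lambda> b\<rbrakk>
      \<Longrightarrow> cmp \<Lambda> a b \<in> mor \<Lambda> \<and> deg \<Lambda> (cmp \<Lambda> a b) \<noteq> 0"
begin

lemma gens_carrier:
  "u \<in> obj \<Lambda> \<Longrightarrow> kp_p u \<in> free_carrier (kp_gens \<Lambda>)"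
  "a \<in> mor \<Lambda> \<Longrightarrow> deg \<Lambda> a \<noteq> 0 \<Longrightarrow> kp_s a \<in> free_carrier (kp_gens \<Lambda>)"
  "a \<in> mor \<Lambda> \<Longrightarrow> deg \<Lambda> a \<noteq> 0 \<Longrightarrow> kp_t a \<in> free_carrier (kp_gens \<Lambda>)"
  by (auto simp: kp_gens_def intro!: free_carrier_gen)

lemma kp_rels_carrier: "kp_rels \<Lambda> \<subseteq> free_carrier (kp_gens \<Lambda>)"
proof
  fix r assume "r \<in> kp_rels \<Lambda>"
  then show "r \<in> free_carrier (kp_gens \<Lambda>)"
    by cases (auto simp: rng_in_obj src_in_obj cmp_in_mor paths_from_def
        intro!: free_carrier_diff free_carrier_mult free_carrier_sum gens_carrier free_carrier_0)
qed

lemma kp_ideal_kernel: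
  obtains \<Phi> :: "('f::field, ('v, 'a) kp_gen) free_elem \<Rightarrow> ('f, ('v, 'a) kp_gen) free_elem endo"
  where "ring_hom \<Phi>"
    and "kp_family \<Lambda> (\<lambda>u. \<Phi> (kp_p u)) (\<lambda>l. \<Phi> (kp_s l)) (\<lambda>l. \<Phi> (kp_t l))"
    and "\<And>x. x \<in> free_carrier (kp_gens \<Lambda>) \<Longrightarrow> \<Phi> x = 0 \<Longrightarrow> x \<in> rel_ideal (kp_gens \<Lambda>) (kp_rels \<Lambda>)"
proof -
  obtain \<Phi> :: "('f, ('v, 'a) kp_gen) free_elem \<Rightarrow> ('f, ('v, 'a) kp_gen) free_elem endo"
    where \<Phi>: "ring_hom \<Phi>" "\<And>x. \<Phi> x = 0 \<longleftrightarrow> x \<in> rel_ideal UNIV (kp_rels \<Lambda>)"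
    using rel_ideal_kernel[of "kp_rels \<Lambda> :: ('f, ('v, 'a) kp_gen) free_elem set"] by blast
  show thesis
  proof (rule that[OF \<Phi>(1)])
    show "kp_family \<Lambda> (\<lambda>u. \<Phi> (kp_p u)) (\<lambda>l. \<Phi> (kp_s l)) (\<lambda>l. \<Phi> (kp_t l))"
      by (simp add: kp_family_iff_kills_kp_rels[OF \<Phi>(1)] \<Phi>(2) rel_ideal.base)
    show "x \<in> rel_ideal (kp_gens \<Lambda>) (kp_rels \<Lambda>)"
      if "x \<in> free_carrier (kp_gens \<Lambda>)" "\<Phi> x = 0" for x
      using that by (intro rel_ideal_UNIV_restrict[OF _ _ kp_rels_carrier]) (simp_all add: \<Phi>(2))
  qed
qed

end

lemma ex1_unique: "\<exists>!x. Q x \<Longrightarrow> Q a \<Longrightarrow> Q b \<Longrightarrow> a = b"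
  by blast

context k_graph
begin

lemma deg_0_idm:
  assumes "a \<in> mor \<Lambda>" "deg \<Lambda> a = 0"
  shows "a = idm \<Lambda> (rng \<Lambda> a)" "src \<Lambda> a = rng \<Lambda> a"
proof -
  let ?r = "idm \<Lambda> (rng \<Lambda> a)" and ?s = "idm \<Lambda> (src \<Lambda> a)"
  let ?Q = "\<lambda>(c, d). c \<in> mor \<Lambda> \<and> d \<in> mor \<Lambda> \<and> src \<Lambda> c = rng \<Lambda> d \<and>
      deg \<Lambda> c = 0 \<and> deg \<Lambda> d = 0 \<and> a = cmp \<Lambda> c d"
  have "\<exists>!p. ?Q p"
    using assms by (intro factorization) simp_all
  moreover have "?Q (?r, a)"
    using assms by (simp add: idm_mor src_idm deg_idm rng_obj cmp_idm_left)
  moreover have "?Q (a, ?s)"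
    using assms by (simp add: idm_mor rng_idm deg_idm src_obj cmp_idm_right)
  ultimately have "(?r, a) = (a, ?s)" by (rule ex1_unique)
  then show *: "a = ?r" by simp
  have "src \<Lambda> ?r = rng \<Lambda> a" using assms by (simp add: src_idm rng_obj)
  with * show "src \<Lambda> a = rng \<Lambda> a" by simp
qed

lemma deg_cmp_nonzero:
  assumes "a \<in> mor \<Lambda>" "b \<in> mor \<Lambda>" "src \<Lambda> a = rng \<Lambda> b" "deg \<Lambda> a \<noteq> 0 \<or> deg \<Lambda> b \<noteq> 0"
  shows "deg \<Lambda> (cmp \<Lambda> a b) \<noteq> 0"
  using assms by (auto simp: deg_cmp vec_eq_iff)

lemma composable: "composable \<Lambda>"
  by unfold_locales (auto simp: rng_obj src_obj cmp_mor deg_cmp_nonzero)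

lemma bij_betw_cmp_paths_from:
  assumes "u \<in> obj \<Lambda>"
  shows "bij_betw (\<lambda>(a, b). cmp \<Lambda> a b)
    (SIGMA a:paths_from \<Lambda> u n. paths_from \<Lambda> (src \<Lambda> a) m) (paths_from \<Lambda> u (n + m))"
proof (rule bij_betwI')
  fix p q
  assume p: "p \<in> (SIGMA a:paths_from \<Lambda> u n. paths_from \<Lambda> (src \<Lambda> a) m)"
    and q: "q \<in> (SIGMA a:paths_from \<Lambda> u n. paths_from \<Lambda> (src \<Lambda> a) m)"
  obtain a b c d where pq: "p = (a, b)" "q = (c, d)" by fastforce
  show "((\<lambda>(a, b). cmp \<Lambda> a b) p = (\<lambda>(a, b). cmp \<Lambda> a b) q) = (p = q)"
  proof
    assume "(\<lambda>(a, b). cmp \<Lambda> a b) p = (\<lambda>(a, b). cmp \<Lambda> a b) q"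
    then have eq: "cmp \<Lambda> a b = cmp \<Lambda> c d" by (simp add: pq)
    let ?Q = "\<lambda>(a', b'). a' \<in> mor \<Lambda> \<and> b' \<in> mor \<Lambda> \<and> src \<Lambda> a' = rng \<Lambda> b' \<and>
        deg \<Lambda> a' = n \<and> deg \<Lambda> b' = m \<and> cmp \<Lambda> a b = cmp \<Lambda> a' b'"
    have "\<exists>!p. ?Q p"
      using p pq by (intro factorization) (auto simp: paths_from_def cmp_mor deg_cmp)
    moreover have "?Q p" "?Q q"
      using p q eq by (auto simp: pq paths_from_def)
    ultimately show "p = q" by (rule ex1_unique)
  qed simp
next
  fix p assume "p \<in> (SIGMA a:paths_from \<Lambda> u n. paths_from \<Lambda> (src \<Lambda> a) m)"
  then show "(\<lambda>(a, b). cmp \<Lambda> a b) p \<in> paths_from \<Lambda> u (n + m)"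
    by (auto simp: paths_from_def cmp_mor rng_cmp deg_cmp)
next
  fix l assume "l \<in> paths_from \<Lambda> u (n + m)"
  then have l: "l \<in> mor \<Lambda>" "rng \<Lambda> l = u" "deg \<Lambda> l = n + m" by (auto simp: paths_from_def)
  from factorization[OF l(1,3)] obtain a b where
    "a \<in> mor \<Lambda>" "b \<in> mor \<Lambda>" "src \<Lambda> a = rng \<Lambda> b" "deg \<Lambda> a = n" "deg \<Lambda> b = m" "l = cmp \<Lambda> a b"
    by auto
  with l show "\<exists>p\<in>SIGMA a:paths_from \<Lambda> u n. paths_from \<Lambda> (src \<Lambda> a) m.
      l = (\<lambda>(a, b). cmp \<Lambda> a b) p"
    by (intro bexI[of _ "(a, b)"]) (auto simp: paths_from_def rng_cmp)
qed

end


section \<open>Graphs split by the heads of paths\<close>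

lemma one_nonzero: "(1 :: nat ^ 'k::finite) \<noteq> 0"
  by (simp add: vec_eq_iff)

text \<open>Abstraction of the in-split: every path \<open>a\<close> of \<open>\<Lambda>\<close> has one lift \<open>lift a w\<close> for each
  vertex \<open>w\<close> over its source, and the range of a lift of positive degree is the head
  \<open>head a\<close>, which depends on an initial edge of \<open>a\<close> only.\<close>

locale split_graph = k_graph \<Lambda>
  for \<Lambda> :: "('v, 'a, 'k::finite) kgraph" +
  fixes \<Lambda>' :: "('w, 'b, 'k) kgraph"
    and proj :: "'w \<Rightarrow> 'v" and base :: "'b \<Rightarrow> 'a"
    and head :: "'a \<Rightarrow> 'w" and lift :: "'a \<Rightarrow> 'w \<Rightarrow> 'b"
  assumes row_finite: "u \<in> obj \<Lambda> \<Longrightarrow> finite (paths_from \<Lambda> u n)"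
    and proj_obj: "w \<in> obj \<Lambda>' \<Longrightarrow> proj w \<in> obj \<Lambda>"
    and finite_fibre: "finite {w \<in> obj \<Lambda>'. proj w = u}"
    and head_obj: "\<lbrakk>a \<in> mor \<Lambda>; deg \<Lambda> a \<noteq> 0\<rbrakk> \<Longrightarrow> head a \<in> obj \<Lambda>'"
    and proj_head: "\<lbrakk>a \<in> mor \<Lambda>; deg \<Lambda> a \<noteq> 0\<rbrakk> \<Longrightarrow> proj (head a) = rng \<Lambda> a"
    and head_cmp: "\<lbrakk>a \<in> mor \<Lambda>; b \<in> mor \<Lambda>; src \<Lambda> a = rng \<Lambda> b; deg \<Lambda> a \<noteq> 0\<rbrakk>
      \<Longrightarrow> head (cmp \<Lambda> a b) = head a"
    and mor_split: "mor \<Lambda>' = {lift a w | a w. a \<in> mor \<Lambda> \<and> w \<in> obj \<Lambda>' \<and> proj w = src \<Lambda> a}"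
    and base_lift: "\<lbrakk>a \<in> mor \<Lambda>; w \<in> obj \<Lambda>'; proj w = src \<Lambda> a\<rbrakk> \<Longrightarrow> base (lift a w) = a"
    and src_lift: "\<lbrakk>a \<in> mor \<Lambda>; w \<in> obj \<Lambda>'; proj w = src \<Lambda> a\<rbrakk> \<Longrightarrow> src \<Lambda>' (lift a w) = w"
    and rng_lift: "\<lbrakk>a \<in> mor \<Lambda>; w \<in> obj \<Lambda>'; proj w = src \<Lambda> a\<rbrakk>
      \<Longrightarrow> rng \<Lambda>' (lift a w) = (if deg \<Lambda> a = 0 then w else head a)"
    and deg_lift: "\<lbrakk>a \<in> mor \<Lambda>; w \<in> obj \<Lambda>'; proj w = src \<Lambda> a\<rbrakk> \<Longrightarrow> deg \<Lambda>' (lift a w) = deg \<Lambda> a"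
    and cmp_lift: "\<lbrakk>a \<in> mor \<Lambda>; b \<in> mor \<Lambda>; src \<Lambda> a = rng \<Lambda> b; deg \<Lambda> b \<noteq> 0; w \<in> obj \<Lambda>'; proj w = src \<Lambda> b\<rbrakk>
      \<Longrightarrow> cmp \<Lambda>' (lift a (head b)) (lift b w) = lift (cmp \<Lambda> a b) w"
begin

definition fibre :: "'v \<Rightarrow> 'w set" where
  "fibre u = {w \<in> obj \<Lambda>'. proj w = u}"

lemma finite_fibre' [simp]: "finite (fibre u)"
  by (simp add: fibre_def finite_fibre)

lemmas lift_simps = base_lift src_lift rng_lift deg_lift

lemma mor_splitE:
  assumes "x \<in> mor \<Lambda>'"
  obtains a w where "x = lift a w" "a \<in> mor \<Lambda>" "w \<in> obj \<Lambda>'" "proj w = src \<Lambda> a"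
  using assms by (auto simp: mor_split)

lemma lift_mor: "\<lbrakk>a \<in> mor \<Lambda>; w \<in> obj \<Lambda>'; proj w = src \<Lambda> a\<rbrakk> \<Longrightarrow> lift a w \<in> mor \<Lambda>'"
  by (auto simp: mor_split)

lemma lift_inject:
  "\<lbrakk>a \<in> mor \<Lambda>; w \<in> obj \<Lambda>'; proj w = src \<Lambda> a; b \<in> mor \<Lambda>; z \<in> obj \<Lambda>'; proj z = src \<Lambda> b\<rbrakk>
    \<Longrightarrow> lift a w = lift b z \<longleftrightarrow> a = b \<and> w = z"
  using base_lift[of a w] base_lift[of b z] src_lift[of a w] src_lift[of b z] by auto

lemma composable_split: "composable \<Lambda>'"
proof
  fix x y
  assume x: "x \<in> mor \<Lambda>'"
  then show "src \<Lambda>' x \<in> obj \<Lambda>'" "rng \<Lambda>' x \<in> obj \<Lambda>'"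
    by (auto elim!: mor_splitE simp: lift_simps head_obj)
  assume y: "y \<in> mor \<Lambda>'" "deg \<Lambda>' x \<noteq> 0" "deg \<Lambda>' y \<noteq> 0" "src \<Lambda>' x = rng \<Lambda>' y"
  from x obtain a w where a: "x = lift a w" "a \<in> mor \<Lambda>" "w \<in> obj \<Lambda>'" "proj w = src \<Lambda> a"
    by (rule mor_splitE)
  from y(1) obtain b z where b: "y = lift b z" "b \<in> mor \<Lambda>" "z \<in> obj \<Lambda>'" "proj z = src \<Lambda> b"
    by (rule mor_splitE)
  from a b y have nz: "deg \<Lambda> a \<noteq> 0" "deg \<Lambda> b \<noteq> 0" and w: "w = head b"
    by (auto simp: lift_simps)
  with a b have comp: "src \<Lambda> a = rng \<Lambda> b" by (simp add: proj_head)
  have "cmp \<Lambda>' x y = lift (cmp \<Lambda> a b) z"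
    using a b nz w comp by (simp add: cmp_lift)
  then show "cmp \<Lambda>' x y \<in> mor \<Lambda>' \<and> deg \<Lambda>' (cmp \<Lambda>' x y) \<noteq> 0"
    using a b nz comp by (simp add: lift_mor lift_simps cmp_mor src_cmp deg_cmp_nonzero)
qed

definition headed_paths :: "nat ^ 'k \<Rightarrow> 'w \<Rightarrow> 'a set" where
  "headed_paths n w = {a \<in> paths_from \<Lambda> (proj w) n. head a = w}"

lemma headed_pathsD:
  assumes "a \<in> headed_paths n w"
  shows "a \<in> mor \<Lambda>" "deg \<Lambda> a = n" "head a = w" "rng \<Lambda> a = proj w" "src \<Lambda> a \<in> obj \<Lambda>"
  using assms by (auto simp: headed_paths_def paths_from_def src_obj)

lemma finite_headed_paths: "w \<in> obj \<Lambda>' \<Longrightarrow> finite (headed_paths n w)"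
  by (simp add: headed_paths_def row_finite proj_obj)

lemma headed_paths_iff:
  "n \<noteq> 0 \<Longrightarrow> a \<in> headed_paths n w \<longleftrightarrow> a \<in> mor \<Lambda> \<and> deg \<Lambda> a = n \<and> head a = w"
  by (auto simp: headed_paths_def paths_from_def proj_head)

lemma bij_betw_cmp_headed_paths:
  assumes "w \<in> obj \<Lambda>'" "n \<noteq> 0"
  shows "bij_betw (\<lambda>(a, b). cmp \<Lambda> a b)
    (SIGMA a:headed_paths n w. paths_from \<Lambda> (src \<Lambda> a) m) (headed_paths (n + m) w)"
proof -
  let ?B = "SIGMA a:paths_from \<Lambda> (proj w) n. paths_from \<Lambda> (src \<Lambda> a) m"
  let ?A = "SIGMA a:headed_paths n w. paths_from \<Lambda> (src \<Lambda> a) m"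
  have bij: "bij_betw (\<lambda>(a, b). cmp \<Lambda> a b) ?B (paths_from \<Lambda> (proj w) (n + m))"
    using assms(1) by (intro bij_betw_cmp_paths_from proj_obj)
  have head: "head (cmp \<Lambda> a b) = head a" if "(a, b) \<in> ?B" for a b
    using that assms(2) by (intro head_cmp) (auto simp: paths_from_def)
  have "(\<lambda>(a, b). cmp \<Lambda> a b) ` ?A = headed_paths (n + m) w"
  proof (intro equalityI subsetI)
    fix c assume "c \<in> (\<lambda>(a, b). cmp \<Lambda> a b) ` ?A"
    then obtain a b where "c = cmp \<Lambda> a b" "(a, b) \<in> ?B" "head a = w"
      by (auto simp: headed_paths_def)
    then show "c \<in> headed_paths (n + m) w"
      using bij head[of a b] by (auto simp: headed_paths_def bij_betw_def)
  next
    fix c assume c: "c \<in> headed_paths (n + m) w"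
    then have "c \<in> (\<lambda>(a, b). cmp \<Lambda> a b) ` ?B"
      using bij unfolding headed_paths_def bij_betw_def by simp
    then obtain a b where ab: "c = cmp \<Lambda> a b" "(a, b) \<in> ?B"
      by (elim imageE SigmaE) simp
    with c head[OF ab(2)] have "(a, b) \<in> ?A"
      by (auto simp: headed_paths_def)
    with ab(1) show "c \<in> (\<lambda>(a, b). cmp \<Lambda> a b) ` ?A" by force
  qed
  moreover have "?A \<subseteq> ?B" by (auto simp: headed_paths_def)
  ultimately show ?thesis
    using bij by (auto simp: bij_betw_def intro: inj_on_subset)
qed

lemma sum_headed_paths:
  assumes "u \<in> obj \<Lambda>" "n \<noteq> 0"
  shows "(\<Sum>w\<in>fibre u. \<Sum>a\<in>headed_paths n w. f a) = (\<Sum>a\<in>paths_from \<Lambda> u n. f a)"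
proof -
  have "(\<Sum>w\<in>fibre u. \<Sum>a\<in>{a \<in> paths_from \<Lambda> u n. head a = w}. f a) = (\<Sum>a\<in>paths_from \<Lambda> u n. f a)"
    using assms
    by (intro sum.group) (auto simp: row_finite, auto simp: fibre_def paths_from_def head_obj proj_head)
  moreover have "headed_paths n w = {a \<in> paths_from \<Lambda> u n. head a = w}" if "w \<in> fibre u" for w
    using that by (simp add: headed_paths_def fibre_def)
  ultimately show ?thesis
    by (simp cong: sum.cong)
qed

lemma sum_paths_from_split:
  assumes "w \<in> obj \<Lambda>'" "n \<noteq> 0"
  shows "(\<Sum>x\<in>paths_from \<Lambda>' w n. f x) = (\<Sum>a\<in>headed_paths n w. \<Sum>z\<in>fibre (src \<Lambda> a). f (lift a z))"
proof -
  have "bij_betw (\<lambda>(a, z). lift a z) (SIGMA a:headed_paths n w. fibre (src \<Lambda> a)) (paths_from \<Lambda>' w n)"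
    unfolding bij_betw_def
  proof
    show "inj_on (\<lambda>(a, z). lift a z) (SIGMA a:headed_paths n w. fibre (src \<Lambda> a))"
      by (auto simp: inj_on_def fibre_def lift_inject headed_pathsD(1))
    show "(\<lambda>(a, z). lift a z) ` (SIGMA a:headed_paths n w. fibre (src \<Lambda> a)) = paths_from \<Lambda>' w n"
      using assms(2)
      by (auto simp: paths_from_def fibre_def headed_paths_iff lift_mor lift_simps elim!: mor_splitE
          split: if_splits intro!: rev_image_eqI)
  qed
  from sum.reindex_bij_betw[OF this, of f] show ?thesis
    by (subst sum.Sigma) (auto simp: finite_headed_paths assms split_def)
qed

lemma sum_fibre_delta:
  assumes "w \<in> obj \<Lambda>'"
  shows "(\<Sum>z\<in>fibre u. if z = w then f z else 0) = (if proj w = u then f w else 0)"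
    and "(\<Sum>z\<in>fibre u. if w = z then f z else 0) = (if proj w = u then f w else 0)"
proof -
  have "w \<in> fibre u \<longleftrightarrow> proj w = u" using assms by (simp add: fibre_def)
  then show "(\<Sum>z\<in>fibre u. if z = w then f z else 0) = (if proj w = u then f w else 0)"
    and "(\<Sum>z\<in>fibre u. if w = z then f z else 0) = (if proj w = u then f w else 0)"
    by simp_all
qed

end

definition full_val ::
  "('v, 'a, 'k::finite) kgraph \<Rightarrow> ('v \<Rightarrow> 'r) \<Rightarrow> ('a \<Rightarrow> 'r) \<Rightarrow> 'a \<Rightarrow> 'r" where
  "full_val \<Lambda> P S a = (if deg \<Lambda> a = 0 then P (rng \<Lambda> a) else S a)"

locale composable_family = composable \<Lambda> + kp_family \<Lambda> P S T
  for \<Lambda> :: "('v, 'a, 'k::finite) kgraph" and P :: "'v \<Rightarrow> 'r::ring" and S T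
begin

lemma S_mult_P:
  assumes "a \<in> mor \<Lambda>" "deg \<Lambda> a \<noteq> 0" "w \<in> obj \<Lambda>"
  shows "S a * P w = (if src \<Lambda> a = w then S a else 0)"
proof -
  have *: "S a * P w = S a * (P (src \<Lambda> a) * P w)"
    using assms by (simp add: S_P flip: mult.assoc)
  show ?thesis by (subst *) (use assms in \<open>auto simp: P_mult src_in_obj S_P\<close>)
qed

lemma P_mult_S:
  assumes "a \<in> mor \<Lambda>" "deg \<Lambda> a \<noteq> 0" "w \<in> obj \<Lambda>"
  shows "P w * S a = (if rng \<Lambda> a = w then S a else 0)"
proof -
  have *: "P w * S a = (P w * P (rng \<Lambda> a)) * S a"
    using assms by (simp add: P_S mult.assoc)
  show ?thesis by (subst *) (use assms in \<open>auto simp: P_mult rng_in_obj P_S\<close>)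
qed

lemma T_mult_P:
  assumes "a \<in> mor \<Lambda>" "deg \<Lambda> a \<noteq> 0" "w \<in> obj \<Lambda>"
  shows "T a * P w = (if rng \<Lambda> a = w then T a else 0)"
proof -
  have *: "T a * P w = T a * (P (rng \<Lambda> a) * P w)"
    using assms by (simp add: T_P flip: mult.assoc)
  show ?thesis by (subst *) (use assms in \<open>auto simp: P_mult rng_in_obj T_P\<close>)
qed

lemma P_mult_T:
  assumes "a \<in> mor \<Lambda>" "deg \<Lambda> a \<noteq> 0" "w \<in> obj \<Lambda>"
  shows "P w * T a = (if src \<Lambda> a = w then T a else 0)"
proof -
  have *: "P w * T a = (P w * P (src \<Lambda> a)) * T a"
    using assms by (simp add: P_T mult.assoc)
  show ?thesis by (subst *) (use assms in \<open>auto simp: P_mult src_in_obj P_T\<close>)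
qed

lemma S_mult_S:
  assumes "a \<in> mor \<Lambda>" "deg \<Lambda> a \<noteq> 0" "b \<in> mor \<Lambda>" "deg \<Lambda> b \<noteq> 0"
  shows "S a * S b = (if src \<Lambda> a = rng \<Lambda> b then S (cmp \<Lambda> a b) else 0)"
proof -
  have *: "S a * S b = (S a * P (rng \<Lambda> b)) * S b"
    using assms by (simp add: P_S mult.assoc)
  show ?thesis by (subst *) (use assms in \<open>auto simp: S_mult_P rng_in_obj S_mult\<close>)
qed

lemma T_mult_T:
  assumes "a \<in> mor \<Lambda>" "deg \<Lambda> a \<noteq> 0" "b \<in> mor \<Lambda>" "deg \<Lambda> b \<noteq> 0"
  shows "T b * T a = (if src \<Lambda> a = rng \<Lambda> b then T (cmp \<Lambda> a b) else 0)"
proof -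
  have *: "T b * T a = T b * (P (rng \<Lambda> b) * T a)"
    using assms by (simp add: T_P flip: mult.assoc)
  show ?thesis by (subst *) (use assms in \<open>auto simp: P_mult_T rng_in_obj T_mult\<close>)
qed

end

context split_graph
begin

subsection \<open>From families of the split graph to families of the graph\<close>

definition P_down :: "('w \<Rightarrow> 'r::ring) \<Rightarrow> 'v \<Rightarrow> 'r" where
  "P_down P u = (\<Sum>w\<in>fibre u. P w)"

definition S_down :: "('b \<Rightarrow> 'r::ring) \<Rightarrow> 'a \<Rightarrow> 'r" where
  "S_down S a = (\<Sum>w\<in>fibre (src \<Lambda> a). S (lift a w))"

context
  fixes P :: "'w \<Rightarrow> 'r::ring" and S T :: "'b \<Rightarrow> 'r"
  assumes fam: "kp_family \<Lambda>' P S T"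
begin

interpretation composable_family \<Lambda>' P S T
  by (intro composable_family.intro fam composable_split)

lemma P_down_mult_P: "w \<in> obj \<Lambda>' \<Longrightarrow> P_down P u * P w = (if proj w = u then P w else 0)"
proof -
  assume w: "w \<in> obj \<Lambda>'"
  then have "P_down P u * P w = (\<Sum>z\<in>fibre u. if z = w then P z else 0)"
    unfolding P_down_def sum_distrib_right
    by (intro sum.cong) (auto simp: P_mult fibre_def)
  with w show ?thesis by (simp only: sum_fibre_delta)
qed

lemma P_mult_P_down: "w \<in> obj \<Lambda>' \<Longrightarrow> P w * P_down P u = (if proj w = u then P w else 0)"
proof -
  assume w: "w \<in> obj \<Lambda>'"
  then have "P w * P_down P u = (\<Sum>z\<in>fibre u. if w = z then P z else 0)"
    unfolding P_down_def sum_distrib_left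
    by (intro sum.cong) (auto simp: P_mult fibre_def)
  with w show ?thesis by (simp only: sum_fibre_delta)
qed

lemma S_lift_P:
  assumes "a \<in> mor \<Lambda>" "w \<in> fibre (src \<Lambda> a)" "deg \<Lambda> a \<noteq> 0" "z \<in> obj \<Lambda>'"
  shows "S (lift a w) * P z = (if w = z then S (lift a w) else 0)"
    and "P z * T (lift a w) = (if w = z then T (lift a w) else 0)"
    and "P z * S (lift a w) = (if z = head a then S (lift a w) else 0)"
    and "T (lift a w) * P z = (if z = head a then T (lift a w) else 0)"
  using assms by (auto simp: S_mult_P P_mult_S P_mult_T T_mult_P lift_mor lift_simps fibre_def)

lemma S_down_mult_P:
  assumes "a \<in> mor \<Lambda>" "deg \<Lambda> a \<noteq> 0" "w \<in> fibre (src \<Lambda> a)"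
  shows "S_down S a * P w = S (lift a w)"
    and "P w * S_down T a = T (lift a w)"
proof -
  have w: "w \<in> obj \<Lambda>'" "proj w = src \<Lambda> a" using assms by (auto simp: fibre_def)
  have "S_down S a * P w = (\<Sum>z\<in>fibre (src \<Lambda> a). if z = w then S (lift a z) else 0)"
    unfolding S_down_def sum_distrib_right
    by (intro sum.cong) (auto simp: S_lift_P assms w)
  then show "S_down S a * P w = S (lift a w)" by (simp only: sum_fibre_delta w simp_thms if_True)
  have "P w * S_down T a = (\<Sum>z\<in>fibre (src \<Lambda> a). if z = w then T (lift a z) else 0)"
    unfolding S_down_def sum_distrib_left
    by (intro sum.cong) (auto simp: S_lift_P assms w)
  then show "P w * S_down T a = T (lift a w)" by (simp only: sum_fibre_delta w simp_thms if_True)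
qed

lemma full_val_lift_mult:
  assumes "a \<in> mor \<Lambda>" "b \<in> mor \<Lambda>" "src \<Lambda> a = src \<Lambda> b"
    "w \<in> fibre (src \<Lambda> a)" "z \<in> fibre (src \<Lambda> a)" "w \<noteq> z"
  shows "full_val \<Lambda>' P S (lift a w) * full_val \<Lambda>' P T (lift b z) = 0"
proof -
  have wz: "w \<in> obj \<Lambda>'" "z \<in> obj \<Lambda>'" "proj w = src \<Lambda> a" "proj z = src \<Lambda> b"
    using assms by (auto simp: fibre_def)
  have "full_val \<Lambda>' P S (lift a w) = full_val \<Lambda>' P S (lift a w) * P w"
    using assms(1) wz by (auto simp: full_val_def S_mult_P P_mult lift_mor lift_simps)
  then have "full_val \<Lambda>' P S (lift a w) * full_val \<Lambda>' P T (lift b z) =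
      full_val \<Lambda>' P S (lift a w) * (P w * full_val \<Lambda>' P T (lift b z))"
    by (metis mult.assoc)
  also have "P w * full_val \<Lambda>' P T (lift b z) = 0"
    using assms(2,6) wz by (auto simp: full_val_def P_mult_T P_mult lift_mor lift_simps)
  finally show ?thesis by simp
qed

lemma full_val_down:
  assumes "a \<in> mor \<Lambda>"
  shows "full_val \<Lambda> (P_down P) (S_down S) a = (\<Sum>w\<in>fibre (src \<Lambda> a). full_val \<Lambda>' P S (lift a w))"
    and "full_val \<Lambda> (P_down P) (S_down T) a = (\<Sum>w\<in>fibre (src \<Lambda> a). full_val \<Lambda>' P T (lift a w))"
proof -
  have *: "w \<in> fibre (src \<Lambda> a) \<Longrightarrow> rng \<Lambda>' (lift a w) = (if deg \<Lambda> a = 0 then w else head a)"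
    "w \<in> fibre (src \<Lambda> a) \<Longrightarrow> deg \<Lambda>' (lift a w) = deg \<Lambda> a" for w
    using assms by (auto simp: fibre_def lift_simps)
  show "full_val \<Lambda> (P_down P) (S_down S) a = (\<Sum>w\<in>fibre (src \<Lambda> a). full_val \<Lambda>' P S (lift a w))"
    using assms deg_0_idm(2)[OF assms]
    by (simp add: full_val_def * P_down_def S_down_def cong: sum.cong)
  show "full_val \<Lambda> (P_down P) (S_down T) a = (\<Sum>w\<in>fibre (src \<Lambda> a). full_val \<Lambda>' P T (lift a w))"
    using assms deg_0_idm(2)[OF assms]
    by (simp add: full_val_def * P_down_def S_down_def cong: sum.cong)
qed

lemma full_val_down_mult:
  assumes "a \<in> mor \<Lambda>" "b \<in> mor \<Lambda>" "src \<Lambda> a = src \<Lambda> b"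
  shows "full_val \<Lambda> (P_down P) (S_down S) a * full_val \<Lambda> (P_down P) (S_down T) b =
    (\<Sum>w\<in>fibre (src \<Lambda> a). full_val \<Lambda>' P S (lift a w) * full_val \<Lambda>' P T (lift b w))"
proof -
  have "full_val \<Lambda> (P_down P) (S_down S) a * full_val \<Lambda> (P_down P) (S_down T) b =
      (\<Sum>w\<in>fibre (src \<Lambda> a). \<Sum>z\<in>fibre (src \<Lambda> a).
        full_val \<Lambda>' P S (lift a w) * full_val \<Lambda>' P T (lift b z))"
    using assms by (simp add: full_val_down sum_product)
  also have "\<dots> = (\<Sum>w\<in>fibre (src \<Lambda> a). \<Sum>z\<in>fibre (src \<Lambda> a).
      if w = z then full_val \<Lambda>' P S (lift a z) * full_val \<Lambda>' P T (lift b z) else 0)"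
    by (intro sum.cong) (auto simp: full_val_lift_mult assms)
  also have "\<dots> = (\<Sum>w\<in>fibre (src \<Lambda> a). full_val \<Lambda>' P S (lift a w) * full_val \<Lambda>' P T (lift b w))"
    by (intro sum.cong) (auto simp: sum.delta')
  finally show ?thesis .
qed

lemma S_down_mult_T_down:
  assumes "a \<in> mor \<Lambda>" "b \<in> mor \<Lambda>" "deg \<Lambda> a \<noteq> 0" "deg \<Lambda> b \<noteq> 0" "src \<Lambda> a = src \<Lambda> b"
  shows "S_down S a * S_down T b = (\<Sum>w\<in>fibre (src \<Lambda> a). S (lift a w) * T (lift b w))"
proof -
  have "full_val \<Lambda>' P S (lift a w) * full_val \<Lambda>' P T (lift b w) = S (lift a w) * T (lift b w)"
    if "w \<in> fibre (src \<Lambda> a)" for w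
    using that assms by (simp add: full_val_def fibre_def lift_simps)
  with full_val_down_mult[OF assms(1,2,5)] assms show ?thesis
    by (simp add: full_val_def cong: sum.cong)
qed

lemma sum_headed_down:
  assumes "w \<in> obj \<Lambda>'" "n \<noteq> 0"
  shows "(\<Sum>a\<in>headed_paths n w. S_down S a * S_down T a) = P w"
proof -
  have "P w = (\<Sum>a\<in>headed_paths n w. \<Sum>z\<in>fibre (src \<Lambda> a). S (lift a z) * T (lift a z))"
    using assms by (simp add: P_sum[of w n] sum_paths_from_split)
  also have "\<dots> = (\<Sum>a\<in>headed_paths n w. S_down S a * S_down T a)"
    by (intro sum.cong) (auto simp: S_down_mult_T_down headed_pathsD assms(2))
  finally show ?thesis by (rule sym)
qed

lemma kp_family_down: "kp_family \<Lambda> (P_down P) (S_down S) (S_down T)"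
proof
  fix u w
  have "P_down P u * P_down P w = (\<Sum>z\<in>fibre w. P_down P u * P z)"
    unfolding P_down_def[of P w] sum_distrib_left ..
  also have "\<dots> = (\<Sum>z\<in>fibre w. if w = u then P z else 0)"
    by (intro sum.cong) (auto simp: P_down_mult_P fibre_def)
  finally show "P_down P u * P_down P w = (if u = w then P_down P u else 0)"
    by (auto simp: P_down_def)
next
  fix l m assume lm: "l \<in> mor \<Lambda>" "m \<in> mor \<Lambda>" "deg \<Lambda> l \<noteq> 0" "deg \<Lambda> m \<noteq> 0" "src \<Lambda> l = rng \<Lambda> m"
  have head: "head m \<in> obj \<Lambda>'" "proj (head m) = src \<Lambda> l"
    using lm by (simp_all add: head_obj proj_head)
  have "S (lift l z) * S (lift m w) = (if z = head m then S (lift (cmp \<Lambda> l m) w) else 0)"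
    if "z \<in> fibre (src \<Lambda> l)" "w \<in> fibre (src \<Lambda> m)" for z w
    using that lm head
    by (auto simp: S_mult_S lift_mor lift_simps fibre_def cmp_lift)
  then have "S_down S l * S_down S m =
      (\<Sum>w\<in>fibre (src \<Lambda> m). \<Sum>z\<in>fibre (src \<Lambda> l). if z = head m then S (lift (cmp \<Lambda> l m) w) else 0)"
    unfolding S_down_def sum_product by (subst sum.swap) simp
  then show "S_down S l * S_down S m = S_down S (cmp \<Lambda> l m)"
    using lm head by (simp only: sum_fibre_delta simp_thms if_True S_down_def src_cmp)
  have "T (lift m w) * T (lift l z) = (if z = head m then T (lift (cmp \<Lambda> l m) w) else 0)"
    if "z \<in> fibre (src \<Lambda> l)" "w \<in> fibre (src \<Lambda> m)" for z w
    using that lm head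
    by (auto simp: T_mult_T lift_mor lift_simps fibre_def cmp_lift)
  then have "S_down T m * S_down T l =
      (\<Sum>w\<in>fibre (src \<Lambda> m). \<Sum>z\<in>fibre (src \<Lambda> l). if z = head m then T (lift (cmp \<Lambda> l m) w) else 0)"
    unfolding S_down_def sum_product by simp
  then show "S_down T m * S_down T l = S_down T (cmp \<Lambda> l m)"
    using lm head by (simp only: sum_fibre_delta simp_thms if_True S_down_def src_cmp)
next
  fix l assume l: "l \<in> mor \<Lambda>" "deg \<Lambda> l \<noteq> 0"
  have h: "head l \<in> obj \<Lambda>'" "proj (head l) = rng \<Lambda> l"
    using l by (simp_all add: head_obj proj_head)
  have f: "z \<in> obj \<Lambda>'" "proj z = src \<Lambda> l" if "z \<in> fibre (src \<Lambda> l)" for z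
    using that by (auto simp: fibre_def)
  have "P_down P (rng \<Lambda> l) * S (lift l z) = S (lift l z)" if "z \<in> fibre (src \<Lambda> l)" for z
  proof -
    have "P_down P (rng \<Lambda> l) * S (lift l z) = (P_down P (rng \<Lambda> l) * P (head l)) * S (lift l z)"
      using that l h by (simp add: S_lift_P mult.assoc)
    then show ?thesis using that l h by (simp add: P_down_mult_P S_lift_P)
  qed
  then show "P_down P (rng \<Lambda> l) * S_down S l = S_down S l"
    by (simp add: S_down_def sum_distrib_left)
  have "T (lift l z) * P_down P (rng \<Lambda> l) = T (lift l z)" if "z \<in> fibre (src \<Lambda> l)" for z
  proof -
    have "T (lift l z) * P_down P (rng \<Lambda> l) = T (lift l z) * (P (head l) * P_down P (rng \<Lambda> l))"
      using that l h by (simp add: S_lift_P flip: mult.assoc)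
    then show ?thesis using that l h by (simp add: P_mult_P_down S_lift_P)
  qed
  then show "S_down T l * P_down P (rng \<Lambda> l) = S_down T l"
    by (simp add: S_down_def sum_distrib_right)
  show "S_down S l * P_down P (src \<Lambda> l) = S_down S l"
    unfolding P_down_def sum_distrib_left S_down_def[of S l]
    by (intro sum.cong refl) (simp add: S_down_mult_P l flip: S_down_def)
  show "P_down P (src \<Lambda> l) * S_down T l = S_down T l"
    unfolding P_down_def sum_distrib_right S_down_def[of T l]
    by (intro sum.cong refl) (simp add: S_down_mult_P l flip: S_down_def)
next
  fix l m assume lm: "l \<in> mor \<Lambda>" "m \<in> mor \<Lambda>" "deg \<Lambda> l \<noteq> 0" "deg \<Lambda> l = deg \<Lambda> m"
  have "T (lift l z) * S (lift m w) = (if l = m \<and> z = w then P z else 0)"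
    if "z \<in> fibre (src \<Lambda> l)" "w \<in> fibre (src \<Lambda> m)" for z w
    using that lm by (auto simp: T_S lift_mor lift_simps fibre_def lift_inject)
  then have "S_down T l * S_down S m =
      (\<Sum>z\<in>fibre (src \<Lambda> l). \<Sum>w\<in>fibre (src \<Lambda> m). if l = m \<and> z = w then P z else 0)"
    unfolding S_down_def sum_product by simp
  also have "\<dots> = (if l = m then P_down P (src \<Lambda> l) else 0)"
    by (auto simp: P_down_def sum.delta' cong: sum.cong)
  finally show "S_down T l * S_down S m = (if l = m then P_down P (src \<Lambda> l) else 0)" .
next
  fix u and n :: "nat ^ 'k" assume un: "u \<in> obj \<Lambda>" "n \<noteq> 0"
  have "P_down P u = (\<Sum>w\<in>fibre u. \<Sum>a\<in>headed_paths n w. S_down S a * S_down T a)"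
    unfolding P_down_def using un by (intro sum.cong) (auto simp: sum_headed_down fibre_def)
  then show "P_down P u = (\<Sum>l\<in>paths_from \<Lambda> u n. S_down S l * S_down T l)"
    using sum_headed_paths[OF un, of "\<lambda>a. S_down S a * S_down T a"] by simp
qed

end

subsection \<open>From families of the graph to families of the split graph\<close>

definition head_proj :: "nat ^ 'k \<Rightarrow> ('a \<Rightarrow> 'r::ring) \<Rightarrow> ('a \<Rightarrow> 'r) \<Rightarrow> 'w \<Rightarrow> 'r" where
  "head_proj n S T w = (\<Sum>a\<in>headed_paths n w. S a * T a)"

text \<open>The degree 1 (the sum of all basis vectors) may be replaced by any other nonzero degree.\<close>

definition P_up :: "('a \<Rightarrow> 'r::ring) \<Rightarrow> ('a \<Rightarrow> 'r) \<Rightarrow> 'w \<Rightarrow> 'r" where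
  "P_up S T = head_proj 1 S T"

definition S_up :: "('a \<Rightarrow> 'r::ring) \<Rightarrow> ('a \<Rightarrow> 'r) \<Rightarrow> 'b \<Rightarrow> 'r" where
  "S_up S T x = S (base x) * P_up S T (src \<Lambda>' x)"

definition T_up :: "('a \<Rightarrow> 'r::ring) \<Rightarrow> ('a \<Rightarrow> 'r) \<Rightarrow> 'b \<Rightarrow> 'r" where
  "T_up S T x = P_up S T (src \<Lambda>' x) * T (base x)"

context
  fixes P :: "'v \<Rightarrow> 'r::ring" and S T :: "'a \<Rightarrow> 'r"
  assumes fam: "kp_family \<Lambda> P S T"
begin

interpretation composable_family \<Lambda> P S T
  by (intro composable_family.intro fam composable)

lemma head_proj_mult_S:
  assumes "a \<in> mor \<Lambda>" "deg \<Lambda> a = n" "n \<noteq> 0" "w \<in> obj \<Lambda>'"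
  shows "head_proj n S T w * S a = (if head a = w then S a else 0)"
proof -
  have "(S b * T b) * S a = (if b = a then S a else 0)" if "b \<in> headed_paths n w" for b
    using that assms headed_pathsD(1,2)[OF that] by (simp add: mult.assoc T_S S_P)
  then have "head_proj n S T w * S a = (\<Sum>b\<in>headed_paths n w. if b = a then S a else 0)"
    by (simp add: head_proj_def sum_distrib_right)
  also have "\<dots> = (if head a = w then S a else 0)"
    using assms by (simp add: finite_headed_paths headed_paths_iff)
  finally show ?thesis .
qed

lemma T_mult_head_proj:
  assumes "a \<in> mor \<Lambda>" "deg \<Lambda> a = n" "n \<noteq> 0" "w \<in> obj \<Lambda>'"
  shows "T a * head_proj n S T w = (if head a = w then T a else 0)"
proof -
  have "T a * (S b * T b) = (if b = a then T a else 0)" if "b \<in> headed_paths n w" for b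
    using that assms headed_pathsD(1,2)[OF that] by (auto simp: T_S P_T simp flip: mult.assoc)
  then have "T a * head_proj n S T w = (\<Sum>b\<in>headed_paths n w. if b = a then T a else 0)"
    by (simp add: head_proj_def sum_distrib_left)
  also have "\<dots> = (if head a = w then T a else 0)"
    using assms by (simp add: finite_headed_paths headed_paths_iff)
  finally show ?thesis .
qed

lemma head_proj_add:
  assumes "w \<in> obj \<Lambda>'" "n \<noteq> 0" "m \<noteq> 0"
  shows "head_proj (n + m) S T w = head_proj n S T w"
proof -
  have "S a * T a = (\<Sum>b\<in>paths_from \<Lambda> (src \<Lambda> a) m. S (cmp \<Lambda> a b) * T (cmp \<Lambda> a b))"
    if "a \<in> headed_paths n w" for a
  proof -
    have a: "a \<in> mor \<Lambda>" "deg \<Lambda> a \<noteq> 0" "src \<Lambda> a \<in> obj \<Lambda>"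
      using headed_pathsD[OF that] assms by auto
    have "S a * T a = S a * P (src \<Lambda> a) * T a"
      using a by (simp add: S_P)
    also have "\<dots> = (\<Sum>b\<in>paths_from \<Lambda> (src \<Lambda> a) m. (S a * S b) * (T b * T a))"
      using a assms(3)
      by (simp add: P_sum[of "src \<Lambda> a" m] sum_distrib_left sum_distrib_right mult.assoc)
    also have "\<dots> = (\<Sum>b\<in>paths_from \<Lambda> (src \<Lambda> a) m. S (cmp \<Lambda> a b) * T (cmp \<Lambda> a b))"
      using a assms(3) by (intro sum.cong) (auto simp: S_mult T_mult paths_from_def)
    finally show ?thesis .
  qed
  then have "head_proj n S T w =
      (\<Sum>a\<in>headed_paths n w. \<Sum>b\<in>paths_from \<Lambda> (src \<Lambda> a) m. S (cmp \<Lambda> a b) * T (cmp \<Lambda> a b))"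
    by (simp add: head_proj_def)
  also have "\<dots> = (\<Sum>(a, b)\<in>(SIGMA a:headed_paths n w. paths_from \<Lambda> (src \<Lambda> a) m).
      S (cmp \<Lambda> a b) * T (cmp \<Lambda> a b))"
    using assms(1) by (intro sum.Sigma) (auto simp: finite_headed_paths row_finite headed_pathsD(5))
  also have "\<dots> = head_proj (n + m) S T w"
    using sum.reindex_bij_betw[OF bij_betw_cmp_headed_paths[OF assms(1,2), of m],
        of "\<lambda>c. S c * T c"]
    by (simp add: head_proj_def split_def)
  finally show ?thesis by (rule sym)
qed

lemma head_proj_eq_P_up:
  assumes "w \<in> obj \<Lambda>'" "n \<noteq> 0"
  shows "head_proj n S T w = P_up S T w"
  using head_proj_add[of w n 1] head_proj_add[of w 1 n] assms one_nonzero
  by (simp add: P_up_def add.commute)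

lemma P_up_mult_S:
  "\<lbrakk>a \<in> mor \<Lambda>; deg \<Lambda> a \<noteq> 0; w \<in> obj \<Lambda>'\<rbrakk> \<Longrightarrow> P_up S T w * S a = (if head a = w then S a else 0)"
  using head_proj_mult_S[of a "deg \<Lambda> a" w] by (simp add: head_proj_eq_P_up)

lemma T_mult_P_up:
  "\<lbrakk>a \<in> mor \<Lambda>; deg \<Lambda> a \<noteq> 0; w \<in> obj \<Lambda>'\<rbrakk> \<Longrightarrow> T a * P_up S T w = (if head a = w then T a else 0)"
  using T_mult_head_proj[of a "deg \<Lambda> a" w] by (simp add: head_proj_eq_P_up)

lemma P_up_mult_P_up:
  assumes "w \<in> obj \<Lambda>'" "z \<in> obj \<Lambda>'"
  shows "P_up S T w * P_up S T z = (if w = z then P_up S T w else 0)"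
proof -
  have "P_up S T w * (S b * T b) = (if w = z then S b * T b else 0)"
    if "b \<in> headed_paths 1 z" for b
    using that assms one_nonzero
    by (auto simp: P_up_mult_S headed_paths_iff simp flip: mult.assoc)
  then have "P_up S T w * P_up S T z = (\<Sum>b\<in>headed_paths 1 z. if w = z then S b * T b else 0)"
    by (simp add: P_up_def[of S T] head_proj_def[of 1 S T z] sum_distrib_left)
  then show ?thesis by (simp add: P_up_def head_proj_def)
qed

lemma P_mult_P_up:
  assumes "w \<in> obj \<Lambda>'" "u \<in> obj \<Lambda>"
  shows "P u * P_up S T w = (if proj w = u then P_up S T w else 0)"
    and "P_up S T w * P u = (if proj w = u then P_up S T w else 0)"
proof -
  have "P u * (S b * T b) = (if proj w = u then S b * T b else 0)"
    "(S b * T b) * P u = (if proj w = u then S b * T b else 0)"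
    if "b \<in> headed_paths 1 w" for b
    using headed_pathsD[OF that] assms(2) one_nonzero
    by (simp_all add: P_mult_S mult.assoc T_mult_P) (simp add: P_mult_S flip: mult.assoc)
  then show "P u * P_up S T w = (if proj w = u then P_up S T w else 0)"
    and "P_up S T w * P u = (if proj w = u then P_up S T w else 0)"
    by (simp_all add: P_up_def head_proj_def sum_distrib_left sum_distrib_right)
qed

lemma sum_P_up: "u \<in> obj \<Lambda> \<Longrightarrow> (\<Sum>w\<in>fibre u. P_up S T w) = P u"
  by (simp add: P_up_def head_proj_def sum_headed_paths one_nonzero P_sum[of u 1])

lemma S_up_lift:
  assumes "a \<in> mor \<Lambda>" "w \<in> obj \<Lambda>'" "proj w = src \<Lambda> a"
  shows "S_up S T (lift a w) = S a * P_up S T w" "T_up S T (lift a w) = P_up S T w * T a"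
  using assms by (simp_all add: S_up_def T_up_def lift_simps)

lemma kp_family_up: "kp_family \<Lambda>' (P_up S T) (S_up S T) (T_up S T)"
proof
  show "P_up S T u * P_up S T w = (if u = w then P_up S T u else 0)"
    if "u \<in> obj \<Lambda>'" "w \<in> obj \<Lambda>'" for u w
    using that by (rule P_up_mult_P_up)
next
  fix x y assume xy: "x \<in> mor \<Lambda>'" "y \<in> mor \<Lambda>'" "deg \<Lambda>' x \<noteq> 0" "deg \<Lambda>' y \<noteq> 0" "src \<Lambda>' x = rng \<Lambda>' y"
  obtain a w where a: "x = lift a w" "a \<in> mor \<Lambda>" "w \<in> obj \<Lambda>'" "proj w = src \<Lambda> a"
    using xy(1) by (rule mor_splitE)
  obtain b z where b: "y = lift b z" "b \<in> mor \<Lambda>" "z \<in> obj \<Lambda>'" "proj z = src \<Lambda> b"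
    using xy(2) by (rule mor_splitE)
  have nz: "deg \<Lambda> a \<noteq> 0" "deg \<Lambda> b \<noteq> 0" and w: "w = head b"
    using a b xy by (auto simp: lift_simps)
  with a b have comp: "src \<Lambda> a = rng \<Lambda> b" by (simp add: proj_head)
  have cmp: "cmp \<Lambda>' x y = lift (cmp \<Lambda> a b) z"
    using a b nz w comp by (simp add: cmp_lift)
  have ab: "cmp \<Lambda> a b \<in> mor \<Lambda>" "proj z = src \<Lambda> (cmp \<Lambda> a b)"
    using a b comp by (simp_all add: cmp_mor src_cmp)
  have "S_up S T x * S_up S T y = S a * (P_up S T w * S b) * P_up S T z"
    using a b by (simp add: S_up_lift mult.assoc)
  also have "\<dots> = S_up S T (lift (cmp \<Lambda> a b) z)"
    using a b nz w comp ab by (simp add: P_up_mult_S S_up_lift S_mult)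
  finally show "S_up S T x * S_up S T y = S_up S T (cmp \<Lambda>' x y)"
    by (simp only: cmp)
  have "T_up S T y * T_up S T x = P_up S T z * (T b * P_up S T w) * T a"
    using a b by (simp add: S_up_lift mult.assoc)
  also have "\<dots> = T_up S T (lift (cmp \<Lambda> a b) z)"
    using a b nz w comp ab by (simp add: T_mult_P_up S_up_lift T_mult mult.assoc)
  finally show "T_up S T y * T_up S T x = T_up S T (cmp \<Lambda>' x y)"
    by (simp only: cmp)
next
  fix x assume x: "x \<in> mor \<Lambda>'" "deg \<Lambda>' x \<noteq> 0"
  obtain a w where a: "x = lift a w" "a \<in> mor \<Lambda>" "w \<in> obj \<Lambda>'" "proj w = src \<Lambda> a"
    using x(1) by (rule mor_splitE)
  have nz: "deg \<Lambda> a \<noteq> 0" and r: "rng \<Lambda>' (lift a w) = head a" "src \<Lambda>' (lift a w) = w"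
    using a x by (auto simp: lift_simps)
  have h: "head a \<in> obj \<Lambda>'" using a nz by (simp add: head_obj)
  show "P_up S T (rng \<Lambda>' x) * S_up S T x = S_up S T x"
    unfolding a(1) r S_up_lift[OF a(2-4)] mult.assoc[symmetric] using a nz h by (simp add: P_up_mult_S)
  show "T_up S T x * P_up S T (rng \<Lambda>' x) = T_up S T x"
    unfolding a(1) r S_up_lift[OF a(2-4)] mult.assoc using a nz h by (simp add: T_mult_P_up)
  show "S_up S T x * P_up S T (src \<Lambda>' x) = S_up S T x"
    unfolding a(1) r S_up_lift[OF a(2-4)] mult.assoc using a by (simp add: P_up_mult_P_up)
  show "P_up S T (src \<Lambda>' x) * T_up S T x = T_up S T x"
    unfolding a(1) r S_up_lift[OF a(2-4)] mult.assoc[symmetric] using a by (simp add: P_up_mult_P_up)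
next
  fix x y assume xy: "x \<in> mor \<Lambda>'" "y \<in> mor \<Lambda>'" "deg \<Lambda>' x \<noteq> 0" "deg \<Lambda>' x = deg \<Lambda>' y"
  obtain a w where a: "x = lift a w" "a \<in> mor \<Lambda>" "w \<in> obj \<Lambda>'" "proj w = src \<Lambda> a"
    using xy(1) by (rule mor_splitE)
  obtain b z where b: "y = lift b z" "b \<in> mor \<Lambda>" "z \<in> obj \<Lambda>'" "proj z = src \<Lambda> b"
    using xy(2) by (rule mor_splitE)
  have nz: "deg \<Lambda> a \<noteq> 0" "deg \<Lambda> a = deg \<Lambda> b"
    using a b xy by (auto simp: lift_simps)
  have "T_up S T x * S_up S T y = P_up S T w * (T a * S b) * P_up S T z"
    using a b by (simp add: S_up_lift mult.assoc)
  also have "\<dots> = (if x = y then P_up S T (src \<Lambda>' x) else 0)"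
    using a b nz by (simp add: T_S P_mult_P_up src_obj P_up_mult_P_up lift_inject src_lift)
  finally show "T_up S T x * S_up S T y = (if x = y then P_up S T (src \<Lambda>' x) else 0)" .
next
  fix w and n :: "nat ^ 'k" assume wn: "w \<in> obj \<Lambda>'" "n \<noteq> 0"
  have "S a * T a = (\<Sum>z\<in>fibre (src \<Lambda> a). S_up S T (lift a z) * T_up S T (lift a z))"
    if "a \<in> headed_paths n w" for a
  proof -
    have a: "a \<in> mor \<Lambda>" "deg \<Lambda> a \<noteq> 0" "src \<Lambda> a \<in> obj \<Lambda>"
      using headed_pathsD[OF that] wn by auto
    have "S a * T a = S a * P (src \<Lambda> a) * T a"
      using a by (simp add: S_P)
    also have "\<dots> = (\<Sum>z\<in>fibre (src \<Lambda> a). S a * P_up S T z * T a)"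
      by (simp only: sum_distrib_left sum_distrib_right flip: sum_P_up[OF a(3)])
    also have "\<dots> = (\<Sum>z\<in>fibre (src \<Lambda> a). S a * (P_up S T z * P_up S T z) * T a)"
      by (intro sum.cong) (auto simp: P_up_mult_P_up fibre_def)
    also have "\<dots> = (\<Sum>z\<in>fibre (src \<Lambda> a). S_up S T (lift a z) * T_up S T (lift a z))"
      using a by (intro sum.cong) (auto simp: S_up_lift fibre_def mult.assoc)
    finally show ?thesis .
  qed
  then have "head_proj n S T w = (\<Sum>x\<in>paths_from \<Lambda>' w n. S_up S T x * T_up S T x)"
    using wn by (simp add: sum_paths_from_split head_proj_def)
  then show "P_up S T w = (\<Sum>x\<in>paths_from \<Lambda>' w n. S_up S T x * T_up S T x)"
    using wn by (simp add: head_proj_eq_P_up)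
qed

lemma S_down_S_up:
  assumes "a \<in> mor \<Lambda>" "deg \<Lambda> a \<noteq> 0"
  shows "S_down (S_up S T) a = S a" "S_down (T_up S T) a = T a"
proof -
  have "S_down (S_up S T) a = (\<Sum>w\<in>fibre (src \<Lambda> a). S a * P_up S T w)"
    unfolding S_down_def using assms by (intro sum.cong) (auto simp: S_up_lift fibre_def)
  then show "S_down (S_up S T) a = S a"
    using assms by (simp add: sum_P_up src_obj S_P flip: sum_distrib_left)
  have "S_down (T_up S T) a = (\<Sum>w\<in>fibre (src \<Lambda> a). P_up S T w * T a)"
    unfolding S_down_def using assms by (intro sum.cong) (auto simp: S_up_lift fibre_def)
  then show "S_down (T_up S T) a = T a"
    using assms by (simp add: sum_P_up src_obj P_T flip: sum_distrib_right)
qed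

lemma full_val_up_lift:
  assumes "a \<in> mor \<Lambda>" "w \<in> obj \<Lambda>'" "proj w = src \<Lambda> a"
  shows "full_val \<Lambda>' (P_up S T) (S_up S T) (lift a w) = full_val \<Lambda> P S a * P_up S T w"
    and "full_val \<Lambda>' (P_up S T) (T_up S T) (lift a w) = P_up S T w * full_val \<Lambda> P T a"
  using assms deg_0_idm(2)[OF assms(1)]
  by (auto simp: full_val_def lift_simps S_up_lift
      P_mult_P_up src_obj rng_obj)

lemma full_val_mult:
  assumes "a \<in> mor \<Lambda>" "c \<in> mor \<Lambda>" "src \<Lambda> a = rng \<Lambda> c" "deg \<Lambda> c \<noteq> 0"
  shows "full_val \<Lambda> P S a * S c = S (cmp \<Lambda> a c)" "T c * full_val \<Lambda> P T a = T (cmp \<Lambda> a c)"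
proof -
  have "cmp \<Lambda> a c = c" "rng \<Lambda> a = rng \<Lambda> c" if "deg \<Lambda> a = 0"
    using deg_0_idm[OF assms(1) that] assms cmp_idm_left[of c] by auto
  then show "full_val \<Lambda> P S a * S c = S (cmp \<Lambda> a c)" "T c * full_val \<Lambda> P T a = T (cmp \<Lambda> a c)"
    using assms by (auto simp: full_val_def S_mult T_mult P_S T_P)
qed

lemma full_val_up_mult:
  assumes "a \<in> mor \<Lambda>" "b \<in> mor \<Lambda>" "w \<in> obj \<Lambda>'" "proj w = src \<Lambda> a" "proj w = src \<Lambda> b"
  shows "full_val \<Lambda>' (P_up S T) (S_up S T) (lift a w) * full_val \<Lambda>' (P_up S T) (T_up S T) (lift b w) =
    (\<Sum>c\<in>headed_paths 1 w. S (cmp \<Lambda> a c) * T (cmp \<Lambda> b c))"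
proof -
  have "full_val \<Lambda>' (P_up S T) (S_up S T) (lift a w) * full_val \<Lambda>' (P_up S T) (T_up S T) (lift b w) =
      full_val \<Lambda> P S a * (P_up S T w * P_up S T w) * full_val \<Lambda> P T b"
    using assms by (simp add: full_val_up_lift mult.assoc)
  also have "\<dots> = (\<Sum>c\<in>headed_paths 1 w. (full_val \<Lambda> P S a * S c) * (T c * full_val \<Lambda> P T b))"
    unfolding P_up_mult_P_up[OF assms(3,3)] if_P[OF refl]
    by (simp add: P_up_def head_proj_def sum_distrib_left sum_distrib_right mult.assoc)
  also have "\<dots> = (\<Sum>c\<in>headed_paths 1 w. S (cmp \<Lambda> a c) * T (cmp \<Lambda> b c))"
  proof (intro sum.cong refl)
    fix c assume "c \<in> headed_paths 1 w"
    note c = headed_pathsD(1)[OF this] headed_pathsD(2)[OF this] headed_pathsD(4)[OF this]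
    show "(full_val \<Lambda> P S a * S c) * (T c * full_val \<Lambda> P T b) = S (cmp \<Lambda> a c) * T (cmp \<Lambda> b c)"
      using assms c one_nonzero by (simp add: full_val_mult)
  qed
  finally show ?thesis .
qed

end

end


section \<open>The graded isomorphism\<close>

lemma ring_hom_full_val:
  "ring_hom h \<Longrightarrow> h (full_val \<Lambda> p s a) = full_val \<Lambda> (\<lambda>u. h (p u)) (\<lambda>l. h (s l)) a"
  by (simp add: full_val_def)

lemma kp_gens_iff [simp]:
  "Vtx u \<in> kp_gens \<Lambda> \<longleftrightarrow> u \<in> obj \<Lambda>"
  "Path a \<in> kp_gens \<Lambda> \<longleftrightarrow> a \<in> mor \<Lambda> \<and> deg \<Lambda> a \<noteq> 0"
  "Ghost a \<in> kp_gens \<Lambda> \<longleftrightarrow> a \<in> mor \<Lambda> \<and> deg \<Lambda> a \<noteq> 0"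
  by (auto simp: kp_gens_def)

definition kp_comp ::
  "('v, 'a, 'k::finite) kgraph \<Rightarrow> int ^ 'k \<Rightarrow> ('f::field, ('v, 'a) kp_gen) free_elem set" where
  "kp_comp \<Lambda> n = {full_val \<Lambda> kp_p kp_s a * full_val \<Lambda> kp_p kp_t b | a b.
     a \<in> mor \<Lambda> \<and> b \<in> mor \<Lambda> \<and> src \<Lambda> a = src \<Lambda> b \<and>
     int_deg (deg \<Lambda> a) - int_deg (deg \<Lambda> b) = n}"

lemma (in composable) full_val_carrier:
  assumes "a \<in> mor \<Lambda>"
  shows "full_val \<Lambda> kp_p kp_s a \<in> free_carrier (kp_gens \<Lambda>)"
    and "full_val \<Lambda> kp_p kp_t a \<in> free_carrier (kp_gens \<Lambda>)"
  using assms by (simp_all add: full_val_def gens_carrier rng_in_obj)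

lemma (in composable) kp_comp_carrier: "kp_comp \<Lambda> n \<subseteq> free_carrier (kp_gens \<Lambda>)"
  by (auto simp: kp_comp_def full_val_carrier free_carrier_mult)

lemma (in composable) KP_eq_graded_presented:
  "KP TYPE('f::field) \<Lambda> = graded_presented (kp_gens \<Lambda>) (kp_rels \<Lambda>) (kp_comp \<Lambda>)"
proof -
  have "{amult (kp_algebra TYPE('f) \<Lambda>) (path_elem \<Lambda> a) (ghost_elem \<Lambda> b) | a b.
           a \<in> mor \<Lambda> \<and> b \<in> mor \<Lambda> \<and> src \<Lambda> a = src \<Lambda> b \<and>
           int_deg (deg \<Lambda> a) - int_deg (deg \<Lambda> b) = n} =
      rel_class (kp_gens \<Lambda>) (kp_rels \<Lambda>) ` kp_comp \<Lambda> n" for n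
  proof -
    have "amult (kp_algebra TYPE('f) \<Lambda>) (path_elem \<Lambda> a) (ghost_elem \<Lambda> b) =
        rel_class (kp_gens \<Lambda>) (kp_rels \<Lambda>) (full_val \<Lambda> kp_p kp_s a * full_val \<Lambda> kp_p kp_t b)"
      if "a \<in> mor \<Lambda>" "b \<in> mor \<Lambda>" for a b
      using amult_presented[OF full_val_carrier(1)[OF that(1)] full_val_carrier(2)[OF that(2)],
          of "kp_rels \<Lambda>"]
      by (simp add: kp_algebra_def path_elem_def ghost_elem_def kp_class_def full_val_def)
    then show ?thesis
      unfolding kp_comp_def
      by (intro equalityI subsetI; elim CollectE exE conjE imageE; simp only:) blast+
  qed
  then show ?thesis
    by (simp add: KP_def graded_presented_def kp_algebra_def)
qed

lemma rel_class_sum_vspan: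
  assumes "\<And>i. i \<in> I \<Longrightarrow> f i \<in> B" "B \<subseteq> free_carrier G"
  shows "rel_class G R (\<Sum>i\<in>I. f i) \<in> vspan (presented_algebra G R) (rel_class G R ` B)"
  using assms(1)
proof (induction I rule: infinite_finite_induct)
  case (insert i I)
  have "f i \<in> free_carrier G" "(\<Sum>i\<in>I. f i) \<in> free_carrier G"
    using insert.prems assms(2) by (auto intro!: free_carrier_sum)
  then have "rel_class G R (\<Sum>i\<in>insert i I. f i) =
      vadd (presented_algebra G R) (rel_class G R (f i)) (rel_class G R (\<Sum>i\<in>I. f i))"
    using insert.hyps by (simp add: vadd_presented)
  also have "\<dots> \<in> vspan (presented_algebra G R) (rel_class G R ` B)"
    using insert.IH insert.prems by (intro vspan.add vspan.base[of "rel_class G R (f i)"]) auto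
  finally show ?case .
qed (simp_all add: vspan.zero flip: vzero_presented)

context split_graph
begin

definition gen_down :: "('v, 'a) kp_gen \<Rightarrow> ('f::field, ('w, 'b) kp_gen) free_elem" where
  "gen_down g = (case g of Vtx u \<Rightarrow> P_down kp_p u | Path a \<Rightarrow> S_down kp_s a | Ghost a \<Rightarrow> S_down kp_t a)"

definition gen_up :: "('w, 'b) kp_gen \<Rightarrow> ('f::field, ('v, 'a) kp_gen) free_elem" where
  "gen_up g = (case g of Vtx w \<Rightarrow> P_up kp_s kp_t w | Path x \<Rightarrow> S_up kp_s kp_t x
     | Ghost x \<Rightarrow> T_up kp_s kp_t x)"

interpretation G: composable \<Lambda> by (rule composable)
interpretation G': composable \<Lambda>' by (rule composable_split)

lemma ring_hom_gen_down:
  assumes "ring_hom h"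
  shows "h (gen_down (Vtx u)) = P_down (\<lambda>w. h (kp_p w)) u"
    and "h (gen_down (Path a)) = S_down (\<lambda>x. h (kp_s x)) a"
    and "h (gen_down (Ghost a)) = S_down (\<lambda>x. h (kp_t x)) a"
  by (simp_all add: gen_down_def P_down_def S_down_def ring_hom_sum[OF assms])

lemma ring_hom_gen_up:
  assumes "ring_hom h"
  shows "h (gen_up (Vtx w)) = P_up (\<lambda>x. h (kp_s x)) (\<lambda>x. h (kp_t x)) w"
    and "h (gen_up (Path x)) = S_up (\<lambda>x. h (kp_s x)) (\<lambda>x. h (kp_t x)) x"
    and "h (gen_up (Ghost x)) = T_up (\<lambda>x. h (kp_s x)) (\<lambda>x. h (kp_t x)) x"
  by (simp_all add: gen_up_def P_up_def head_proj_def S_up_def T_up_def ring_hom_simps[OF assms])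

lemma gen_down_carrier:
  assumes "g \<in> kp_gens \<Lambda>"
  shows "gen_down g \<in> free_carrier (kp_gens \<Lambda>')"
proof -
  have "lift a w \<in> mor \<Lambda>'" "deg \<Lambda>' (lift a w) \<noteq> 0"
    if "a \<in> mor \<Lambda>" "deg \<Lambda> a \<noteq> 0" "w \<in> fibre (src \<Lambda> a)" for a w
    using that by (auto simp: fibre_def lift_mor lift_simps)
  then show ?thesis
    using assms
    by (cases g) (auto simp: gen_down_def P_down_def S_down_def fibre_def
        intro!: free_carrier_sum free_carrier_gen)
qed

lemma P_up_carrier:
  "w \<in> obj \<Lambda>' \<Longrightarrow> P_up kp_s kp_t w \<in> free_carrier (kp_gens \<Lambda>)"
  unfolding P_up_def head_proj_def
  by (intro free_carrier_sum free_carrier_mult G.gens_carrier)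
    (auto simp: headed_paths_def paths_from_def one_nonzero)

lemma gen_up_carrier:
  assumes "g \<in> kp_gens \<Lambda>'"
  shows "gen_up g \<in> free_carrier (kp_gens \<Lambda>)"
proof -
  have "base x \<in> mor \<Lambda>" "deg \<Lambda> (base x) \<noteq> 0" "src \<Lambda>' x \<in> obj \<Lambda>'"
    if "x \<in> mor \<Lambda>'" "deg \<Lambda>' x \<noteq> 0" for x
    using that by (auto elim!: mor_splitE simp: lift_simps)
  then show ?thesis
    using assms
    by (cases g) (auto simp: gen_up_def S_up_def T_up_def P_up_carrier
        intro!: free_carrier_mult free_carrier_gen)
qed

lemma presented_hom_down:
  "presented_hom (kp_gens \<Lambda>) (kp_rels \<Lambda>) (kp_gens \<Lambda>') (kp_rels \<Lambda>')
    (gen_down :: _ \<Rightarrow> ('f::field, _) free_elem)"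
proof
  obtain \<Phi> :: "('f, ('w, 'b) kp_gen) free_elem \<Rightarrow> ('f, ('w, 'b) kp_gen) free_elem endo"
    where \<Phi>: "ring_hom \<Phi>" "kp_family \<Lambda>' (\<lambda>u. \<Phi> (kp_p u)) (\<lambda>l. \<Phi> (kp_s l)) (\<lambda>l. \<Phi> (kp_t l))"
      "\<And>x. x \<in> free_carrier (kp_gens \<Lambda>') \<Longrightarrow> \<Phi> x = 0 \<Longrightarrow> x \<in> rel_ideal (kp_gens \<Lambda>') (kp_rels \<Lambda>')"
    by (rule G'.kp_ideal_kernel) (rule that)
  fix r :: "('f, ('v, 'a) kp_gen) free_elem" assume r: "r \<in> kp_rels \<Lambda>"
  show "free_lift gen_down r \<in> rel_ideal (kp_gens \<Lambda>') (kp_rels \<Lambda>')"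
  proof (rule \<Phi>(3))
    show "free_lift gen_down r \<in> free_carrier (kp_gens \<Lambda>')"
      using r G.kp_rels_carrier by (blast intro: free_lift_carrier gen_down_carrier)
    have "\<forall>r\<in>kp_rels \<Lambda>. \<Phi> (free_lift gen_down r) = 0"
      using kp_family_down[OF \<Phi>(2)]
        kp_family_iff_kills_kp_rels[OF ring_hom_free_lift[OF \<Phi>(1)], of \<Lambda> gen_down]
      by (simp add: ring_hom_gen_down[OF \<Phi>(1)])
    with r show "\<Phi> (free_lift gen_down r) = 0" by blast
  qed
qed (rule gen_down_carrier)

lemma presented_hom_up:
  "presented_hom (kp_gens \<Lambda>') (kp_rels \<Lambda>') (kp_gens \<Lambda>) (kp_rels \<Lambda>)
    (gen_up :: _ \<Rightarrow> ('f::field, _) free_elem)"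
proof
  obtain \<Phi> :: "('f, ('v, 'a) kp_gen) free_elem \<Rightarrow> ('f, ('v, 'a) kp_gen) free_elem endo"
    where \<Phi>: "ring_hom \<Phi>" "kp_family \<Lambda> (\<lambda>u. \<Phi> (kp_p u)) (\<lambda>l. \<Phi> (kp_s l)) (\<lambda>l. \<Phi> (kp_t l))"
      "\<And>x. x \<in> free_carrier (kp_gens \<Lambda>) \<Longrightarrow> \<Phi> x = 0 \<Longrightarrow> x \<in> rel_ideal (kp_gens \<Lambda>) (kp_rels \<Lambda>)"
    by (rule G.kp_ideal_kernel) (rule that)
  fix r :: "('f, ('w, 'b) kp_gen) free_elem" assume r: "r \<in> kp_rels \<Lambda>'"
  show "free_lift gen_up r \<in> rel_ideal (kp_gens \<Lambda>) (kp_rels \<Lambda>)"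
  proof (rule \<Phi>(3))
    show "free_lift gen_up r \<in> free_carrier (kp_gens \<Lambda>)"
      using r G'.kp_rels_carrier by (blast intro: free_lift_carrier gen_up_carrier)
    have "\<forall>r\<in>kp_rels \<Lambda>'. \<Phi> (free_lift gen_up r) = 0"
      using kp_family_up[OF \<Phi>(2)]
        kp_family_iff_kills_kp_rels[OF ring_hom_free_lift[OF \<Phi>(1)], of \<Lambda>' gen_up]
      by (simp add: ring_hom_gen_up[OF \<Phi>(1)])
    with r show "\<Phi> (free_lift gen_up r) = 0" by blast
  qed
qed (rule gen_up_carrier)

lemma KP_graded_iso:
  "\<exists>h. graded_algebra_iso (KP TYPE('f::field) \<Lambda>) (KP TYPE('f) \<Lambda>') h"
  unfolding G.KP_eq_graded_presented G'.KP_eq_graded_presented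
proof (rule graded_presented_iso[OF presented_hom_down presented_hom_up])
  interpret down: presented_hom "kp_gens \<Lambda>" "kp_rels \<Lambda>" "kp_gens \<Lambda>'" "kp_rels \<Lambda>'"
      "gen_down :: _ \<Rightarrow> ('f, _) free_elem" by (rule presented_hom_down)
  interpret up: presented_hom "kp_gens \<Lambda>'" "kp_rels \<Lambda>'" "kp_gens \<Lambda>" "kp_rels \<Lambda>"
      "gen_up :: _ \<Rightarrow> ('f, _) free_elem" by (rule presented_hom_up)
  obtain \<Phi> :: "('f, ('v, 'a) kp_gen) free_elem \<Rightarrow> ('f, ('v, 'a) kp_gen) free_elem endo"
    where \<Phi>: "ring_hom \<Phi>" "kp_family \<Lambda> (\<lambda>u. \<Phi> (kp_p u)) (\<lambda>l. \<Phi> (kp_s l)) (\<lambda>l. \<Phi> (kp_t l))"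
      "\<And>x. x \<in> free_carrier (kp_gens \<Lambda>) \<Longrightarrow> \<Phi> x = 0 \<Longrightarrow> x \<in> rel_ideal (kp_gens \<Lambda>) (kp_rels \<Lambda>)"
    by (rule G.kp_ideal_kernel) (rule that)
  obtain \<Phi>' :: "('f, ('w, 'b) kp_gen) free_elem \<Rightarrow> ('f, ('w, 'b) kp_gen) free_elem endo"
    where \<Phi>': "ring_hom \<Phi>'" "kp_family \<Lambda>' (\<lambda>u. \<Phi>' (kp_p u)) (\<lambda>l. \<Phi>' (kp_s l)) (\<lambda>l. \<Phi>' (kp_t l))"
      "\<And>x. x \<in> free_carrier (kp_gens \<Lambda>') \<Longrightarrow> \<Phi>' x = 0 \<Longrightarrow> x \<in> rel_ideal (kp_gens \<Lambda>') (kp_rels \<Lambda>')"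
    by (rule G'.kp_ideal_kernel) (rule that)
  note h = ring_hom_free_lift[OF \<Phi>(1), of gen_up] and h' = ring_hom_free_lift[OF \<Phi>'(1), of gen_down]
  show "free_lift gen_up (gen_down g) - free_gen g \<in>
      (rel_ideal (kp_gens \<Lambda>) (kp_rels \<Lambda>) :: ('f, ('v, 'a) kp_gen) free_elem set)"
    if g: "g \<in> kp_gens \<Lambda>" for g
  proof (rule \<Phi>(3))
    show "free_lift gen_up (gen_down g) - free_gen g \<in>
        (free_carrier (kp_gens \<Lambda>) :: ('f, ('v, 'a) kp_gen) free_elem set)"
      by (rule free_carrier_diff[OF up.lift_carrier[OF gen_down_carrier[OF g]] free_carrier_gen[OF g]])
    have "\<Phi> (free_lift gen_up (gen_down g)) = \<Phi> (free_gen g)"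
      using g by (cases g) (auto simp: ring_hom_gen_down[OF h] ring_hom_gen_up[OF \<Phi>(1)]
          P_down_def sum_P_up[OF \<Phi>(2)] S_down_S_up[OF \<Phi>(2)])
    then show "\<Phi> (free_lift gen_up (gen_down g) - free_gen g) = 0"
      by (simp add: ring_hom_diff[OF \<Phi>(1)])
  qed
  show "free_lift gen_down (gen_up g) - free_gen g \<in>
      (rel_ideal (kp_gens \<Lambda>') (kp_rels \<Lambda>') :: ('f, ('w, 'b) kp_gen) free_elem set)"
    if g: "g \<in> kp_gens \<Lambda>'" for g
  proof (rule \<Phi>'(3))
    show "free_lift gen_down (gen_up g) - free_gen g \<in>
        (free_carrier (kp_gens \<Lambda>') :: ('f, ('w, 'b) kp_gen) free_elem set)"
      by (rule free_carrier_diff[OF down.lift_carrier[OF gen_up_carrier[OF g]] free_carrier_gen[OF g]])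
    let ?S = "\<lambda>x. \<Phi>' (kp_s x)" and ?T = "\<lambda>x. \<Phi>' (kp_t x)"
    have P: "P_up (S_down ?S) (S_down ?T) w = \<Phi>' (kp_p w)" if "w \<in> obj \<Lambda>'" for w
      using sum_headed_down[OF \<Phi>'(2) that one_nonzero] by (simp add: P_up_def head_proj_def)
    have "S_up (S_down ?S) (S_down ?T) x = ?S x \<and> T_up (S_down ?S) (S_down ?T) x = ?T x"
      if x: "x \<in> mor \<Lambda>'" "deg \<Lambda>' x \<noteq> 0" for x
    proof -
      obtain a w where a: "x = lift a w" "a \<in> mor \<Lambda>" "w \<in> obj \<Lambda>'" "proj w = src \<Lambda> a"
        using x(1) by (rule mor_splitE)
      then have "deg \<Lambda> a \<noteq> 0" "w \<in> fibre (src \<Lambda> a)"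
        using x by (auto simp: lift_simps fibre_def)
      then show ?thesis
        using a by (simp add: S_up_def T_up_def lift_simps P S_down_mult_P[OF \<Phi>'(2)])
    qed
    then have "\<Phi>' (free_lift gen_down (gen_up g)) = \<Phi>' (free_gen g)"
      using g by (cases g) (auto simp: ring_hom_gen_up[OF h'] ring_hom_gen_down[OF \<Phi>'(1)] P)
    then show "\<Phi>' (free_lift gen_down (gen_up g) - free_gen g) = 0"
      by (simp add: ring_hom_diff[OF \<Phi>'(1)])
  qed
  show "kp_comp \<Lambda> n \<subseteq> free_carrier (kp_gens \<Lambda>)" for n
    by (rule G.kp_comp_carrier)
  show "kp_comp \<Lambda>' n \<subseteq> free_carrier (kp_gens \<Lambda>')" for n
    by (rule G'.kp_comp_carrier)
  show "rel_class (kp_gens \<Lambda>') (kp_rels \<Lambda>') (free_lift gen_down x)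
      \<in> vspan (presented_algebra (kp_gens \<Lambda>') (kp_rels \<Lambda>'))
          (rel_class (kp_gens \<Lambda>') (kp_rels \<Lambda>') ` kp_comp \<Lambda>' n)"
    if x: "x \<in> kp_comp \<Lambda> n" for n and x :: "('f, ('v, 'a) kp_gen) free_elem"
  proof -
    obtain a b where ab: "x = full_val \<Lambda> kp_p kp_s a * full_val \<Lambda> kp_p kp_t b"
        "a \<in> mor \<Lambda>" "b \<in> mor \<Lambda>" "src \<Lambda> a = src \<Lambda> b" "int_deg (deg \<Lambda> a) - int_deg (deg \<Lambda> b) = n"
      using x unfolding kp_comp_def by blast
    let ?y = "\<lambda>w. full_val \<Lambda>' kp_p kp_s (lift a w) * full_val \<Lambda>' kp_p kp_t (lift b w) ::
        ('f, ('w, 'b) kp_gen) free_elem"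
    have y: "?y w \<in> kp_comp \<Lambda>' n" if "w \<in> fibre (src \<Lambda> a)" for w
      using that ab unfolding kp_comp_def fibre_def
      by (intro CollectI exI[of _ "lift a w"] exI[of _ "lift b w"]) (simp add: lift_mor lift_simps)
    have carr: "free_lift gen_down x \<in> free_carrier (kp_gens \<Lambda>')"
      using x G.kp_comp_carrier by (blast intro: down.lift_carrier)
    have ycarr: "(\<Sum>w\<in>fibre (src \<Lambda> a). ?y w) \<in> free_carrier (kp_gens \<Lambda>')"
      using y G'.kp_comp_carrier by (blast intro: free_carrier_sum)
    have "\<Phi>' (free_lift gen_down x) = \<Phi>' (\<Sum>w\<in>fibre (src \<Lambda> a). ?y w)"
      using full_val_down_mult[OF \<Phi>'(2) ab(2-4)]
      by (simp add: ab(1) ring_hom_full_val[OF h'] ring_hom_mult[OF h'] ring_hom_gen_down[OF \<Phi>'(1)]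
          ring_hom_simps[OF \<Phi>'(1)] ring_hom_full_val[OF \<Phi>'(1)])
    then have "free_lift gen_down x - (\<Sum>w\<in>fibre (src \<Lambda> a). ?y w) \<in> rel_ideal (kp_gens \<Lambda>') (kp_rels \<Lambda>')"
      using carr ycarr by (intro \<Phi>'(3) free_carrier_diff) (simp_all add: ring_hom_diff[OF \<Phi>'(1)])
    from rel_classI[OF this carr ycarr] show ?thesis
      using rel_class_sum_vspan[OF y G'.kp_comp_carrier] by simp
  qed
  show "rel_class (kp_gens \<Lambda>) (kp_rels \<Lambda>) (free_lift gen_up x)
      \<in> vspan (presented_algebra (kp_gens \<Lambda>) (kp_rels \<Lambda>))
          (rel_class (kp_gens \<Lambda>) (kp_rels \<Lambda>) ` kp_comp \<Lambda> n)"
    if x: "x \<in> kp_comp \<Lambda>' n" for n and x :: "('f, ('w, 'b) kp_gen) free_elem"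
  proof -
    obtain c d where cd: "x = full_val \<Lambda>' kp_p kp_s c * full_val \<Lambda>' kp_p kp_t d"
        "c \<in> mor \<Lambda>'" "d \<in> mor \<Lambda>'" "src \<Lambda>' c = src \<Lambda>' d" "int_deg (deg \<Lambda>' c) - int_deg (deg \<Lambda>' d) = n"
      using x unfolding kp_comp_def by blast
    obtain a w where a: "c = lift a w" "a \<in> mor \<Lambda>" "w \<in> obj \<Lambda>'" "proj w = src \<Lambda> a"
      using cd(2) by (rule mor_splitE)
    obtain b z where b: "d = lift b z" "b \<in> mor \<Lambda>" "z \<in> obj \<Lambda>'" "proj z = src \<Lambda> b"
      using cd(3) by (rule mor_splitE)
    have z: "z = w" using cd(4) a b by (simp add: lift_simps)
    let ?y = "\<lambda>e. kp_s (cmp \<Lambda> a e) * kp_t (cmp \<Lambda> b e) :: ('f, ('v, 'a) kp_gen) free_elem"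
    have y: "?y e \<in> kp_comp \<Lambda> n" if "e \<in> headed_paths 1 w" for e
    proof -
      note e = headed_pathsD[OF that]
      have comp: "src \<Lambda> a = rng \<Lambda> e" "src \<Lambda> b = rng \<Lambda> e" using e a b z by simp_all
      have "int_deg (deg \<Lambda> (cmp \<Lambda> a e)) - int_deg (deg \<Lambda> (cmp \<Lambda> b e)) = n"
        unfolding deg_cmp[OF a(2) e(1) comp(1)] deg_cmp[OF b(2) e(1) comp(2)]
        using cd(5) deg_lift[OF a(2-4)] deg_lift[OF b(2-4)] a(1) b(1)
        by (auto simp: int_deg_def vec_eq_iff)
      moreover have "deg \<Lambda> (cmp \<Lambda> a e) \<noteq> 0" "deg \<Lambda> (cmp \<Lambda> b e) \<noteq> 0"
        using e(2) one_nonzero by (simp_all add: deg_cmp_nonzero[OF a(2) e(1) comp(1)]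
          deg_cmp_nonzero[OF b(2) e(1) comp(2)])
      ultimately show ?thesis
        using a(2) b(2) e(1) comp unfolding kp_comp_def
        by (intro CollectI exI[of _ "cmp \<Lambda> a e"] exI[of _ "cmp \<Lambda> b e"])
          (simp add: full_val_def cmp_mor src_cmp)
    qed
    have carr: "free_lift gen_up x \<in> free_carrier (kp_gens \<Lambda>)"
      using x G'.kp_comp_carrier by (blast intro: up.lift_carrier)
    have ycarr: "(\<Sum>e\<in>headed_paths 1 w. ?y e) \<in> free_carrier (kp_gens \<Lambda>)"
      using y G.kp_comp_carrier by (blast intro: free_carrier_sum)
    have "\<Phi> (free_lift gen_up x) = \<Phi> (\<Sum>e\<in>headed_paths 1 w. ?y e)"
      using full_val_up_mult[OF \<Phi>(2), of a b w] a b z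
      by (simp add: cd(1) ring_hom_full_val[OF h] ring_hom_mult[OF h] ring_hom_gen_up[OF \<Phi>(1)]
          ring_hom_simps[OF \<Phi>(1)])
    then have "free_lift gen_up x - (\<Sum>e\<in>headed_paths 1 w. ?y e) \<in> rel_ideal (kp_gens \<Lambda>) (kp_rels \<Lambda>)"
      using carr ycarr by (intro \<Phi>(3) free_carrier_diff) (simp_all add: ring_hom_diff[OF \<Phi>(1)])
    from rel_classI[OF this carr ycarr] show ?thesis
      using rel_class_sum_vspan[OF y G.kp_comp_carrier] by simp
  qed
qed

end


section \<open>In-splits as split graphs\<close>

context k_graph
begin

lemma cmp_cancel_deg:
  assumes "a \<in> mor \<Lambda>" "b \<in> mor \<Lambda>" "src \<Lambda> a = rng \<Lambda> b"
    and "c \<in> mor \<Lambda>" "d \<in> mor \<Lambda>" "src \<Lambda> c = rng \<Lambda> d"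
    and "cmp \<Lambda> a b = cmp \<Lambda> c d" "deg \<Lambda> a = deg \<Lambda> c"
  shows "a = c"
proof -
  let ?Q = "\<lambda>(a', b'). a' \<in> mor \<Lambda> \<and> b' \<in> mor \<Lambda> \<and> src \<Lambda> a' = rng \<Lambda> b' \<and>
      deg \<Lambda> a' = deg \<Lambda> a \<and> deg \<Lambda> b' = deg \<Lambda> b \<and> cmp \<Lambda> a b = cmp \<Lambda> a' b'"
  have "deg \<Lambda> a + deg \<Lambda> b = deg \<Lambda> c + deg \<Lambda> d"
    using assms deg_cmp[of a b] deg_cmp[of c d] by simp
  then have "deg \<Lambda> d = deg \<Lambda> b" by (simp add: assms(8))
  have "\<exists>!p. ?Q p"
    using assms(1-3) by (intro factorization) (auto simp: cmp_mor deg_cmp)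
  moreover have "?Q (a, b)" "?Q (c, d)"
    using assms \<open>deg \<Lambda> d = deg \<Lambda> b\<close> by auto
  ultimately have "(a, b) = (c, d)" by (rule ex1_unique)
  then show ?thesis by simp
qed

lemma edge_prefix:
  assumes "c \<in> mor \<Lambda>" "deg \<Lambda> c $ j \<noteq> 0"
  obtains g d where "g \<in> mor \<Lambda>" "d \<in> mor \<Lambda>" "src \<Lambda> g = rng \<Lambda> d" "deg \<Lambda> g = axis j 1"
    "deg \<Lambda> c = axis j 1 + deg \<Lambda> d" "c = cmp \<Lambda> g d"
proof -
  have "deg \<Lambda> c = axis j 1 + (deg \<Lambda> c - axis j 1)"
    using assms(2) by (auto simp: vec_eq_iff axis_def)
  from factorization[OF assms(1) this] obtain g d where
    "g \<in> mor \<Lambda>" "d \<in> mor \<Lambda>" "src \<Lambda> g = rng \<Lambda> d" "deg \<Lambda> g = axis j 1" "c = cmp \<Lambda> g d"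
    by auto
  then show thesis
    using that deg_cmp[of g d] by auto
qed

end

locale insplitting = k_graph \<Lambda> for \<Lambda> :: "('v, 'a, 'k::finite) kgraph" +
  fixes v :: 'v and E1 E2 :: "'a set"
  assumes row_finite: "row_finite_no_sources \<Lambda>"
    and v_obj: "v \<in> obj \<Lambda>"
    and partition: "insplit_partition \<Lambda> v E1 E2"
begin

lemma edge_nonzero: "e \<in> edges \<Lambda> \<Longrightarrow> deg \<Lambda> e \<noteq> 0"
  by (auto simp: edges_def)

lemma edge_mor: "e \<in> edges \<Lambda> \<Longrightarrow> e \<in> mor \<Lambda>"
  by (simp add: edges_def)

lemma E1_edge: "e \<in> E1 \<Longrightarrow> e \<in> edges \<Lambda> \<and> rng \<Lambda> e = v"
  using partition by (auto simp: insplit_partition_def)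

lemma pairing:
  assumes "l \<in> edges \<Lambda>" "rng \<Lambda> l = v" "m \<in> edges \<Lambda>" "rng \<Lambda> m = v" "a \<in> edges \<Lambda>" "b \<in> edges \<Lambda>"
    "src \<Lambda> l = rng \<Lambda> a" "src \<Lambda> m = rng \<Lambda> b" "cmp \<Lambda> l a = cmp \<Lambda> m b"
  shows "l \<in> E1 \<longleftrightarrow> m \<in> E1"
proof -
  have "l \<in> E1 \<and> m \<in> E1 \<or> l \<in> E2 \<and> m \<in> E2"
    using partition assms unfolding insplit_partition_def by blast
  moreover have "E1 \<inter> E2 = {}"
    using partition by (simp add: insplit_partition_def)
  ultimately show ?thesis by blast
qed

lemma initial_edges_same_block:
  assumes e: "e \<in> edges \<Lambda>" "rng \<Lambda> e = v" and f: "f \<in> edges \<Lambda>" "rng \<Lambda> f = v"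
    and c: "c \<in> mor \<Lambda>" "src \<Lambda> e = rng \<Lambda> c" and d: "d \<in> mor \<Lambda>" "src \<Lambda> f = rng \<Lambda> d"
    and eq: "cmp \<Lambda> e c = cmp \<Lambda> f d"
  shows "e \<in> E1 \<longleftrightarrow> f \<in> E1"
proof -
  obtain i j where ij: "deg \<Lambda> e = axis i 1" "deg \<Lambda> f = axis j 1"
    using e f by (auto simp: edges_def)
  note mor = edge_mor[OF e(1)] edge_mor[OF f(1)]
  show ?thesis
  proof (cases "i = j")
    case True
    with ij have "e = f"
      using cmp_cancel_deg[OF mor(1) c mor(2) d eq] by simp
    then show ?thesis by simp
  next
    case False
    have deg_eq: "axis i 1 + deg \<Lambda> c = axis j 1 + deg \<Lambda> d"
      using deg_cmp[OF mor(1) c] deg_cmp[OF mor(2) d] eq ij by simp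
    then have "(axis i 1 + deg \<Lambda> c) $ j = (axis j 1 + deg \<Lambda> d) $ j"
      "(axis i 1 + deg \<Lambda> c) $ i = (axis j 1 + deg \<Lambda> d) $ i" by simp_all
    with False have nz: "deg \<Lambda> c $ j \<noteq> 0" "deg \<Lambda> d $ i \<noteq> 0"
      by (auto simp: axis_def)
    obtain g c' where g: "g \<in> mor \<Lambda>" "c' \<in> mor \<Lambda>" "src \<Lambda> g = rng \<Lambda> c'" "deg \<Lambda> g = axis j 1"
        "deg \<Lambda> c = axis j 1 + deg \<Lambda> c'" "c = cmp \<Lambda> g c'"
      by (rule edge_prefix[OF c(1) nz(1)])
    obtain h d' where h: "h \<in> mor \<Lambda>" "d' \<in> mor \<Lambda>" "src \<Lambda> h = rng \<Lambda> d'" "deg \<Lambda> h = axis i 1"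
        "deg \<Lambda> d = axis i 1 + deg \<Lambda> d'" "d = cmp \<Lambda> h d'"
      by (rule edge_prefix[OF d(1) nz(2)])
    have comp: "src \<Lambda> e = rng \<Lambda> g" "src \<Lambda> f = rng \<Lambda> h"
      using c(2) d(2) g h rng_cmp by auto
    have "cmp \<Lambda> (cmp \<Lambda> e g) c' = cmp \<Lambda> (cmp \<Lambda> f h) d'"
      using eq g h comp mor by (simp add: cmp_assoc)
    then have "cmp \<Lambda> e g = cmp \<Lambda> f h"
      using mor g h comp ij
      by (intro cmp_cancel_deg[of "cmp \<Lambda> e g" c' "cmp \<Lambda> f h" d'])
        (simp_all add: cmp_mor src_cmp deg_cmp add.commute)
    moreover have "g \<in> edges \<Lambda>" "h \<in> edges \<Lambda>"
      using g h by (auto simp: edges_def)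
    ultimately show ?thesis
      using e f comp by (intro pairing[of e f g h]) auto
  qed
qed

definition starts_in_E1 :: "'a \<Rightarrow> bool" where
  "starts_in_E1 a \<longleftrightarrow> (\<exists>e\<in>E1. \<exists>b\<in>mor \<Lambda>. src \<Lambda> e = rng \<Lambda> b \<and> a = cmp \<Lambda> e b)"

definition head :: "'a \<Rightarrow> 'v split" where
  "head a = (if rng \<Lambda> a \<noteq> v then Keep (rng \<Lambda> a)
     else if starts_in_E1 a then Copy v 1 else Copy v 2)"

lemma starts_in_E1_edge:
  assumes "f \<in> edges \<Lambda>" "rng \<Lambda> f = v" "c \<in> mor \<Lambda>" "src \<Lambda> f = rng \<Lambda> c"
  shows "starts_in_E1 (cmp \<Lambda> f c) \<longleftrightarrow> f \<in> E1"
proof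
  assume "starts_in_E1 (cmp \<Lambda> f c)"
  then obtain e b where "e \<in> E1" "b \<in> mor \<Lambda>" "src \<Lambda> e = rng \<Lambda> b" "cmp \<Lambda> f c = cmp \<Lambda> e b"
    by (auto simp: starts_in_E1_def)
  then show "f \<in> E1"
    using initial_edges_same_block[of f e c b] assms E1_edge[of e] by auto
qed (use assms in \<open>auto simp: starts_in_E1_def\<close>)

lemma first_edge:
  assumes "a \<in> mor \<Lambda>" "deg \<Lambda> a \<noteq> 0"
  obtains f j c where "f \<in> edges \<Lambda>" "c \<in> mor \<Lambda>" "src \<Lambda> f = rng \<Lambda> c" "rng \<Lambda> f = rng \<Lambda> a"
    "deg \<Lambda> a = axis j 1 + deg \<Lambda> c" "a = cmp \<Lambda> f c"
proof -
  obtain j where "deg \<Lambda> a $ j \<noteq> 0" using assms(2) by (auto simp: vec_eq_iff)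
  from edge_prefix[OF assms(1) this] obtain f c where
    "f \<in> mor \<Lambda>" "c \<in> mor \<Lambda>" "src \<Lambda> f = rng \<Lambda> c" "deg \<Lambda> f = axis j 1"
    "deg \<Lambda> a = axis j 1 + deg \<Lambda> c" "a = cmp \<Lambda> f c" .
  then show thesis
    by (intro that[of f c j]) (auto simp: edges_def rng_cmp)
qed

lemma head_cmp_edge:
  assumes "f \<in> edges \<Lambda>" "c \<in> mor \<Lambda>" "src \<Lambda> f = rng \<Lambda> c"
  shows "head (cmp \<Lambda> f c) =
    (if rng \<Lambda> f \<noteq> v then Keep (rng \<Lambda> f) else if f \<in> E1 then Copy v 1 else Copy v 2)"
  using assms starts_in_E1_edge[of f c] by (simp add: head_def rng_cmp edge_mor)

lemma head_cmp:
  assumes "a \<in> mor \<Lambda>" "b \<in> mor \<Lambda>" "src \<Lambda> a = rng \<Lambda> b" "deg \<Lambda> a \<noteq> 0"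
  shows "head (cmp \<Lambda> a b) = head a"
proof -
  obtain f j c where f: "f \<in> edges \<Lambda>" "c \<in> mor \<Lambda>" "src \<Lambda> f = rng \<Lambda> c" "a = cmp \<Lambda> f c"
    using first_edge[OF assms(1,4)] by metis
  then have cb: "src \<Lambda> c = rng \<Lambda> b"
    using assms(3) by (simp add: src_cmp edge_mor)
  have "cmp \<Lambda> a b = cmp \<Lambda> f (cmp \<Lambda> c b)"
    using f cb assms(2) by (simp add: cmp_assoc edge_mor)
  then show ?thesis
    using f cb assms(2) head_cmp_edge[of f c] head_cmp_edge[of f "cmp \<Lambda> c b"]
    by (simp add: cmp_mor rng_cmp)
qed

lemma split_rng_eq_head: "par e \<in> edges \<Lambda> \<Longrightarrow> split_rng \<Lambda> v E1 e = head (par e)"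
  using head_cmp_edge[of "par e" "idm \<Lambda> (src \<Lambda> (par e))"]
  by (simp add: split_rng_def edge_mor cmp_idm_right idm_mor src_obj rng_idm)

lemma split_obj_par: "w \<in> split_obj \<Lambda> v \<Longrightarrow> par w \<in> obj \<Lambda>"
  using v_obj by (auto simp: split_obj_def)

lemma split_obj_cases:
  assumes "w \<in> split_obj \<Lambda> v"
  shows "(par w \<noteq> v \<and> w = Keep (par w)) \<or> (\<exists>i\<in>{1, 2}. w = Copy v i)"
  using assms by (auto simp: split_obj_def)

lemma head_split_obj: "a \<in> mor \<Lambda> \<Longrightarrow> head a \<in> split_obj \<Lambda> v"
  by (auto simp: head_def split_obj_def rng_obj)

lemma par_head: "par (head a) = rng \<Lambda> a"
  by (simp add: head_def)

lemma split_edgeD: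
  assumes "e \<in> split_edges \<Lambda> v"
  shows "par e \<in> edges \<Lambda>" "split_src \<Lambda> v e \<in> split_obj \<Lambda> v" "par (split_src \<Lambda> v e) = src \<Lambda> (par e)"
  using assms by (auto simp: split_edges_def split_obj_def edges_def src_obj)

lemma epath_src_Cons:
  "epath_src \<Lambda> v (w, e # es) = epath_src \<Lambda> v (split_src \<Lambda> v e, es)"
  by simp

lemma epath_props:
  assumes "is_epath \<Lambda> v E1 (w, es)"
  shows "epath_par \<Lambda> v (w, es) \<in> mor \<Lambda> \<and> epath_src \<Lambda> v (w, es) \<in> split_obj \<Lambda> v \<and>
    rng \<Lambda> (epath_par \<Lambda> v (w, es)) = par w \<and>
    src \<Lambda> (epath_par \<Lambda> v (w, es)) = par (epath_src \<Lambda> v (w, es)) \<and>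
    deg \<Lambda> (epath_par \<Lambda> v (w, es)) = epath_deg \<Lambda> (w, es) \<and>
    w = (if deg \<Lambda> (epath_par \<Lambda> v (w, es)) = 0 then epath_src \<Lambda> v (w, es)
      else head (epath_par \<Lambda> v (w, es)))"
  using assms
proof (induction es arbitrary: w)
  case Nil
  then show ?case
    by (simp add: split_obj_par idm_mor rng_idm src_idm deg_idm epath_deg_def)
next
  case (Cons e es)
  let ?q = "(split_src \<Lambda> v e, es)"
  from Cons.prems have e: "e \<in> split_edges \<Lambda> v" and w: "w = split_rng \<Lambda> v E1 e"
    and q: "is_epath \<Lambda> v E1 ?q" by auto
  note IH = Cons.IH[OF q]
  note ed = split_edgeD[OF e]
  have comp: "src \<Lambda> (par e) = rng \<Lambda> (epath_par \<Lambda> v ?q)"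
    using IH ed(3) by simp
  have mor: "par e \<in> mor \<Lambda>" "epath_par \<Lambda> v ?q \<in> mor \<Lambda>"
    using IH edge_mor[OF ed(1)] by auto
  have "deg \<Lambda> (cmp \<Lambda> (par e) (epath_par \<Lambda> v ?q)) \<noteq> 0"
    using mor comp edge_nonzero[OF ed(1)] by (simp add: deg_cmp_nonzero)
  moreover have "head (cmp \<Lambda> (par e) (epath_par \<Lambda> v ?q)) = w"
    using mor comp edge_nonzero[OF ed(1)] by (simp add: head_cmp w split_rng_eq_head[OF ed(1)])
  moreover have "par w = rng \<Lambda> (par e)"
    by (simp add: w split_rng_eq_head[OF ed(1)] par_head)
  ultimately show ?case
    using IH mor comp unfolding epath_src_Cons
    by (simp add: cmp_mor rng_cmp src_cmp deg_cmp epath_deg_def del: epath_src.simps)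
qed

definition lift_rng :: "'a \<Rightarrow> 'v split \<Rightarrow> 'v split" where
  "lift_rng a w = (if deg \<Lambda> a = 0 then w else head a)"

lemma epath_exists:
  assumes "a \<in> mor \<Lambda>" "w \<in> split_obj \<Lambda> v" "par w = src \<Lambda> a"
  shows "\<exists>es. is_epath \<Lambda> v E1 (lift_rng a w, es) \<and> epath_par \<Lambda> v (lift_rng a w, es) = a \<and>
    epath_src \<Lambda> v (lift_rng a w, es) = w"
  using assms(1,3)
proof (induction "\<Sum>i\<in>UNIV. deg \<Lambda> a $ i" arbitrary: a rule: less_induct)
  case less
  show ?case
  proof (cases "deg \<Lambda> a = 0")
    case True
    with deg_0_idm[OF less.prems(1) True] assms(2) less.prems show ?thesis
      by (intro exI[of _ "[]"]) (simp add: lift_rng_def)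
  next
    case False
    obtain f j c where f: "f \<in> edges \<Lambda>" "c \<in> mor \<Lambda>" "src \<Lambda> f = rng \<Lambda> c" "rng \<Lambda> f = rng \<Lambda> a"
        "deg \<Lambda> a = axis j 1 + deg \<Lambda> c" "a = cmp \<Lambda> f c"
      by (rule first_edge[OF less.prems(1) False])
    have fm: "f \<in> mor \<Lambda>" by (rule edge_mor[OF f(1)])
    have "(\<Sum>i\<in>UNIV. deg \<Lambda> c $ i) < (\<Sum>i\<in>UNIV. deg \<Lambda> a $ i)"
      by (simp add: f(5) sum.distrib axis_def)
    moreover have pc: "par w = src \<Lambda> c"
      using less.prems(2) f fm by (simp add: src_cmp)
    ultimately obtain es where es: "is_epath \<Lambda> v E1 (lift_rng c w, es)"
        "epath_par \<Lambda> v (lift_rng c w, es) = c" "epath_src \<Lambda> v (lift_rng c w, es) = w"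
      using less.hyps[of c] f(2) by blast
    have lc: "lift_rng c w \<in> split_obj \<Lambda> v" "par (lift_rng c w) = src \<Lambda> f"
      using f assms(2) pc deg_0_idm(2)[of c] by (auto simp: lift_rng_def head_split_obj par_head)
    obtain e where e: "e \<in> split_edges \<Lambda> v" "par e = f" "split_src \<Lambda> v e = lift_rng c w"
    proof (cases "src \<Lambda> f = v")
      case True
      then obtain i where "i \<in> {1, 2}" "lift_rng c w = Copy v i"
        using split_obj_cases[OF lc(1)] lc(2) by auto
      with True f(1) show thesis
        by (intro that[of "Copy f i"]) (auto simp: split_edges_def)
    next
      case False
      then have "lift_rng c w = Keep (src \<Lambda> f)"
        using split_obj_cases[OF lc(1)] lc(2) by auto
      with False f(1) show thesis
        by (intro that[of "Keep f"]) (auto simp: split_edges_def)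
    qed
    have "split_rng \<Lambda> v E1 e = lift_rng a w"
      using split_rng_eq_head[of e] e(2) f fm False head_cmp[OF fm f(2,3) edge_nonzero[OF f(1)]]
      by (simp add: lift_rng_def)
    then show ?thesis
      using e es f(6) by (intro exI[of _ "e # es"]) (simp add: epath_src_Cons del: epath_src.simps)
  qed
qed

lemma epath_cmp_props:
  assumes "is_epath \<Lambda> v E1 (w, es)" "is_epath \<Lambda> v E1 (z, fs)" "epath_src \<Lambda> v (w, es) = z"
  shows "is_epath \<Lambda> v E1 (w, es @ fs) \<and> epath_src \<Lambda> v (w, es @ fs) = epath_src \<Lambda> v (z, fs) \<and>
    epath_par \<Lambda> v (w, es @ fs) = cmp \<Lambda> (epath_par \<Lambda> v (w, es)) (epath_par \<Lambda> v (z, fs))"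
  using assms
proof (induction es arbitrary: w)
  case Nil
  then show ?case
    using epath_props[OF assms(2)] cmp_idm_left[of "epath_par \<Lambda> v (z, fs)"] by simp
next
  case (Cons e es)
  let ?q = "(split_src \<Lambda> v e, es)"
  from Cons.prems have e: "e \<in> split_edges \<Lambda> v" and w: "split_rng \<Lambda> v E1 e = w"
    and q: "is_epath \<Lambda> v E1 ?q" by auto
  have s: "epath_src \<Lambda> v ?q = z"
    using Cons.prems(3) unfolding epath_src_Cons .
  note IH = Cons.IH[OF q Cons.prems(2) s]
  note ed = split_edgeD[OF e]
  have "cmp \<Lambda> (par e) (cmp \<Lambda> (epath_par \<Lambda> v ?q) (epath_par \<Lambda> v (z, fs))) =
      cmp \<Lambda> (cmp \<Lambda> (par e) (epath_par \<Lambda> v ?q)) (epath_par \<Lambda> v (z, fs))"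
    using epath_props[OF q] epath_props[OF assms(2)] s ed
    by (intro cmp_assoc[symmetric]) (auto simp: edge_mor simp del: epath_src.simps)
  then show ?case
    using IH e w unfolding append_Cons epath_src_Cons
    by (simp del: epath_src.simps)
qed

definition lift_path :: "'a \<Rightarrow> 'v split \<Rightarrow> ('v, 'a) epath set" where
  "lift_path a w = {p. is_epath \<Lambda> v E1 p \<and> epath_par \<Lambda> v p = a \<and> epath_src \<Lambda> v p = w}"

lemma lift_path_nonempty:
  "\<lbrakk>a \<in> mor \<Lambda>; w \<in> split_obj \<Lambda> v; par w = src \<Lambda> a\<rbrakk> \<Longrightarrow> lift_path a w \<noteq> {}"
  using epath_exists[of a w] by (auto simp: lift_path_def simp del: epath_src.simps)

lemma lift_pathD:
  assumes "p \<in> lift_path a w"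
  shows "is_epath \<Lambda> v E1 p" "epath_par \<Lambda> v p = a" "epath_src \<Lambda> v p = w"
    "fst p = lift_rng a w" "epath_deg \<Lambda> p = deg \<Lambda> a"
proof -
  show p: "is_epath \<Lambda> v E1 p" "epath_par \<Lambda> v p = a" "epath_src \<Lambda> v p = w"
    using assms by (simp_all only: lift_path_def mem_Collect_eq)
  obtain x es where x: "p = (x, es)" by (cases p)
  have props: "x = (if deg \<Lambda> (epath_par \<Lambda> v (x, es)) = 0 then epath_src \<Lambda> v (x, es)
      else head (epath_par \<Lambda> v (x, es)))"
    "deg \<Lambda> (epath_par \<Lambda> v (x, es)) = epath_deg \<Lambda> (x, es)"
    using epath_props[OF p(1)[unfolded x]] by blast+
  show "fst p = lift_rng a w"
    unfolding x fst_conv lift_rng_def by (rule props(1)[folded x, unfolded p(2,3)])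
  show "epath_deg \<Lambda> p = deg \<Lambda> a"
    using props(2) p(2) unfolding x by simp
qed

lemma epath_rel_class:
  assumes "is_epath \<Lambda> v E1 p"
  shows "epath_rel \<Lambda> v E1 `` {p} = lift_path (epath_par \<Lambda> v p) (epath_src \<Lambda> v p)"
proof -
  have "p \<in> lift_path (epath_par \<Lambda> v p) (epath_src \<Lambda> v p)"
    using assms by (simp add: lift_path_def del: epath_src.simps)
  then have "fst q = fst p" if "q \<in> lift_path (epath_par \<Lambda> v p) (epath_src \<Lambda> v p)" for q
    using lift_pathD(4)[OF that] lift_pathD(4)[of p] by simp
  then have "(p, q) \<in> epath_rel \<Lambda> v E1 \<longleftrightarrow> q \<in> lift_path (epath_par \<Lambda> v p) (epath_src \<Lambda> v p)" for q
    using assms unfolding epath_rel_def lift_path_def mem_Collect_eq case_prod_conv by metis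
  then show ?thesis by blast
qed

lemma mor_insplit:
  "mor (insplit \<Lambda> v E1) =
    {lift_path a w | a w. a \<in> mor \<Lambda> \<and> w \<in> split_obj \<Lambda> v \<and> par w = src \<Lambda> a}"
proof (intro equalityI subsetI)
  fix X assume "X \<in> mor (insplit \<Lambda> v E1)"
  then obtain p where p: "is_epath \<Lambda> v E1 p" "X = epath_rel \<Lambda> v E1 `` {p}"
    by (auto simp: insplit_def quotient_def)
  then show "X \<in> {lift_path a w | a w. a \<in> mor \<Lambda> \<and> w \<in> split_obj \<Lambda> v \<and> par w = src \<Lambda> a}"
    using epath_props[of "fst p" "snd p"]
    by (intro CollectI exI[of _ "epath_par \<Lambda> v p"] exI[of _ "epath_src \<Lambda> v p"])
      (simp add: epath_rel_class del: epath_src.simps)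
next
  fix X assume "X \<in> {lift_path a w | a w. a \<in> mor \<Lambda> \<and> w \<in> split_obj \<Lambda> v \<and> par w = src \<Lambda> a}"
  then obtain a w where X: "X = lift_path a w" "a \<in> mor \<Lambda>" "w \<in> split_obj \<Lambda> v" "par w = src \<Lambda> a"
    by blast
  then obtain p where p: "p \<in> lift_path a w"
    using lift_path_nonempty by blast
  have "X = epath_rel \<Lambda> v E1 `` {p}"
    using X(1) epath_rel_class[of p] lift_pathD[OF p] by simp
  then show "X \<in> mor (insplit \<Lambda> v E1)"
    using lift_pathD(1)[OF p] unfolding insplit_def quotient_def kgraph.simps by blast
qed

lemma the_elem_image_const: "X \<noteq> {} \<Longrightarrow> (\<And>x. x \<in> X \<Longrightarrow> f x = c) \<Longrightarrow> the_elem (f ` X) = c"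
proof -
  assume "X \<noteq> {}" "\<And>x. x \<in> X \<Longrightarrow> f x = c"
  then have "f ` X = {c}" by auto
  then show ?thesis by simp
qed

lemma cmp_lift_path:
  assumes "a \<in> mor \<Lambda>" "b \<in> mor \<Lambda>" "src \<Lambda> a = rng \<Lambda> b" "deg \<Lambda> b \<noteq> 0"
    "w \<in> split_obj \<Lambda> v" "par w = src \<Lambda> b"
  shows "cmp (insplit \<Lambda> v E1) (lift_path a (head b)) (lift_path b w) = lift_path (cmp \<Lambda> a b) w"
proof -
  have *: "epath_rel \<Lambda> v E1 `` {epath_cmp p q} = lift_path (cmp \<Lambda> a b) w"
    if p: "p \<in> lift_path a (head b)" and q: "q \<in> lift_path b w" for p q
  proof -
    obtain x es y fs where pq: "p = (x, es)" "q = (y, fs)" by (cases p; cases q)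
    have "y = head b"
      using lift_pathD(4)[OF q] assms(4) by (simp add: lift_rng_def pq)
    then have "is_epath \<Lambda> v E1 (epath_cmp p q)" "epath_src \<Lambda> v (epath_cmp p q) = w"
      "epath_par \<Lambda> v (epath_cmp p q) = cmp \<Lambda> a b"
      using epath_cmp_props[of x es y fs] lift_pathD(1-3)[OF p] lift_pathD(1-3)[OF q]
      by (simp_all add: pq epath_cmp_def del: epath_src.simps)
    then show ?thesis by (simp add: epath_rel_class)
  qed
  have ne: "lift_path a (head b) \<noteq> {}" "lift_path b w \<noteq> {}"
    using assms by (intro lift_path_nonempty; simp add: head_split_obj par_head)+
  have "cmp (insplit \<Lambda> v E1) (lift_path a (head b)) (lift_path b w) =
      (\<Union>p\<in>lift_path a (head b). \<Union>q\<in>lift_path b w. epath_rel \<Lambda> v E1 `` {epath_cmp p q})"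
    by (simp add: insplit_def)
  also have "\<dots> = (\<Union>p\<in>lift_path a (head b). \<Union>q\<in>lift_path b w. lift_path (cmp \<Lambda> a b) w)"
    by (intro SUP_cong refl) (rule *)
  also have "\<dots> = lift_path (cmp \<Lambda> a b) w"
    using ne by simp
  finally show ?thesis .
qed

lemma obj_insplit: "obj (insplit \<Lambda> v E1) = split_obj \<Lambda> v"
  by (simp add: insplit_def)

lemma split_graph_insplit:
  "split_graph \<Lambda> (insplit \<Lambda> v E1) par (\<lambda>X. the_elem (epath_par \<Lambda> v ` X)) head lift_path"
proof unfold_locales
  show "finite (paths_from \<Lambda> u n)" if "u \<in> obj \<Lambda>" for u n
    using row_finite that by (simp add: row_finite_no_sources_def)
  show "par w \<in> obj \<Lambda>" if "w \<in> obj (insplit \<Lambda> v E1)" for w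
    using that by (simp add: insplit_def split_obj_par)
  show "finite {w \<in> obj (insplit \<Lambda> v E1). par w = u}" for u
    by (rule finite_subset[of _ "{Keep u, Copy v 1, Copy v 2}"])
      (auto simp: insplit_def split_obj_def)
  show "head a \<in> obj (insplit \<Lambda> v E1)" if "a \<in> mor \<Lambda>" for a
    using that by (simp add: insplit_def head_split_obj)
  show "mor (insplit \<Lambda> v E1) =
      {lift_path a w | a w. a \<in> mor \<Lambda> \<and> w \<in> obj (insplit \<Lambda> v E1) \<and> par w = src \<Lambda> a}"
    unfolding mor_insplit by (simp add: insplit_def)
  fix a w assume aw: "a \<in> mor \<Lambda>" "w \<in> obj (insplit \<Lambda> v E1)" "par w = src \<Lambda> a"
  then have ne: "lift_path a w \<noteq> {}"
    by (intro lift_path_nonempty) (simp_all add: insplit_def)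
  show "the_elem (epath_par \<Lambda> v ` lift_path a w) = a"
    by (rule the_elem_image_const[OF ne lift_pathD(2)])
  show "src (insplit \<Lambda> v E1) (lift_path a w) = w"
    unfolding insplit_def kgraph.simps by (rule the_elem_image_const[OF ne lift_pathD(3)])
  show "rng (insplit \<Lambda> v E1) (lift_path a w) = (if deg \<Lambda> a = 0 then w else head a)"
    unfolding insplit_def kgraph.simps lift_rng_def[symmetric]
    by (rule the_elem_image_const[OF ne lift_pathD(4)])
  show "deg (insplit \<Lambda> v E1) (lift_path a w) = deg \<Lambda> a"
    unfolding insplit_def kgraph.simps by (rule the_elem_image_const[OF ne lift_pathD(5)])
qed (simp_all add: par_head head_cmp obj_insplit cmp_lift_path)

end


section \<open>Restriction of scalars along a graded isomorphism\<close>

lemma vspan_subset_cong: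
  assumes "vzero V = vzero W" "vadd V = vadd W" "vscale V = vscale W"
  shows "vspan V S \<subseteq> vspan W S"
proof
  fix x assume "x \<in> vspan V S"
  then show "x \<in> vspan W S"
    by induction (simp_all add: assms vspan.intros)
qed

lemma vspan_cong:
  assumes "vzero V = vzero W" "vadd V = vadd W" "vscale V = vscale W"
  shows "vspan V S = vspan W S"
  using vspan_subset_cong[OF assms] vspan_subset_cong[OF assms[symmetric]] by (rule equalityI)

lemma graded_algebra_iso_inverse:
  assumes h: "graded_algebra_iso A B h" and A: "galgebra_closed A"
  shows "graded_algebra_iso B A (inv_into (vcarrier A) h)"
proof -
  let ?g = "inv_into (vcarrier A) h"
  have bij: "bij_betw h (vcarrier A) (vcarrier B)"
    using h by (simp add: graded_algebra_iso_def)
  have gh: "?g (h x) = x" if "x \<in> vcarrier A" for x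
    using bij that by (simp add: bij_betw_def)
  have hg: "h (?g y) = y" "?g y \<in> vcarrier A" if "y \<in> vcarrier B" for y
    using bij that by (auto simp: bij_betw_def f_inv_into_f inv_into_into)
  have vlin: "h (vadd A x y) = vadd B (h x) (h y)" "h (vscale A c x) = vscale B c (h x)"
      "h (amult A x y) = amult B (h x) (h y)" if "x \<in> vcarrier A" "y \<in> vcarrier A" for c x y
    using h that by (simp_all add: graded_algebra_iso_def vlinear_def)
  have cl: "vadd A x y \<in> vcarrier A" "amult A x y \<in> vcarrier A" "vscale A c x \<in> vcarrier A"
    if "x \<in> vcarrier A" "y \<in> vcarrier A" for c x y
    using A that by (simp_all add: galgebra_closed_def)
  have "?g ` acomp B n = acomp A n" for n
  proof -
    have "acomp B n = h ` acomp A n" "acomp A n \<subseteq> vcarrier A"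
      using h A by (simp_all add: graded_algebra_iso_def galgebra_closed_def)
    then show ?thesis using gh by (force simp: image_image)
  qed
  moreover have "?g (vadd B x y) = vadd A (?g x) (?g y)" "?g (vscale B c x) = vscale A c (?g x)"
    "?g (amult B x y) = amult A (?g x) (?g y)"
    if "x \<in> vcarrier B" "y \<in> vcarrier B" for c x y
    using that hg vlin[of "?g x" "?g y"] cl[of "?g x" "?g y"] gh by metis+
  ultimately show ?thesis
    using bij_betw_inv_into[OF bij] hg by (auto simp: graded_algebra_iso_def vlinear_def)
qed

definition restrict_module ::
  "('y \<Rightarrow> 'x) \<Rightarrow> ('f, 'u, 'x, 'k::finite) grmodule \<Rightarrow> ('f, 'u, 'y, 'k) grmodule" where
  "restrict_module g M = \<lparr> vcarrier = vcarrier M, vzero = vzero M, vadd = vadd M,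
     vscale = vscale M, act = (\<lambda>m b. act M m (g b)), mcomp = mcomp M \<rparr>"

lemma restrict_module_simps [simp]:
  "vcarrier (restrict_module g M) = vcarrier M"
  "vzero (restrict_module g M) = vzero M"
  "vadd (restrict_module g M) = vadd M"
  "vscale (restrict_module g M) = vscale M"
  "act (restrict_module g M) m b = act M m (g b)"
  "mcomp (restrict_module g M) = mcomp M"
  by (simp_all add: restrict_module_def)

lemma restrict_module_vspace [simp]:
  "vspan (restrict_module g M) S = vspan M S"
  "is_vspace (restrict_module g M) = is_vspace M"
  "vsubspace (restrict_module g M) S = vsubspace M S"
  "direct_sum (restrict_module g M) C = direct_sum M C"
  "vlinear (restrict_module g M) (restrict_module g N) f = vlinear M N f"
proof -
  show span: "vspan (restrict_module g M) S = vspan M S" for S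
    by (rule vspan_cong) simp_all
  show sub: "vsubspace (restrict_module g M) S = vsubspace M S" for S
    by (simp add: vsubspace_def span)
  show "is_vspace (restrict_module g M) = is_vspace M"
    by (simp only: is_vspace_def restrict_module_simps)
  show "direct_sum (restrict_module g M) C = direct_sum M C"
    by (simp only: direct_sum_def restrict_module_simps sub span)
  show "vlinear (restrict_module g M) (restrict_module g N) f = vlinear M N f"
    by (simp only: vlinear_def restrict_module_simps)
qed

definition restrict_functor ::
  "('y \<Rightarrow> 'x) \<Rightarrow>
    (('f, 'u, 'x, 'k::finite) grmodule, 'u \<Rightarrow> 'u, ('f, 'u, 'y, 'k) grmodule, 'u \<Rightarrow> 'u) hfunctor" where
  "restrict_functor g = \<lparr> fob = restrict_module g, fmor = (\<lambda>M N f. f) \<rparr>"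

context
  fixes A :: "('f::field, 'x, 'k::finite) galgebra" and B :: "('f, 'y, 'k) galgebra" and g :: "'y \<Rightarrow> 'x"
  assumes iso: "graded_algebra_iso B A g"
begin

lemma restrict_scalar_map:
  "b \<in> vcarrier B \<Longrightarrow> g b \<in> vcarrier A"
  "\<lbrakk>b \<in> vcarrier B; c \<in> vcarrier B\<rbrakk> \<Longrightarrow> g (vadd B b c) = vadd A (g b) (g c)"
  "b \<in> vcarrier B \<Longrightarrow> g (vscale B r b) = vscale A r (g b)"
  "\<lbrakk>b \<in> vcarrier B; c \<in> vcarrier B\<rbrakk> \<Longrightarrow> g (amult B b c) = amult A (g b) (g c)"
  "b \<in> acomp B n \<Longrightarrow> g b \<in> acomp A n"
  using iso imageI[of b "acomp B n" g] by (simp_all add: graded_algebra_iso_def vlinear_def)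

lemma restrict_module_graded:
  "is_graded_module A M \<Longrightarrow> is_graded_module B (restrict_module g M)"
  unfolding is_graded_module_def
  by (simp add: restrict_scalar_map)

lemma restrict_module_unital:
  assumes "unital_module A M"
  shows "unital_module B (restrict_module g M)"
proof -
  have "g ` vcarrier B = vcarrier A"
    using iso by (simp add: graded_algebra_iso_def bij_betw_def)
  then have "{act M m (g b) | m b. m \<in> vcarrier M \<and> b \<in> vcarrier B} =
      {act M m a | m a. m \<in> vcarrier M \<and> a \<in> vcarrier A}"
    by (auto simp: set_eq_iff image_iff) (metis imageE)+
  with assms show ?thesis by (simp add: unital_module_def)
qed

lemma restrict_graded_hom:
  "f \<in> graded_hom A M N \<Longrightarrow> f \<in> graded_hom B (restrict_module g M) (restrict_module g N)"
  by (simp add: graded_hom_def restrict_scalar_map)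

lemma is_functor_restrict:
  "is_functor (grmod_cat TYPE('u) A) (grmod_cat TYPE('u) B) (restrict_functor g)"
  by (simp add: is_functor_def grmod_cat_def restrict_functor_def restrict_module_graded
      restrict_module_unital restrict_graded_hom)

lemma restrict_commutes_with_shifts:
  "commutes_with_shifts (grmod_cat TYPE('u) A) (restrict_functor g)"
  by (simp add: commutes_with_shifts_def functor_eq_def functor_comp_def shift_def
      restrict_functor_def restrict_module_def)

end

lemma restrict_functor_inverse:
  fixes A :: "('f::field, 'x, 'k::finite) galgebra" and g :: "'y \<Rightarrow> 'x" and h :: "'x \<Rightarrow> 'y"
  assumes gh: "\<And>a. a \<in> vcarrier A \<Longrightarrow> g (h a) = a"
  shows "naturally_isomorphic (grmod_cat TYPE('u) A) (grmod_cat TYPE('u) A)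
    (functor_comp (restrict_functor h) (restrict_functor g)) functor_id"
proof -
  let ?R = "\<lambda>M :: ('f, 'u, 'x, 'k) grmodule. restrict_module h (restrict_module g M)"
  let ?i = "\<lambda>M :: ('f, 'u, 'x, 'k) grmodule. restrict (\<lambda>m. m) (vcarrier M)"
  have lin: "vlinear M M' (?i M)"
    if "is_vspace M" "vcarrier M' = vcarrier M" "vadd M' = vadd M" "vscale M' = vscale M"
    for M M' :: "('f, 'u, 'x, 'k) grmodule"
    using that by (simp add: vlinear_def is_vspace_def)
  have obj: "?i M \<in> graded_hom A (?R M) M \<and> ?i M \<in> graded_hom A M (?R M)"
    if M: "is_graded_module A M" for M
  proof -
    have "is_vspace M" "\<And>m a. m \<in> vcarrier M \<Longrightarrow> a \<in> vcarrier A \<Longrightarrow> act M m a \<in> vcarrier M"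
        "\<And>n. mcomp M n \<subseteq> vcarrier M"
      using M by (simp_all add: is_graded_module_def direct_sum_def vsubspace_def)
    then show ?thesis
      using lin[of M "?R M"] lin[of "?R M" M]
      by (auto simp: graded_hom_def gh)
  qed
  have comp: "compose (vcarrier M) (?i M) (?i M) = ?i M" for M
    by (auto simp: compose_def restrict_def)
  have nat: "compose (vcarrier M) (?i N) f = compose (vcarrier M) f (?i M)"
    if "f \<in> graded_hom A M N" for M N f
    using that by (auto simp: graded_hom_def vlinear_def compose_def restrict_def)
  show ?thesis
    unfolding naturally_isomorphic_def
  proof (intro exI[of _ ?i] conjI ballI)
    fix M assume M: "M \<in> Ob (grmod_cat TYPE('u) A)"
    show "?i M \<in> Hom (grmod_cat TYPE('u) A)
        (fob (functor_comp (restrict_functor h) (restrict_functor g)) M) (fob functor_id M)"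
      using M obj
      by (simp add: grmod_cat_def functor_comp_def restrict_functor_def functor_id_def)
    show "\<exists>k\<in>Hom (grmod_cat TYPE('u) A) (fob functor_id M)
        (fob (functor_comp (restrict_functor h) (restrict_functor g)) M).
       Comp (grmod_cat TYPE('u) A) (fob (functor_comp (restrict_functor h) (restrict_functor g)) M)
        (fob functor_id M) (fob (functor_comp (restrict_functor h) (restrict_functor g)) M) k (?i M) =
       Ident (grmod_cat TYPE('u) A) (fob (functor_comp (restrict_functor h) (restrict_functor g)) M) \<and>
       Comp (grmod_cat TYPE('u) A) (fob functor_id M)
        (fob (functor_comp (restrict_functor h) (restrict_functor g)) M) (fob functor_id M) (?i M) k =
       Ident (grmod_cat TYPE('u) A) (fob functor_id M)"
      using M obj comp
      by (intro bexI[of _ "?i M"])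
        (simp_all add: grmod_cat_def functor_comp_def restrict_functor_def functor_id_def)
  qed (simp add: grmod_cat_def functor_comp_def restrict_functor_def functor_id_def nat)
qed

lemma graded_morita_equivalent_of_iso:
  assumes h: "graded_algebra_iso A B h" and A: "galgebra_closed A"
  shows "graded_morita_equivalent TYPE('u) A B"
proof -
  let ?g = "inv_into (vcarrier A) h"
  have g: "graded_algebra_iso B A ?g" by (rule graded_algebra_iso_inverse[OF h A])
  have bij: "bij_betw h (vcarrier A) (vcarrier B)"
    using h by (simp add: graded_algebra_iso_def)
  have gh: "?g (h a) = a" if "a \<in> vcarrier A" for a
    using bij that by (simp add: bij_betw_def)
  have hg: "h (?g b) = b" if "b \<in> vcarrier B" for b
    using bij that by (simp add: bij_betw_def f_inv_into_f)
  show ?thesis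
    unfolding graded_morita_equivalent_def
    by (intro exI[of _ "restrict_functor ?g"] exI[of _ "restrict_functor h"] conjI
        is_functor_restrict[OF g] is_functor_restrict[OF h] restrict_commutes_with_shifts[OF g]
        restrict_commutes_with_shifts[OF h] restrict_functor_inverse gh hg)
qed

theorem proposition3p1:
  fixes \<Lambda> :: "('v, 'a, 'k::finite) kgraph"
    and v :: 'v
    and E1 E2 :: "'a set"
  assumes "k_graph \<Lambda>"
    and "row_finite_no_sources \<Lambda>"
    and "v \<in> obj \<Lambda>"
    and "insplit_partition \<Lambda> v E1 E2"
  shows "(\<exists>\<pi>. graded_algebra_iso (KP TYPE('f::field) \<Lambda>) (KP TYPE('f) (insplit \<Lambda> v E1)) \<pi>) \<and>
    graded_morita_equivalent TYPE('u) (KP TYPE('f) \<Lambda>) (KP TYPE('f) (insplit \<Lambda> v E1))"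
proof -
  interpret k_graph \<Lambda> by fact
  interpret insplitting \<Lambda> v E1 E2
    using assms by unfold_locales
  obtain \<pi> where \<pi>: "graded_algebra_iso (KP TYPE('f) \<Lambda>) (KP TYPE('f) (insplit \<Lambda> v E1)) \<pi>"
    using split_graph.KP_graded_iso[OF split_graph_insplit] by blast
  moreover have "galgebra_closed (KP TYPE('f) \<Lambda>)"
    unfolding composable.KP_eq_graded_presented[OF composable]
    by (rule galgebra_closed_graded_presented) (rule composable.kp_comp_carrier[OF composable])
  ultimately show ?thesis
    using graded_morita_equivalent_of_iso by blast
qed

end
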